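(* Let $k=2^{32}$ and $d=3\cdot 2^{5268390106224805281791998}$, let $U_1,\ldots,U_k\in \mathrm{U}(d)$ and $F\in M_d(\mathbb{C})$ be the explicit matrices defined in the context, and let $\Phi:M_d(\mathbb{C})\to M_k(\mathbb{C})$ be the channel $$[\Phi(\rho)]_{ij}:=\frac1k\operatorname{Tr}(U_iF\rho FU_j^* )+\frac{\delta_{ij}}{k}\operatorname{Tr}((I_d-F^2)\rho),\qquad i,j=1,\ldots,k.$$ Then $\Phi$ violates additivity of the minimum output Rényi-$p$ entropy for all $1\le p\le\infty$, with a uniform lower bound on the gap: for every $p\in[1,\infty]$, $$2H_{p,\min}(\Phi)-H_{p,\min}(\Phi\otimes\Phi)\ge\frac{3}{17179869184}.$$
   Context: All logarithms are natural. A density matrix is a positive semidefinite matrix of trace one; a quantum channel is a completely positive trace-preserving linear map. For a density matrix $\sigma$, the Rényi-$p$ entropy is $H_p(\sigma)=\frac{1}{1-p}\log\operatorname{Tr}(\sigma^p)$ for $p\in(0,\infty)$, $p\neq1$, with $H_1(\sigma)=-\operatorname{Tr}(\sigma\log\sigma)$ and $H_\infty(\sigma)=-\log\|\sigma\|$ (limits). $H_{p,\min}(\Phi)=\min_\rho H_p(\Phi(\rho))$ over all input density matrices $\rho$. Parameters: $k=2^{32}$, $r=k(k-1)$, $m=350r$, $\eta=64k$, $L=25/8$, $n=272m$, $M=2^n=(16k^2)^{4m}$. Unitaries: for $j=1,\dots,k$ let $$a_j=\begin{pmatrix}1+4j&-8j^2\\2&1-4j\end{pmatrix}\in \mathrm{SL}_2(\mathbb{Z}),$$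 reduced modulo $M$, so that $a_j\in G:=\mathrm{SL}_2(\mathbb{Z}/M\mathbb{Z})$. One has $|G|=3\cdot 2^{3n-2}=d$. Identify $\mathbb{C}^d$ with $\ell^2(G)$, with standard orthonormal basis $\{|g\rangle:g\in G\}$. Define $U_j|g\rangle=|a_jg\rangle$ for $g\in G$, $j=1,\dots,k$. Damping matrix: for a $k\times k$ matrix $A$ put $T_A=\sum_{i\ne j}A_{ij}U_i^*U_j$. For $1\le a<b\le k$ let $E^{\mathrm R}_{ab}=\frac1{\sqrt2}(|a\rangle\langle b|+|b\rangle\langle a|)$ and $E^{\mathrm I}_{ab}=\frac{i}{\sqrt2}(|a\rangle\langle b|-|b\rangle\langle a|)$. For $q=(x_{ab},y_{ab})_{a<b}\in\{-\eta,\ldots,\eta\}^r\setminus\{0\}$ (integer vectors) let $$A_q=\frac{\sum_{a<b}(x_{ab}E^{\mathrm R}_{ab}+y_{ab}E^{\mathrm I}_{ab})}{\sqrt{\sum_{a<b}(x_{ab}^2+y_{ab}^2)}}.$$ Define $$R=\sum_{q\in\{-\eta,\ldots,\eta\}^r\setminus\{0\}}\left(\frac{T_{A_q}}{L}\right)^{2m},\qquad F=(I_d+R)^{-1}.$$ *)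

theory Defs
  imports "HOL-Analysis.Analysis" "HOL-Library.Word"
begin

section \<open>Complex matrices\<close>

definition adj_mat :: "complex^'n^'m \<Rightarrow> complex^'m^'n" where
  "adj_mat A = (\<chi> i j. cnj (A $ j $ i))"

definition smult_mat :: "complex \<Rightarrow> complex^'n^'m \<Rightarrow> complex^'n^'m" where
  "smult_mat c A = (\<chi> i j. c * A $ i $ j)"

text \<open>The library's \<open>^\<close> on the type of square matrices is the entrywise power.\<close>

definition mat_pow :: "complex^'n^'n \<Rightarrow> nat \<Rightarrow> complex^'n^'n" where
  "mat_pow A n = ((\<lambda>B. A ** B) ^^ n) (mat 1)"

definition ketbra :: "'n \<Rightarrow> 'm \<Rightarrow> complex^'m^'n" where
  "ketbra a b = (\<chi> i j. if i = a \<and> j = b then 1 else 0)"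

definition diag_mat :: "('n \<Rightarrow> complex) \<Rightarrow> complex^'n^'n" where
  "diag_mat e = (\<chi> i j. if i = j then e i else 0)"

definition unitary_mat :: "complex^'n^'n \<Rightarrow> bool" where
  "unitary_mat V \<longleftrightarrow> adj_mat V ** V = mat 1 \<and> V ** adj_mat V = mat 1"

definition cdot :: "complex^'n \<Rightarrow> complex^'n \<Rightarrow> complex" where
  "cdot v w = (\<Sum>i\<in>UNIV. cnj (v $ i) * w $ i)"

definition psd_mat :: "complex^'n^'n \<Rightarrow> bool" where
  "psd_mat A \<longleftrightarrow> adj_mat A = A \<and> (\<forall>v. cdot v (A *v v) \<in> \<real>\<^sub>\<ge>\<^sub>0)"

definition density_matrix :: "complex^'n^'n \<Rightarrow> bool" where
  "density_matrix \<rho> \<longleftrightarrow> psd_mat \<rho> \<and> trace \<rho> = 1"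

text \<open>Functional calculus for Hermitian matrices; the matrix \<open>B\<close> below exists by the spectral
  theorem and does not depend on the chosen diagonalization.\<close>

definition herm_fun :: "(real \<Rightarrow> real) \<Rightarrow> complex^'n^'n \<Rightarrow> complex^'n^'n" where
  "herm_fun f A = (THE B. \<exists>V (e :: 'n \<Rightarrow> real). unitary_mat V \<and>
      A = V ** diag_mat (\<lambda>i. complex_of_real (e i)) ** adj_mat V \<and>
      B = V ** diag_mat (\<lambda>i. complex_of_real (f (e i))) ** adj_mat V)"

definition kron_mat :: "complex^'n^'m \<Rightarrow> complex^'q^'p \<Rightarrow> complex^('n \<times> 'q)^('m \<times> 'p)" where
  "kron_mat A B = (\<chi> i j. A $ fst i $ fst j * B $ snd i $ snd j)"


section \<open>Quantum channels and entropies\<close>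

definition clinear_map :: "(complex^'n^'n \<Rightarrow> complex^'m^'m) \<Rightarrow> bool" where
  "clinear_map \<Phi> \<longleftrightarrow> (\<forall>A B. \<Phi> (A + B) = \<Phi> A + \<Phi> B) \<and> (\<forall>c A. \<Phi> (smult_mat c A) = smult_mat c (\<Phi> A))"

text \<open>\<open>block_psd N X\<close> says that the \<open>N \<times> N\<close> block matrix with blocks \<open>X i j\<close> (\<open>i, j < N\<close>) is
  positive semidefinite; over the complex numbers, Hermiticity is implied.  Complete positivity is
  positivity of the ampliation to \<open>N \<times> N\<close> block matrices for every \<open>N\<close>.\<close>

definition block_psd :: "nat \<Rightarrow> (nat \<Rightarrow> nat \<Rightarrow> complex^'n^'n) \<Rightarrow> bool" where
  "block_psd N X \<longleftrightarrow>
     (\<forall>v :: nat \<Rightarrow> complex^'n. (\<Sum>i<N. \<Sum>j<N. cdot (v i) (X i j *v v j)) \<in> \<real>\<^sub>\<ge>\<^sub>0)"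

definition completely_positive :: "(complex^'n^'n \<Rightarrow> complex^'m^'m) \<Rightarrow> bool" where
  "completely_positive \<Phi> \<longleftrightarrow> (\<forall>N X. block_psd N X \<longrightarrow> block_psd N (\<lambda>i j. \<Phi> (X i j)))"

definition quantum_channel :: "(complex^'n^'n \<Rightarrow> complex^'m^'m) \<Rightarrow> bool" where
  "quantum_channel \<Phi> \<longleftrightarrow>
     clinear_map \<Phi> \<and> completely_positive \<Phi> \<and> (\<forall>A. trace (\<Phi> A) = trace A)"

text \<open>For linear \<open>\<Phi>\<close> and \<open>\<Psi>\<close> this is the linear map that sends each Kronecker product of \<open>A\<close> and \<open>B\<close>
  to the Kronecker product of \<open>\<Phi> A\<close> and \<open>\<Psi> B\<close>, expanded in matrix units.\<close>

definition tensor_map ::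
  "(complex^'n^'n \<Rightarrow> complex^'m^'m) \<Rightarrow> (complex^'q^'q \<Rightarrow> complex^'p^'p) \<Rightarrow>
   complex^('n \<times> 'q)^('n \<times> 'q) \<Rightarrow> complex^('m \<times> 'p)^('m \<times> 'p)" where
  "tensor_map \<Phi> \<Psi> X = (\<Sum>i\<in>UNIV. \<Sum>j\<in>UNIV.
     smult_mat (X $ i $ j)
       (kron_mat (\<Phi> (ketbra (fst i) (fst j))) (\<Psi> (ketbra (snd i) (snd j)))))"

text \<open>\<open>0 powr p = 0\<close> and \<open>ln 0 = 0\<close> give the usual conventions at zero eigenvalues.\<close>

definition renyi_entropy :: "ereal \<Rightarrow> complex^'n^'n \<Rightarrow> real" where
  "renyi_entropy p \<sigma> =
     (if p = \<infinity> then - ln (onorm (\<lambda>v. \<sigma> *v v))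
      else if p = 1 then - Re (trace (\<sigma> ** herm_fun ln \<sigma>))
      else 1 / (1 - real_of_ereal p) *
             ln (Re (trace (herm_fun (\<lambda>x. x powr real_of_ereal p) \<sigma>))))"

text \<open>The infimum is a minimum for a channel, by compactness of the set of density matrices and
  continuity of the entropies.\<close>

definition min_output_entropy :: "ereal \<Rightarrow> (complex^'n^'n \<Rightarrow> complex^'m^'m) \<Rightarrow> real" where
  "min_output_entropy p \<Phi> = (INF \<rho>\<in>{\<rho>. density_matrix \<rho>}. renyi_entropy p (\<Phi> \<rho>))"


section \<open>The parameters\<close>

definition k_par :: nat where "k_par = 2 ^ 32"
definition r_par :: nat where "r_par = k_par * (k_par - 1)"
definition m_par :: nat where "m_par = 350 * r_par"
definition eta_par :: int where "eta_par = 64 * int k_par"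
definition L_par :: real where "L_par = 25 / 8"
definition n_par :: nat where "n_par = 272 * m_par"

text \<open>The index type of the output space, in bijection with \<open>{1..k_par}\<close>.\<close>

typedef idx = "{1..k_par}" morphisms num_of_idx idx_of_num
  by (auto simp: k_par_def)

instance idx :: finite
proof
  have "UNIV = idx_of_num ` {1..k_par}"
    using type_definition.Abs_image[OF type_definition_idx] by simp
  then show "finite (UNIV :: idx set)" by (metis finite_imageI finite_atLeastAtMost)
qed

text \<open>The ring of integers modulo \<open>M = 2 ^ n_par\<close>: the type \<open>'a word\<close> is the ring of integers modulo
  \<open>2 ^ LENGTH('a)\<close>.\<close>

type_synonym Z_M = "1756130035408268427264000 word"

lemma length_Z_M: "LENGTH(1756130035408268427264000) = n_par"
  by (simp add: n_par_def m_par_def r_par_def k_par_def)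

typedef SL2 = "{A :: Z_M^2^2. det A = 1}"
  by (rule exI[of _ "mat 1"]) simp

instance SL2 :: finite
proof
  have "UNIV = Abs_SL2 ` {A :: Z_M^2^2. det A = 1}"
    using type_definition.Abs_image[OF type_definition_SL2] by simp
  then show "finite (UNIV :: SL2 set)" by (metis finite_imageI finite)
qed


section \<open>The unitaries and the damping matrix\<close>

definition a_int :: "idx \<Rightarrow> int^2^2" where
  "a_int i = (let j = int (num_of_idx i) in
     vector [vector [1 + 4 * j, - 8 * j ^ 2],
             vector [2,         1 - 4 * j]])"

definition a_mod :: "idx \<Rightarrow> Z_M^2^2" where
  "a_mod j = (\<chi> s t. of_int (a_int j $ s $ t))"

definition U_mat :: "idx \<Rightarrow> complex^SL2^SL2" where
  "U_mat j = (\<chi> h g. if Rep_SL2 h = a_mod j ** Rep_SL2 g then 1 else 0)"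

definition T_mat :: "complex^idx^idx \<Rightarrow> complex^SL2^SL2" where
  "T_mat A = (\<Sum>i\<in>UNIV. \<Sum>j\<in>UNIV - {i}. smult_mat (A $ i $ j) (adj_mat (U_mat i) ** U_mat j))"

definition E_R :: "idx \<times> idx \<Rightarrow> complex^idx^idx" where
  "E_R = (\<lambda>(a, b). smult_mat (1 / complex_of_real (sqrt 2)) (ketbra a b + ketbra b a))"

definition E_I :: "idx \<times> idx \<Rightarrow> complex^idx^idx" where
  "E_I = (\<lambda>(a, b). smult_mat (\<i> / complex_of_real (sqrt 2)) (ketbra a b - ketbra b a))"

definition pairs :: "(idx \<times> idx) set" where
  "pairs = {(a, b). num_of_idx a < num_of_idx b}"

text \<open>The index set \<open>{-eta_par..eta_par}\<close> to the power \<open>r_par\<close>, without the zero vector: there are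
  \<open>r_par div 2\<close> pairs, each carrying one coordinate of \<open>x\<close> and one of \<open>y\<close>.\<close>

definition Q_set :: "((idx \<times> idx \<Rightarrow> int) \<times> (idx \<times> idx \<Rightarrow> int)) set" where
  "Q_set = (pairs \<rightarrow>\<^sub>E {- eta_par..eta_par}) \<times> (pairs \<rightarrow>\<^sub>E {- eta_par..eta_par})
             - {(\<lambda>e\<in>pairs. 0, \<lambda>e\<in>pairs. 0)}"

definition A_mat :: "(idx \<times> idx \<Rightarrow> int) \<times> (idx \<times> idx \<Rightarrow> int) \<Rightarrow> complex^idx^idx" where
  "A_mat = (\<lambda>(x, y).
     (1 / sqrt (\<Sum>e\<in>pairs. (real_of_int (x e))\<^sup>2 + (real_of_int (y e))\<^sup>2)) *\<^sub>R
       (\<Sum>e\<in>pairs. real_of_int (x e) *\<^sub>R E_R e + real_of_int (y e) *\<^sub>R E_I e))"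

definition R_mat :: "complex^SL2^SL2" where
  "R_mat = (\<Sum>q\<in>Q_set. mat_pow ((1 / L_par) *\<^sub>R T_mat (A_mat q)) (2 * m_par))"

definition F_mat :: "complex^SL2^SL2" where
  "F_mat = matrix_inv (mat 1 + R_mat)"

end

theory Submission
  imports Defs
begin

text \<open>
  For a state \<open>\<rho>\<close>, the off-diagonal part of \<open>\<Phi> \<rho>\<close> is determined by the expectations of the matrices
  \<open>F T\<^sub>A F\<close>.  The damping \<open>F = (1 + R)\<^sup>-\<^sup>1\<close> forces \<open>\<parallel>F T\<^sub>A F\<parallel> \<le> L\<close> on a net of directions \<open>A\<close>, hence
  \<open>\<parallel>\<Phi> \<rho> - 1/k\<parallel>\<^sub>2 \<le> 129/127 L/k\<close>, so all outputs of \<open>\<Phi>\<close> have nearly maximal entropy.  On the other hand \<open>F\<close> is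
  close to the identity in normalized trace norm.  Indeed the matrices \<open>a\<^sub>j\<close> generate a free group by ping-pong, and words
  of length at most \<open>4m\<close> have entries smaller than \<open>M\<close>, so the moments of \<open>T\<^sub>A\<close> up to order \<open>2m\<close> agree with those on
  the free group; there \<open>T\<^sub>A\<close> is a sum of three operators (word length changing by \<open>2\<close>, \<open>0\<close>, \<open>-2\<close>), each of
  norm at most \<open>\<parallel>A\<parallel>\<^sub>2\<close>.  Thus \<open>tr R\<close> is bounded by the size of the net times \<open>(3/L)\<^bsup>2m\<^esup>\<close>, which is tiny.
  Since the \<open>U\<^sub>j\<close> are real, \<open>U\<^sub>j \<otimes> U\<^sub>j\<close> fixes the maximally entangled vector, and \<open>\<Phi> \<otimes> \<Phi>\<close> maps the
  maximally entangled state to a state with an eigenvalue close to \<open>1/k\<close>, whose entropy is therefore too small.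
\<close>

section \<open>Adjoints, inner products and the spectral theorem\<close>

text \<open>The norm of \<open>T_mat A\<close> itself is too large: the \<open>U_mat j\<close> are
  permutation matrices, so the constant vector is an eigenvector whose eigenvalue is the sum of the
  off-diagonal entries of \<open>A\<close>, which can be of order k although \<open>A\<close> has
  Hilbert-Schmidt norm 1. Only a spectral average, the normalized trace of a high power, is
  controlled; \<open>F_mat\<close> suppresses the few bad vectors for all directions of the net at
  once.

  The size of k is dictated by p = 1. With c = 129/127 L, a deviation of at most c/k costs at most
  c^2/k of entropy in each of the two copies, about 20.2/k altogether, while an eigenvalue near 1/k
  lowers the entropy of the k^2-dimensional output by about (ln k - 1)/k. So ln k must exceed about
  21.2; k = 2^32 gives ln k >= 22, and 3/(4k) is left as the gap. L must exceed 3, the rate on the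
  free group, but only slightly, as c grows with it. The ratio 3/L = 24/25 then fixes
  \<open>m_par\<close>, which has to beat a net with about 2^39 values per coordinate, and the word
  length 4m fixes the modulus.\<close>

lemma adj_mat_nth [simp]: "adj_mat A $ i $ j = cnj (A $ j $ i)"
  by (simp add: adj_mat_def)

lemma smult_mat_nth [simp]: "smult_mat c A $ i $ j = c * A $ i $ j"
  by (simp add: smult_mat_def)

lemma ketbra_nth: "ketbra a b $ i $ j = (if i = a \<and> j = b then 1 else 0)"
  by (simp add: ketbra_def)

lemma diag_mat_nth: "diag_mat e $ i $ j = (if i = j then e i else 0)"
  by (simp add: diag_mat_def)

lemma matrix_mult_nth: "(A ** B) $ i $ j = (\<Sum>k\<in>UNIV. A $ i $ k * B $ k $ j)"
  by (simp add: matrix_matrix_mult_def)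

lemma matrix_vector_mult_nth: "(A *v x) $ i = (\<Sum>j\<in>UNIV. A $ i $ j * x $ j)"
  by (simp add: matrix_vector_mult_def)

lemma trace_eq_sum: "trace A = (\<Sum>i\<in>UNIV. A $ i $ i)"
  by (simp add: trace_def)

lemma adj_mat_adj_mat [simp]: "adj_mat (adj_mat A) = A"
  by (simp add: vec_eq_iff)

lemma adj_mat_mult: "adj_mat (A ** B) = adj_mat B ** adj_mat A"
  by (simp add: vec_eq_iff matrix_mult_nth mult.commute)

lemma adj_mat_add: "adj_mat (A + B) = adj_mat A + adj_mat B"
  by (simp add: vec_eq_iff)

lemma adj_mat_scaleR: "adj_mat (c *\<^sub>R A) = c *\<^sub>R adj_mat A"
  by (simp add: vec_eq_iff)

lemma adj_mat_sum: "adj_mat (\<Sum>a\<in>S. f a) = (\<Sum>a\<in>S. adj_mat (f a))"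
  by (simp add: vec_eq_iff)

lemma adj_mat_diag_of_real: "adj_mat (diag_mat (\<lambda>i. complex_of_real (e i))) = diag_mat (\<lambda>i. of_real (e i))"
  by (simp add: vec_eq_iff diag_mat_nth)

lemma diag_mat_mult: "diag_mat e ** diag_mat f = diag_mat (\<lambda>i. e i * f i)"
  by (simp add: vec_eq_iff matrix_mult_nth diag_mat_nth mult_delta_left mult_delta_right)

lemma mult_diag_mat_nth: "(A ** diag_mat e) $ i $ j = A $ i $ j * e j"
  by (simp add: matrix_mult_nth diag_mat_nth mult_delta_right)

lemma diag_mat_mult_nth: "(diag_mat e ** A) $ i $ j = e i * A $ i $ j"
  by (simp add: matrix_mult_nth diag_mat_nth mult_delta_left)

lemma diag_mat_mult_vec_nth: "(diag_mat e *v x) $ i = e i * x $ i"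
  by (simp add: matrix_vector_mult_nth diag_mat_nth mult_delta_left)

lemma matrix_mult_add_left: "(A + B) ** C = A ** C + B ** (C :: complex^'p^'n)"
  by (simp add: vec_eq_iff matrix_mult_nth sum.distrib algebra_simps)

lemma matrix_mult_diff_left: "(A - B) ** C = A ** C - B ** (C :: complex^'p^'n)"
  by (simp add: vec_eq_iff matrix_mult_nth sum_subtractf algebra_simps)

lemma matrix_mult_sum_left: "(\<Sum>a\<in>S. f a) ** B = (\<Sum>a\<in>S. f a ** B)"
  by (simp add: vec_eq_iff matrix_mult_nth sum_distrib_right) (intro allI sum.swap)

lemma matrix_vector_mult_sum_left: "(\<Sum>a\<in>S. f a) *v x = (\<Sum>a\<in>S. f a *v x)"
  by (simp add: vec_eq_iff matrix_vector_mult_nth sum_distrib_right) (intro allI sum.swap)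

lemma trace_sum: "trace (\<Sum>a\<in>S. f a) = (\<Sum>a\<in>S. trace (f a))"
  by (simp add: trace_eq_sum) (rule sum.swap)

lemma trace_mult_commute:
  fixes A :: "'a::comm_semiring_1^'n^'m"
  shows "trace (A ** B) = trace (B ** A)"
  by (simp add: trace_eq_sum matrix_mult_nth) (subst sum.swap, simp add: mult.commute)

lemma trace_smult_mat: "trace (smult_mat c A) = c * trace A"
  by (simp add: trace_eq_sum sum_distrib_left)

lemma smult_mat_mult_left: "smult_mat c A ** B = smult_mat c (A ** B)"
  by (simp add: vec_eq_iff matrix_mult_nth sum_distrib_left mult.assoc)

lemma smult_mat_mult_right: "A ** smult_mat c B = smult_mat c (A ** B)"
  by (simp add: vec_eq_iff matrix_mult_nth sum_distrib_left mult.left_commute)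

lemma matrix_vector_mult_scaleR_right:
  fixes A :: "complex^'n^'m"
  shows "A *v (c *\<^sub>R x) = c *\<^sub>R (A *v x)"
  by (simp add: vec_eq_iff matrix_vector_mult_nth scaleR_sum_right)

lemma matrix_vector_mult_scaleR_left:
  fixes A :: "complex^'n^'m"
  shows "(c *\<^sub>R A) *v x = c *\<^sub>R (A *v x)"
  by (simp add: vec_eq_iff matrix_vector_mult_nth scaleR_sum_right)

section \<open>The Hermitian inner product\<close>

lemma cdot_add_right: "cdot v (w + x) = cdot v w + cdot v x"
  by (simp add: cdot_def sum.distrib algebra_simps)

lemma cdot_diff_right: "cdot v (w - x) = cdot v w - cdot v x"
  by (simp add: cdot_def sum_subtractf algebra_simps)

lemma cdot_diff_left: "cdot (v - w) x = cdot v x - cdot w x"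
  by (simp add: cdot_def sum_subtractf algebra_simps)

lemma cdot_add_left: "cdot (v + w) x = cdot v x + cdot w x"
  by (simp add: cdot_def sum.distrib algebra_simps)

lemma cdot_scaleR_right: "cdot v (c *\<^sub>R w) = c *\<^sub>R cdot v w"
  by (simp add: cdot_def scaleR_sum_right)

lemma cdot_scaleR_left: "cdot (c *\<^sub>R v) w = c *\<^sub>R cdot v w"
  by (simp add: cdot_def scaleR_sum_right)

lemma cdot_sum_right: "cdot v (\<Sum>a\<in>S. f a) = (\<Sum>a\<in>S. cdot v (f a))"
  by (simp add: cdot_def sum_distrib_left) (rule sum.swap)

lemma cnj_cdot: "cnj (cdot v w) = cdot w v"
  by (simp add: cdot_def mult.commute)

lemma cdot_self: "cdot v v = of_real ((norm v)\<^sup>2)"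
  by (simp add: cdot_def norm_vec_def L2_set_def sum_nonneg complex_norm_square[symmetric] mult.commute[of "cnj _"])

lemma cdot_adj_mat: "cdot v (A *v w) = cdot (adj_mat A *v v) w"
  by (simp add: cdot_def matrix_vector_mult_nth sum_distrib_left sum_distrib_right mult_ac)
     (rule sum.swap)

lemma continuous_on_cdot [continuous_intros]:
  "continuous_on S f \<Longrightarrow> continuous_on S g \<Longrightarrow> continuous_on S (\<lambda>x. cdot (f x) (g x))"
  unfolding cdot_def by (intro continuous_intros)

lemma continuous_on_matrix_vector_mult [continuous_intros]:
  fixes A :: "complex^'n^'m"
  shows "continuous_on S f \<Longrightarrow> continuous_on S (\<lambda>x. A *v f x)"
  unfolding matrix_vector_mult_def by (intro continuous_intros continuous_on_vec_lambda)

text \<open>A dimension count: the endomorphism \<open>h\<close> never reaches a vector with nonzero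
  coordinate \<open>a\<close>, so it is not surjective and hence not injective.\<close>

lemma exists_orthogonal_vector:
  fixes v :: "'n::finite \<Rightarrow> complex^'n"
  assumes "a \<notin> I"
  shows "\<exists>x. x \<noteq> 0 \<and> (\<forall>i\<in>I. cdot (v i) x = 0)"
proof -
  define h :: "complex^'n \<Rightarrow> complex^'n" where "h x = (\<chi> i. if i \<in> I then cdot (v i) x else 0)" for x
  have lin: "linear h"
    by (rule linearI) (auto simp: h_def vec_eq_iff cdot_add_right cdot_scaleR_right)
  have "\<not> surj h"
  proof
    assume "surj h"
    then obtain x where "h x = (\<chi> i. 1)" by (metis surjD)
    then have "h x $ a = 1" by simp
    with assms show False by (simp add: h_def)
  qed
  then have "\<not> inj h" using linear_injective_imp_surjective[OF lin] by blast
  then obtain x where "x \<noteq> 0" "h x = 0" using linear_injective_0[OF lin] by blast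
  then have "\<forall>i\<in>I. cdot (v i) x = 0" by (auto simp: h_def vec_eq_iff split: if_splits)
  with \<open>x \<noteq> 0\<close> show ?thesis by blast
qed

text \<open>A maximizer of the quadratic form on the unit sphere of an invariant subspace is an
  eigenvector: \<open>\<mu> - A\<close> is positive semidefinite there and its form vanishes at the maximizer.\<close>

lemma exists_orthogonal_eigenvector:
  fixes A :: "complex^'n^'n" and v :: "'n \<Rightarrow> complex^'n" and e :: "'n \<Rightarrow> real"
  assumes herm: "adj_mat A = A" and "a \<notin> I"
    and eig: "\<And>i. i \<in> I \<Longrightarrow> A *v v i = e i *\<^sub>R v i"
  shows "\<exists>x \<mu>. norm x = 1 \<and> (\<forall>i\<in>I. cdot (v i) x = 0) \<and> A *v x = (\<mu>::real) *\<^sub>R x"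
proof -
  define V where "V = {x. \<forall>i\<in>I. cdot (v i) x = 0}"
  have V_diff: "x - y \<in> V" if "x \<in> V" "y \<in> V" for x y using that by (auto simp: V_def cdot_diff_right)
  have V_scale: "c *\<^sub>R x \<in> V" if "x \<in> V" for x and c :: real using that by (auto simp: V_def cdot_scaleR_right)
  have V_inv: "A *v x \<in> V" if "x \<in> V" for x
    using that by (auto simp: V_def cdot_adj_mat herm eig cdot_scaleR_left)
  obtain x0 where x0: "x0 \<noteq> 0" "x0 \<in> V"
    using exists_orthogonal_vector[OF \<open>a \<notin> I\<close>, of v] by (auto simp: V_def)
  define S where "S = V \<inter> sphere 0 1"
  have "closed V"
  proof -
    have "V = (\<Inter>i\<in>I. {x. cdot (v i) x = 0})" by (auto simp: V_def)
    moreover have "closed {x. cdot (v i) x = 0}" for i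
      by (intro closed_Collect_eq continuous_intros)
    ultimately show ?thesis by auto
  qed
  then have "compact S" unfolding S_def by (simp add: closed_Int_compact)
  moreover have "(1 / norm x0) *\<^sub>R x0 \<in> S" using x0 by (simp add: S_def V_scale)
  then have "S \<noteq> {}" by blast
  moreover have "continuous_on S (\<lambda>x. Re (cdot x (A *v x)))" by (intro continuous_intros)
  ultimately obtain x where x: "x \<in> S" and max: "\<And>y. y \<in> S \<Longrightarrow> Re (cdot y (A *v y)) \<le> Re (cdot x (A *v x))"
    using continuous_attains_sup[of S "\<lambda>x. Re (cdot x (A *v x))"] by blast
  define \<mu> where "\<mu> = Re (cdot x (A *v x))"
  have xV: "x \<in> V" and nx: "norm x = 1" using x by (auto simp: S_def)
  define B where "B y = \<mu> *\<^sub>R y - A *v y" for y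
  define q where "q y = Re (cdot y (B y))" for y
  have q_nonneg: "q y \<ge> 0" if "y \<in> V" for y
  proof (cases "y = 0")
    case False
    then have "(1 / norm y) *\<^sub>R y \<in> S" using that by (simp add: S_def V_scale)
    from max[OF this] have "Re (cdot y (A *v y)) / (norm y)\<^sup>2 \<le> \<mu>"
      by (simp add: \<mu>_def matrix_vector_mult_scaleR_right cdot_scaleR_left cdot_scaleR_right power2_eq_square)
    with False show ?thesis
      by (simp add: q_def B_def cdot_diff_right cdot_scaleR_right cdot_self divide_le_eq)
  qed (simp add: q_def B_def cdot_def)
  have qx: "q x = 0" by (simp add: q_def B_def cdot_diff_right cdot_scaleR_right cdot_self nx \<mu>_def)
  define z where "z = B x"
  have zV: "z \<in> V" by (simp add: z_def B_def V_diff V_scale V_inv xV)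
  have B_diff: "B (y - t *\<^sub>R w) = B y - t *\<^sub>R B w" for y w t
    by (simp add: B_def matrix_vector_mult_diff_distrib matrix_vector_mult_scaleR_right algebra_simps)
  have B_herm: "cdot y (B w) = cdot (B y) w" for y w
    by (simp add: B_def cdot_diff_right cdot_diff_left cdot_scaleR_right cdot_scaleR_left cdot_adj_mat herm)
  \<comment> \<open>Perturbing the maximizer along the residual \<open>z\<close> gives a parabola in
    \<open>t\<close> without constant term; it can stay nonnegative only if its linear coefficient
    vanishes.\<close>
  have expand: "q (x - t *\<^sub>R z) = t\<^sup>2 * q z - 2 * t * (norm z)\<^sup>2" for t
  proof -
    have "cdot x (B z) = of_real ((norm z)\<^sup>2)" unfolding B_herm by (simp only: z_def[symmetric] cdot_self)
    moreover have "cdot z (B x) = of_real ((norm z)\<^sup>2)" by (simp only: z_def[symmetric] cdot_self)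
    ultimately show ?thesis using qx
      by (simp add: q_def B_diff cdot_diff_right cdot_diff_left cdot_scaleR_right cdot_scaleR_left
          power2_eq_square algebra_simps)
  qed
  have "(norm z)\<^sup>2 = 0"
  proof (rule ccontr)
    assume "(norm z)\<^sup>2 \<noteq> 0"
    then have z: "(norm z)\<^sup>2 > 0" by simp
    have nn: "0 \<le> t\<^sup>2 * q z - 2 * t * (norm z)\<^sup>2" for t
      using q_nonneg[OF V_diff[OF xV V_scale[OF zV]], of t] by (simp add: expand)
    show False
    proof (cases "q z = 0")
      case True
      then show False using nn[of 1] z by simp
    next
      case False
      then have "q z > 0" using q_nonneg[OF zV] by simp
      then have "((norm z)\<^sup>2 / q z)\<^sup>2 * q z - 2 * ((norm z)\<^sup>2 / q z) * (norm z)\<^sup>2 = - ((norm z)\<^sup>2)\<^sup>2 / q z"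
        by (simp add: field_simps power2_eq_square)
      also have "\<dots> < 0" using z \<open>q z > 0\<close> by (simp add: divide_neg_pos)
      finally show False using nn[of "(norm z)\<^sup>2 / q z"] by simp
    qed
  qed
  then have "A *v x = \<mu> *\<^sub>R x" by (simp add: z_def B_def)
  then show ?thesis using nx xV by (auto simp: V_def)
qed

text \<open>Induction over sets of row indices of the matrix itself: an index outside
  \<open>I\<close> both labels the next eigenvector and guarantees that there is room for
  it.\<close>

lemma orthonormal_eigenvectors:
  fixes A :: "complex^'n^'n"
  assumes "adj_mat A = A"
  shows "\<exists>v (e :: 'n \<Rightarrow> real). (\<forall>i\<in>I. A *v v i = e i *\<^sub>R v i) \<and>
     (\<forall>i\<in>I. \<forall>j\<in>I. cdot (v i) (v j) = (if i = j then 1 else 0))"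
  using finite[of I]
proof (induction I)
  case (insert a I)
  then obtain v and e :: "'n \<Rightarrow> real" where
    eig: "\<And>i. i \<in> I \<Longrightarrow> A *v v i = e i *\<^sub>R v i" and
    on: "\<And>i j. i \<in> I \<Longrightarrow> j \<in> I \<Longrightarrow> cdot (v i) (v j) = (if i = j then 1 else 0)"
    by blast
  obtain x \<mu> where x: "norm x = 1" "\<forall>i\<in>I. cdot (v i) x = 0" "A *v x = (\<mu>::real) *\<^sub>R x"
    using exists_orthogonal_eigenvector[OF assms insert.hyps(2), of v e] eig by blast
  have x': "\<forall>i\<in>I. cdot x (v i) = 0" using x(2) by (metis cnj_cdot complex_cnj_zero)
  have "cdot x x = 1" by (simp add: cdot_self x(1))
  then show ?case using insert.hyps(2) x x' eig on
    by (intro exI[of _ "v(a := x)"] exI[of _ "e(a := \<mu>)"]) auto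
qed simp

theorem spectral_theorem:
  fixes A :: "complex^'n^'n"
  assumes "adj_mat A = A"
  obtains V and e :: "'n \<Rightarrow> real" where
    "unitary_mat V" "A = V ** diag_mat (\<lambda>i. of_real (e i)) ** adj_mat V"
proof -
  obtain v and e :: "'n \<Rightarrow> real" where
    eig: "\<And>i. A *v v i = e i *\<^sub>R v i" and
    on: "\<And>i j. cdot (v i) (v j) = (if i = j then 1 else 0)"
    using orthonormal_eigenvectors[OF assms, of UNIV] by auto
  define V where "V = (\<chi> i j. v j $ i)"
  define D where "D = diag_mat (\<lambda>i. complex_of_real (e i))"
  have 1: "adj_mat V ** V = mat 1"
    using on by (simp add: vec_eq_iff matrix_mult_nth V_def cdot_def mat_def)
  then have 2: "V ** adj_mat V = mat 1" using matrix_left_right_inverse by blast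
  have "A ** V = V ** D"
  proof -
    have "(\<Sum>l\<in>UNIV. A $ i $ l * v j $ l) = v j $ i * of_real (e j)" for i j
      using arg_cong[OF eig[of j], of "\<lambda>x. x $ i"]
      by (simp add: matrix_vector_mult_nth) (simp add: scaleR_conv_of_real)
    then show ?thesis by (simp add: vec_eq_iff D_def mult_diag_mat_nth) (simp add: matrix_mult_nth V_def)
  qed
  then have "A = V ** D ** adj_mat V" by (metis 2 matrix_mul_assoc matrix_mul_rid)
  then show ?thesis using that 1 2 by (simp add: unitary_mat_def D_def)
qed

text \<open>The change of basis \<open>W\<close> intertwines the two diagonal matrices; entrywise,
  \<open>W $ i $ j\<close> can be nonzero only where the eigenvalues agree, and there their images
  under \<open>f\<close> agree too. This makes the definite description in \<open>herm_fun\<close>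
  well defined.\<close>

lemma spectral_function_unique:
  fixes V V' :: "complex^'n^'n" and e e' :: "'n \<Rightarrow> real" and f :: "real \<Rightarrow> real"
  assumes V: "unitary_mat V" and V': "unitary_mat V'"
    and eq: "V ** diag_mat (\<lambda>i. of_real (e i)) ** adj_mat V = V' ** diag_mat (\<lambda>i. of_real (e' i)) ** adj_mat V'"
  shows "V ** diag_mat (\<lambda>i. of_real (f (e i))) ** adj_mat V = V' ** diag_mat (\<lambda>i. of_real (f (e' i))) ** adj_mat V'"
proof -
  define W where "W = adj_mat V' ** V"
  have flip: "V ** D ** adj_mat V = V' ** D' ** adj_mat V' \<longleftrightarrow> W ** D = D' ** W" for D D'
  proof
    assume "V ** D ** adj_mat V = V' ** D' ** adj_mat V'"
    then have "adj_mat V' ** (V ** D ** adj_mat V) ** V = adj_mat V' ** (V' ** D' ** adj_mat V') ** V" by simp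
    moreover have "adj_mat V' ** (V ** D ** adj_mat V) ** V = W ** D ** (adj_mat V ** V)"
      by (simp add: W_def matrix_mul_assoc)
    moreover have "adj_mat V' ** (V' ** D' ** adj_mat V') ** V = (adj_mat V' ** V') ** D' ** W"
      by (simp add: W_def matrix_mul_assoc)
    ultimately show "W ** D = D' ** W" using V V' by (simp add: unitary_mat_def)
  next
    assume "W ** D = D' ** W"
    then have "V' ** (W ** D) ** adj_mat V = V' ** (D' ** W) ** adj_mat V" by simp
    moreover have "V' ** (W ** D) ** adj_mat V = (V' ** adj_mat V') ** V ** D ** adj_mat V"
      by (simp add: W_def matrix_mul_assoc)
    moreover have "V' ** (D' ** W) ** adj_mat V = V' ** D' ** adj_mat V' ** (V ** adj_mat V)"
      by (simp add: W_def matrix_mul_assoc)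
    ultimately show "V ** D ** adj_mat V = V' ** D' ** adj_mat V'" using V V' by (simp add: unitary_mat_def)
  qed
  have "W $ i $ j * of_real (e j) = of_real (e' i) * W $ i $ j" for i j
    using eq[unfolded flip] unfolding vec_eq_iff mult_diag_mat_nth diag_mat_mult_nth by blast
  then have "W $ i $ j = 0 \<or> e j = e' i" for i j
    by (metis mult.commute mult_cancel_left of_real_eq_iff)
  then have "W $ i $ j * of_real (f (e j)) = of_real (f (e' i)) * W $ i $ j" for i j
    by (metis mult.commute mult_zero_left)
  then show ?thesis unfolding flip unfolding vec_eq_iff mult_diag_mat_nth diag_mat_mult_nth by blast
qed

lemma herm_fun_diag:
  fixes V :: "complex^'n^'n" and e :: "'n \<Rightarrow> real"
  assumes "unitary_mat V"
  shows "herm_fun f (V ** diag_mat (\<lambda>i. of_real (e i)) ** adj_mat V) =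
     V ** diag_mat (\<lambda>i. of_real (f (e i))) ** adj_mat V"
  unfolding herm_fun_def
proof (rule the_equality)
  show "\<exists>Va (ea :: 'n \<Rightarrow> real). unitary_mat Va \<and>
      V ** diag_mat (\<lambda>i. complex_of_real (e i)) ** adj_mat V =
         Va ** diag_mat (\<lambda>i. complex_of_real (ea i)) ** adj_mat Va \<and>
      V ** diag_mat (\<lambda>i. complex_of_real (f (e i))) ** adj_mat V =
         Va ** diag_mat (\<lambda>i. complex_of_real (f (ea i))) ** adj_mat Va"
    using assms by blast
qed (use spectral_function_unique[OF assms] in metis)

section \<open>Calculus of unitarily diagonalized matrices\<close>

lemma unitary_conj_mult:
  assumes "unitary_mat V"
  shows "(V ** A ** adj_mat V) ** (V ** B ** adj_mat V) = V ** (A ** B) ** adj_mat V"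
proof -
  have "(V ** A ** adj_mat V) ** (V ** B ** adj_mat V) = V ** A ** (adj_mat V ** V) ** B ** adj_mat V"
    by (simp only: matrix_mul_assoc)
  also have "\<dots> = V ** A ** B ** adj_mat V" using assms by (simp add: unitary_mat_def)
  finally show ?thesis by (simp only: matrix_mul_assoc)
qed

lemma unitary_conj_diag_mult:
  assumes "unitary_mat V"
  shows "(V ** diag_mat (\<lambda>i. of_real (e i)) ** adj_mat V) ** (V ** diag_mat (\<lambda>i. of_real (f i)) ** adj_mat V)
     = V ** diag_mat (\<lambda>i. of_real (e i * f i)) ** adj_mat V"
  by (simp add: unitary_conj_mult[OF assms] diag_mat_mult)

lemma unitary_conj_1:
  fixes V :: "complex^'n^'n"
  shows "unitary_mat V \<Longrightarrow> V ** diag_mat (\<lambda>i. 1) ** adj_mat V = mat 1"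
proof -
  have "diag_mat (\<lambda>i. 1) = (mat 1 :: complex^'n^'n)" by (simp add: vec_eq_iff diag_mat_nth mat_def)
  then show "unitary_mat V \<Longrightarrow> ?thesis" by (simp add: unitary_mat_def)
qed

lemma unitary_conj_diag_add:
  "V ** diag_mat e ** adj_mat V + V ** diag_mat f ** adj_mat V = V ** diag_mat (\<lambda>i. e i + f i) ** adj_mat V"
  by (simp add: vec_eq_iff matrix_mult_nth[of _ "adj_mat V"] mult_diag_mat_nth sum.distrib[symmetric] algebra_simps)

lemma unitary_conj_diag_diff:
  "V ** diag_mat e ** adj_mat V - V ** diag_mat f ** adj_mat V = V ** diag_mat (\<lambda>i. e i - f i) ** adj_mat V"
  by (simp add: vec_eq_iff matrix_mult_nth[of _ "adj_mat V"] mult_diag_mat_nth sum_subtractf[symmetric] algebra_simps)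

lemma adj_unitary_conj_diag:
  "adj_mat (V ** diag_mat (\<lambda>i. of_real (e i)) ** adj_mat V) = V ** diag_mat (\<lambda>i. of_real (e i)) ** adj_mat V"
  by (simp add: adj_mat_mult adj_mat_diag_of_real matrix_mul_assoc)

lemma trace_unitary_conj_diag:
  assumes "unitary_mat V"
  shows "trace (V ** diag_mat e ** adj_mat V) = (\<Sum>i\<in>UNIV. e i)"
proof -
  have "trace (V ** diag_mat e ** adj_mat V) = trace (adj_mat V ** (V ** diag_mat e))"
    by (rule trace_mult_commute)
  also have "\<dots> = trace (diag_mat e)" using assms by (simp add: matrix_mul_assoc unitary_mat_def)
  finally show ?thesis by (simp add: trace_eq_sum diag_mat_nth)
qed

lemma cdot_unitary_conj_diag:
  "cdot x ((V ** diag_mat (\<lambda>i. of_real (e i)) ** adj_mat V) *v x) =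
     of_real (\<Sum>i\<in>UNIV. e i * (cmod ((adj_mat V *v x) $ i))\<^sup>2)"
proof -
  have "cdot x ((V ** diag_mat (\<lambda>i. of_real (e i)) ** adj_mat V) *v x) =
      cdot (adj_mat V *v x) (diag_mat (\<lambda>i. of_real (e i)) *v (adj_mat V *v x))"
    by (simp only: matrix_vector_mul_assoc[symmetric] cdot_adj_mat[of x V])
  also have "\<dots> = of_real (\<Sum>i\<in>UNIV. e i * (cmod ((adj_mat V *v x) $ i))\<^sup>2)"
    unfolding cdot_def
    by (simp add: diag_mat_mult_vec_nth)
       (simp add: complex_norm_square mult_ac del: of_real_power flip: of_real_power)
  finally show ?thesis .
qed

lemma norm_unitary_mult:
  assumes "unitary_mat V"
  shows "norm (adj_mat V *v x) = norm x"
proof -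
  have "cdot (adj_mat V *v x) (adj_mat V *v x) = cdot x x"
    unfolding cdot_adj_mat[of "adj_mat V *v x"] using assms
    by (simp add: matrix_vector_mul_assoc unitary_mat_def)
  then have "complex_of_real ((norm (adj_mat V *v x))\<^sup>2) = of_real ((norm x)\<^sup>2)" by (simp only: cdot_self)
  then show ?thesis by (metis norm_ge_zero of_real_eq_iff power2_eq_iff_nonneg)
qed

lemma norm_vec_sq: "(norm (x :: complex^'n))\<^sup>2 = (\<Sum>i\<in>UNIV. (cmod (x $ i))\<^sup>2)"
  by (simp add: norm_vec_def L2_set_def sum_nonneg)

lemma trace_mult_unitary_conj_diag:
  "trace (B ** (V ** diag_mat e ** adj_mat V)) = (\<Sum>i\<in>UNIV. e i * cdot (column i V) (B *v column i V))"
proof -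
  have "trace (B ** (V ** diag_mat e ** adj_mat V)) = trace (adj_mat V ** (B ** V ** diag_mat e))"
    by (subst trace_mult_commute[of "adj_mat V"]) (simp add: matrix_mul_assoc)
  also have "\<dots> = trace (adj_mat V ** (B ** V) ** diag_mat e)" by (simp add: matrix_mul_assoc)
  also have "\<dots> = (\<Sum>i\<in>UNIV. e i * cdot (column i V) (B *v column i V))"
    by (simp add: trace_eq_sum mult_diag_mat_nth mult.commute)
       (simp add: matrix_mult_nth cdot_def matrix_vector_mult_nth column_def)
  finally show ?thesis .
qed

lemma norm_column_unitary: "unitary_mat V \<Longrightarrow> norm (column i V) = 1"
proof -
  assume "unitary_mat V"
  then have "(adj_mat V ** V) $ i $ i = 1" by (simp add: unitary_mat_def mat_def)
  then have "cdot (column i V) (column i V) = 1"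
    by (simp add: matrix_mult_nth cdot_def column_def)
  then have "complex_of_real ((norm (column i V))\<^sup>2) = 1" by (simp only: cdot_self)
  then have "(norm (column i V))\<^sup>2 = 1" by (metis of_real_eq_1_iff)
  then show ?thesis by (metis norm_ge_zero real_sqrt_abs abs_of_nonneg real_sqrt_one)
qed

lemma cdot_column_eigen:
  assumes "unitary_mat V"
  shows "cdot (column i V) ((V ** diag_mat e ** adj_mat V) *v column i V) = e i"
proof -
  have "cdot (column i V) ((V ** diag_mat e ** adj_mat V) *v column i V) =
      (adj_mat V ** ((V ** diag_mat e ** adj_mat V) ** V)) $ i $ i"
    by (simp add: cdot_def matrix_mult_nth matrix_vector_mult_nth column_def)
  also have "adj_mat V ** ((V ** diag_mat e ** adj_mat V) ** V) =
      (adj_mat V ** V) ** diag_mat e ** (adj_mat V ** V)" by (simp add: matrix_mul_assoc)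
  finally show ?thesis using assms by (simp add: unitary_mat_def diag_mat_nth)
qed

lemma mat_pow_Suc: "mat_pow A (Suc n) = A ** mat_pow A n"
  by (simp add: mat_pow_def)

lemma mat_pow_0 [simp]: "mat_pow A 0 = mat 1"
  by (simp add: mat_pow_def)

lemma mat_pow_scaleR: "mat_pow (c *\<^sub>R A) n = c ^ n *\<^sub>R mat_pow A n"
  by (induction n) (simp_all add: mat_pow_Suc matrix_scalar_ac scalar_matrix_assoc mult.commute)

lemma mat_pow_unitary_conj:
  assumes "unitary_mat V"
  shows "mat_pow (V ** diag_mat (\<lambda>i. of_real (e i)) ** adj_mat V) n =
     V ** diag_mat (\<lambda>i. of_real (e i ^ n)) ** adj_mat V"
  by (induction n) (simp_all add: unitary_conj_1[OF assms] mat_pow_Suc unitary_conj_mult[OF assms] diag_mat_mult)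

section \<open>Entropies of probability vectors\<close>

definition prob_vec :: "('n::finite \<Rightarrow> real) \<Rightarrow> bool" where
  "prob_vec s \<longleftrightarrow> (\<forall>i. 0 \<le> s i) \<and> (\<Sum>i\<in>UNIV. s i) = 1"

definition renyi_vec :: "ereal \<Rightarrow> ('n::finite \<Rightarrow> real) \<Rightarrow> real" where
  "renyi_vec p s =
     (if p = \<infinity> then - ln (Max (range s))
      else if p = 1 then - (\<Sum>i\<in>UNIV. s i * ln (s i))
      else 1 / (1 - real_of_ereal p) * ln (\<Sum>i\<in>UNIV. s i powr real_of_ereal p))"

lemma prob_vec_le_1: "prob_vec s \<Longrightarrow> s i \<le> 1"
  unfolding prob_vec_def by (metis finite iso_tuple_UNIV_I member_le_sum)

lemma prob_vec_pos: "prob_vec s \<Longrightarrow> \<exists>i. s i > 0"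
proof (rule ccontr)
  assume "prob_vec s" "\<not> (\<exists>i. s i > 0)"
  then have "s i = 0" for i unfolding prob_vec_def by (metis less_eq_real_def)
  with \<open>prob_vec s\<close> show False by (simp add: prob_vec_def)
qed

lemma sum_powr_pos:
  assumes "prob_vec s"
  shows "(\<Sum>i\<in>UNIV. s i powr p) > 0"
proof -
  obtain i where "s i > 0" using prob_vec_pos[OF assms] by blast
  then show ?thesis by (intro sum_pos2[of _ i]) auto
qed

text \<open>Convexity of exp on the segment from 0 to \<open>ln y\<close>, evaluated at the fraction
  \<open>a\<close>.\<close>

lemma powr_le_tangent:
  fixes y :: real
  assumes "y > 0" "0 \<le> a" "a \<le> 1"
  shows "y powr a \<le> 1 + a * (y - 1)"
  using convex_onD[OF exp_convex assms(2,3), of 0 "ln y"] assms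
  by (simp add: powr_def algebra_simps)

text \<open>The previous bound with exponent 1/a, applied to the tangent value \<open>w\<close> when
  that is positive, and raised to the power \<open>a\<close>.\<close>

lemma powr_ge_tangent:
  fixes y :: real
  assumes "y \<ge> 0" "a \<ge> 1"
  shows "y powr a \<ge> 1 + a * (y - 1)"
proof (cases "1 + a * (y - 1) \<le> 0")
  case True
  then show ?thesis by (meson order_trans powr_ge_zero)
next
  case False
  define w where "w = 1 + a * (y - 1)"
  have w: "w > 0" using False by (simp add: w_def)
  have "w powr (1 / a) \<le> 1 + (1 / a) * (w - 1)" using w assms by (intro powr_le_tangent) auto
  also have "\<dots> = y" using assms by (simp add: w_def)
  finally have "(w powr (1 / a)) powr a \<le> y powr a" using assms by (intro powr_mono2) auto
  then show ?thesis using w assms by (simp add: powr_powr w_def)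
qed

text \<open>Gibbs' inequality, from \<open>ln z \<le> z - 1\<close> at z = t/s. Positivity of
  \<open>t\<close> on the support of \<open>s\<close> matters because \<open>ln 0 = 0\<close> would
  otherwise hide an infinite cross entropy. Every comparison with the Shannon entropy below is an
  instance with a suitable \<open>t\<close>.\<close>

lemma gibbs:
  fixes s t :: "'n::finite \<Rightarrow> real"
  assumes s: "prob_vec s" and t: "\<And>i. s i > 0 \<Longrightarrow> t i > 0" "\<And>i. t i \<ge> 0" "(\<Sum>i\<in>UNIV. t i) \<le> 1"
  shows "(\<Sum>i\<in>UNIV. s i * ln (t i)) \<le> (\<Sum>i\<in>UNIV. s i * ln (s i))"
proof -
  have "s i * ln (t i) - s i * ln (s i) \<le> t i - s i" for i
  proof (cases "s i = 0")
    case False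
    then have si: "s i > 0" using s unfolding prob_vec_def by (metis less_eq_real_def)
    then have ti: "t i > 0" using t by blast
    have "s i * ln (t i) - s i * ln (s i) = s i * ln (t i / s i)"
      using si ti by (simp add: ln_div algebra_simps)
    also have "\<dots> \<le> s i * (t i / s i - 1)" using si ti by (intro mult_left_mono ln_le_minus_one) auto
    also have "\<dots> = t i - s i" using si by (simp add: field_simps)
    finally show ?thesis .
  qed (use t in simp)
  then have "(\<Sum>i\<in>UNIV. s i * ln (t i) - s i * ln (s i)) \<le> (\<Sum>i\<in>UNIV. t i - s i)" by (rule sum_mono)
  then show ?thesis using s t(3) by (simp add: sum_subtractf prob_vec_def)
qed

section \<open>Lower and upper bounds for Renyi entropies\<close>

lemma renyi_vec_finite_cases:
  assumes "1 \<le> p" "p \<noteq> \<infinity>"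
  obtains x where "p = ereal x" "x = 1" "renyi_vec p s = - (\<Sum>i\<in>UNIV. s i * ln (s i))"
  | x where "p = ereal x" "x > 1" "renyi_vec p s = - (1 / (x - 1)) * ln (\<Sum>i\<in>UNIV. s i powr x)"
proof -
  obtain x where x: "p = ereal x" "x \<ge> 1" using assms by (cases p) (auto simp: one_ereal_def)
  show ?thesis
  proof (cases "x = 1")
    case True
    then show ?thesis using that(1) x by (simp add: renyi_vec_def one_ereal_def)
  next
    case False
    then have "1 / (1 - x) = - (1 / (x - 1))" using x by (simp add: field_simps)
    then show ?thesis using that(2)[of x] x False by (simp add: renyi_vec_def one_ereal_def)
  qed
qed

text \<open>The entropies decrease in p, so H_2 bounds them below on [1, 2]. For p = 1 this is Gibbs
  against s^2/mu; for p > 1 it is Jensen for the concave power p - 1 under the weights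
  \<open>s\<close>, in the form of the tangent at the mean \<open>\<mu>\<close>.\<close>

lemma renyi_vec_ge_collision:
  assumes s: "prob_vec s" and p: "1 \<le> p" "p \<le> 2" and Q: "(\<Sum>i\<in>UNIV. (s i)\<^sup>2) \<le> Q"
  shows "renyi_vec p s \<ge> - ln Q"
proof -
  define \<mu> where "\<mu> = (\<Sum>i\<in>UNIV. (s i)\<^sup>2)"
  have nonneg: "s i \<ge> 0" for i using s by (simp add: prob_vec_def)
  have \<mu>: "\<mu> > 0"
    using sum_powr_pos[OF s, of 2] nonneg by (simp add: \<mu>_def)
  have "- ln Q \<le> - ln \<mu>" using \<mu> Q by (simp add: \<mu>_def)
  also have "- ln \<mu> \<le> renyi_vec p s"
  proof -
    have "p \<noteq> \<infinity>" using p by auto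
    show ?thesis
    proof (rule renyi_vec_finite_cases[OF p(1) \<open>p \<noteq> \<infinity>\<close>, of s])
      fix x assume r: "renyi_vec p s = - (\<Sum>i\<in>UNIV. s i * ln (s i))"
      have "(\<Sum>i\<in>UNIV. s i * ln ((s i)\<^sup>2 / \<mu>)) \<le> (\<Sum>i\<in>UNIV. s i * ln (s i))"
        using \<mu> by (intro gibbs[OF s]) (auto simp: sum_divide_distrib[symmetric] \<mu>_def[symmetric])
      moreover have "s i * ln ((s i)\<^sup>2 / \<mu>) = 2 * (s i * ln (s i)) - s i * ln \<mu>" for i
      proof (cases "s i = 0")
        case False
        then have "s i > 0" using nonneg[of i] by simp
        then show ?thesis using \<mu> by (simp add: ln_div ln_realpow algebra_simps)
      qed simp
      ultimately have "2 * (\<Sum>i\<in>UNIV. s i * ln (s i)) - ln \<mu> \<le> (\<Sum>i\<in>UNIV. s i * ln (s i))"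
        using s by (simp add: sum_subtractf sum_distrib_left[symmetric] sum_distrib_right[symmetric] prob_vec_def)
      then show ?thesis using r by simp
    next
      fix x assume x: "p = ereal x" "x > 1" and r: "renyi_vec p s = - (1 / (x - 1)) * ln (\<Sum>i\<in>UNIV. s i powr x)"
      have x2: "x \<le> 2" using p x by simp
      define a where "a = x - 1"
      have a: "0 < a" "a \<le> 1" using x x2 by (auto simp: a_def)
      have "s i powr x \<le> \<mu> powr a * (s i * (1 + a * (s i / \<mu> - 1)))" for i
      proof (cases "s i = 0")
        case False
        then have si: "s i > 0" using nonneg[of i] by simp
        have "s i powr x = s i * s i powr a" using si by (simp add: a_def powr_diff)
        also have "s i powr a = \<mu> powr a * (s i / \<mu>) powr a" using si \<mu> by (simp add: powr_divide)
        also have "s i * (\<mu> powr a * (s i / \<mu>) powr a) \<le> s i * (\<mu> powr a * (1 + a * (s i / \<mu> - 1)))"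
          using si \<mu> a by (intro mult_left_mono powr_le_tangent) auto
        finally show ?thesis by (simp add: algebra_simps)
      qed simp
      then have "(\<Sum>i\<in>UNIV. s i powr x) \<le> (\<Sum>i\<in>UNIV. \<mu> powr a * (s i * (1 + a * (s i / \<mu> - 1))))"
        by (rule sum_mono)
      also have "\<dots> = \<mu> powr a * ((\<Sum>i\<in>UNIV. s i) * (1 - a) + a / \<mu> * (\<Sum>i\<in>UNIV. (s i)\<^sup>2))"
        by (simp add: sum_distrib_left[symmetric] sum_distrib_right[symmetric] sum.distrib[symmetric] sum_distrib_left power2_eq_square algebra_simps)
      also have "\<dots> = \<mu> powr a" using \<mu> s by (simp add: \<mu>_def[symmetric] prob_vec_def)
      finally have "ln (\<Sum>i\<in>UNIV. s i powr x) \<le> ln (\<mu> powr a)"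
        using sum_powr_pos[OF s, of x] by (meson ln_mono less_le_trans)
      then have "ln (\<Sum>i\<in>UNIV. s i powr x) \<le> a * ln \<mu>" using \<mu> by (simp add: ln_powr)
      then show ?thesis unfolding r using a by (simp add: a_def[symmetric] field_simps)
    qed
  qed
  finally show ?thesis .
qed

text \<open>All but two of the x factors are estimated by the largest entry. Just above 2 this is
  better than the min-entropy bound.\<close>

lemma renyi_vec_ge_interpolate:
  assumes s: "prob_vec s" and p: "2 \<le> x" and B: "\<And>i. s i \<le> B" and Q: "(\<Sum>i\<in>UNIV. (s i)\<^sup>2) \<le> Q"
  shows "renyi_vec (ereal x) s \<ge> - (1 / (x - 1)) * ((x - 2) * ln B + ln Q)"
proof -
  have nonneg: "s i \<ge> 0" for i using s by (simp add: prob_vec_def)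
  obtain i0 where "s i0 > 0" using prob_vec_pos[OF s] by blast
  then have Bpos: "B > 0" using B[of i0] by simp
  have Qpos: "Q > 0" using sum_powr_pos[OF s, of 2] nonneg Q by simp
  have "s i powr x \<le> B powr (x - 2) * (s i)\<^sup>2" for i
  proof (cases "s i = 0")
    case False
    then have si: "s i > 0" using nonneg[of i] by simp
    have "s i powr x = s i powr (x - 2 + 2)" by simp
    also have "\<dots> = s i powr (x - 2) * s i powr 2" by (rule powr_add)
    also have "\<dots> = s i powr (x - 2) * (s i)\<^sup>2" using si by simp
    also have "\<dots> \<le> B powr (x - 2) * (s i)\<^sup>2" using p B si by (intro mult_right_mono powr_mono2) auto
    finally show ?thesis .
  qed simp
  then have "(\<Sum>i\<in>UNIV. s i powr x) \<le> B powr (x - 2) * (\<Sum>i\<in>UNIV. (s i)\<^sup>2)"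
    by (simp add: sum_distrib_left sum_mono)
  also have "\<dots> \<le> B powr (x - 2) * Q" using Q by (intro mult_left_mono) auto
  finally have "ln (\<Sum>i\<in>UNIV. s i powr x) \<le> ln (B powr (x - 2) * Q)"
    using sum_powr_pos[OF s, of x] by (meson ln_mono less_le_trans)
  also have "\<dots> = (x - 2) * ln B + ln Q" using Bpos Qpos by (simp add: ln_mult ln_powr)
  finally have "1 / (x - 1) * ln (\<Sum>i\<in>UNIV. s i powr x) \<le> 1 / (x - 1) * ((x - 2) * ln B + ln Q)"
    using p by (intro mult_left_mono) auto
  moreover have "renyi_vec (ereal x) s = - (1 / (x - 1) * ln (\<Sum>i\<in>UNIV. s i powr x))"
  proof -
    have "1 / (1 - x) = - (1 / (x - 1))" using p by (simp add: field_simps)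
    then show ?thesis using p by (simp add: renyi_vec_def)
  qed
  ultimately show ?thesis by simp
qed

lemma renyi_vec_ge_min:
  assumes s: "prob_vec s" and p: "1 \<le> p" and B: "\<And>i. s i \<le> B"
  shows "renyi_vec p s \<ge> - ln B"
proof (cases "p = \<infinity>")
  case True
  have "Max (range s) \<le> B" using B by auto
  moreover have "Max (range s) > 0"
    using prob_vec_pos[OF s] by (subst Max_gr_iff) auto
  ultimately have "ln (Max (range s)) \<le> ln B" by (intro ln_mono)
  then show ?thesis by (simp add: True renyi_vec_def)
next
  case False
  have nonneg: "s i \<ge> 0" for i using s by (simp add: prob_vec_def)
  obtain i0 where "s i0 > 0" using prob_vec_pos[OF s] by blast
  then have Bpos: "B > 0" using B[of i0] by simp
  show ?thesis
  proof (rule renyi_vec_finite_cases[OF p False, of s])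
    fix x assume r: "renyi_vec p s = - (\<Sum>i\<in>UNIV. s i * ln (s i))"
    have "(\<Sum>i\<in>UNIV. s i * ln (s i)) \<le> (\<Sum>i\<in>UNIV. s i * ln B)"
    proof (rule sum_mono)
      fix i show "s i * ln (s i) \<le> s i * ln B"
        using nonneg[of i] B[of i] by (cases "s i = 0") (auto intro!: mult_left_mono)
    qed
    also have "\<dots> = ln B" using s by (simp add: sum_distrib_right[symmetric] prob_vec_def)
    finally show ?thesis using r by simp
  next
    fix x assume x: "p = ereal x" "x > 1" and r: "renyi_vec p s = - (1 / (x - 1)) * ln (\<Sum>i\<in>UNIV. s i powr x)"
    have "s i powr x \<le> B powr (x - 1) * s i" for i
    proof (cases "s i = 0")
      case False
      then have si: "s i > 0" using nonneg[of i] by simp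
      have "s i powr x = s i powr (x - 1) * s i" using si by (simp add: powr_diff)
      also have "\<dots> \<le> B powr (x - 1) * s i" using x B si by (intro mult_right_mono powr_mono2) auto
      finally show ?thesis .
    qed simp
    then have "(\<Sum>i\<in>UNIV. s i powr x) \<le> B powr (x - 1) * (\<Sum>i\<in>UNIV. s i)"
      by (simp add: sum_distrib_left sum_mono)
    also have "\<dots> = B powr (x - 1)" using s by (simp add: prob_vec_def)
    finally have "ln (\<Sum>i\<in>UNIV. s i powr x) \<le> ln (B powr (x - 1))"
      using sum_powr_pos[OF s, of x] by (meson ln_mono less_le_trans)
    then have "ln (\<Sum>i\<in>UNIV. s i powr x) \<le> (x - 1) * ln B" using Bpos by (simp add: ln_powr)
    then show ?thesis unfolding r using x by (simp add: field_simps)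
  qed
qed

text \<open>Gibbs against the escort distribution s^x/Z.\<close>

lemma renyi_vec_le_shannon:
  assumes s: "prob_vec s" and p: "1 \<le> p" "p \<noteq> \<infinity>"
  shows "renyi_vec p s \<le> - (\<Sum>i\<in>UNIV. s i * ln (s i))"
proof (rule renyi_vec_finite_cases[OF p, of s])
  have nonneg: "s i \<ge> 0" for i using s by (simp add: prob_vec_def)
  fix x assume x: "p = ereal x" "x > 1" and r: "renyi_vec p s = - (1 / (x - 1)) * ln (\<Sum>i\<in>UNIV. s i powr x)"
  define Z where "Z = (\<Sum>i\<in>UNIV. s i powr x)"
  have Z: "Z > 0" unfolding Z_def by (rule sum_powr_pos[OF s])
  have "(\<Sum>i\<in>UNIV. s i * ln (s i powr x / Z)) \<le> (\<Sum>i\<in>UNIV. s i * ln (s i))"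
    using Z by (intro gibbs[OF s]) (auto simp: sum_divide_distrib[symmetric] Z_def[symmetric])
  moreover have "s i * ln (s i powr x / Z) = x * (s i * ln (s i)) - s i * ln Z" for i
  proof (cases "s i = 0")
    case False
    then have "s i > 0" using nonneg[of i] by simp
    then show ?thesis using Z by (simp add: ln_div ln_powr algebra_simps)
  qed simp
  ultimately have "x * (\<Sum>i\<in>UNIV. s i * ln (s i)) - ln Z \<le> (\<Sum>i\<in>UNIV. s i * ln (s i))"
    using s by (simp add: sum_subtractf sum_distrib_left[symmetric] sum_distrib_right[symmetric] prob_vec_def)
  then show ?thesis unfolding r Z_def[symmetric] using x by (simp add: field_simps)
qed simp

text \<open>Gibbs against the two-valued vector with \<open>t\<close> at \<open>j\<close> and
  \<open>u\<close> elsewhere: the resulting cross entropy depends only on \<open>s j\<close>, and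
  decreases in it since \<open>u \<le> t\<close>.\<close>

lemma shannon_le_of_large_entry:
  fixes s :: "'n::finite \<Rightarrow> real"
  assumes s: "prob_vec s" and l: "l \<le> s j" and t: "0 < u" "u \<le> t" "t + real (CARD('n) - 1) * u \<le> 1"
  shows "- (\<Sum>i\<in>UNIV. s i * ln (s i)) \<le> - ln u - l * (ln t - ln u)"
proof -
  define w where "w i = (if i = j then t else u)" for i
  have UN: "(UNIV :: 'n set) = insert j (UNIV - {j})" by auto
  have sum_w: "(\<Sum>i\<in>UNIV. g i (w i)) = g j t + (\<Sum>i\<in>UNIV - {j}. g i u)" for g :: "'n \<Rightarrow> real \<Rightarrow> real"
    by (subst UN, subst sum.insert) (auto simp: w_def intro!: sum.cong)
  have "(\<Sum>i\<in>UNIV. s i * ln (w i)) \<le> (\<Sum>i\<in>UNIV. s i * ln (s i))"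
  proof (rule gibbs[OF s])
    show "(\<Sum>i\<in>UNIV. w i) \<le> 1" using sum_w[of "\<lambda>_ x. x"] t(3) by simp
  qed (use t in \<open>auto simp: w_def\<close>)
  moreover have "(\<Sum>i\<in>UNIV. s i * ln (w i)) = s j * ln t + (\<Sum>i\<in>UNIV - {j}. s i) * ln u"
    using sum_w[of "\<lambda>i x. s i * ln x"] by (simp add: sum_distrib_right)
  moreover have "(\<Sum>i\<in>UNIV - {j}. s i) = 1 - s j"
    using s by (simp add: prob_vec_def sum_diff1)
  moreover have "l * (ln t - ln u) \<le> s j * (ln t - ln u)" using l t by (intro mult_right_mono) auto
  ultimately show ?thesis by (simp add: algebra_simps)
qed

text \<open>Jensen as in \<open>renyi_vec_ge_collision\<close>, reversed because the power x - 1 is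
  now at least 1 and hence convex.\<close>

lemma renyi_vec_le_collision:
  assumes s: "prob_vec s" and x: "2 \<le> x"
  shows "renyi_vec (ereal x) s \<le> - ln (\<Sum>i\<in>UNIV. (s i)\<^sup>2)"
proof -
  define \<mu> where "\<mu> = (\<Sum>i\<in>UNIV. (s i)\<^sup>2)"
  define a where "a = x - 1"
  have a: "a \<ge> 1" using x by (simp add: a_def)
  have nonneg: "s i \<ge> 0" for i using s by (simp add: prob_vec_def)
  have \<mu>: "\<mu> > 0" using sum_powr_pos[OF s, of 2] nonneg by (simp add: \<mu>_def)
  have "s i powr x \<ge> \<mu> powr a * (s i * (1 + a * (s i / \<mu> - 1)))" for i
  proof (cases "s i = 0")
    case False
    then have si: "s i > 0" using nonneg[of i] by simp
    have "s i * (\<mu> powr a * (s i / \<mu>) powr a) \<ge> s i * (\<mu> powr a * (1 + a * (s i / \<mu> - 1)))"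
      using si \<mu> a by (intro mult_left_mono powr_ge_tangent) auto
    moreover have "s i powr a = \<mu> powr a * (s i / \<mu>) powr a" using si \<mu> by (simp add: powr_divide)
    moreover have "s i powr x = s i * s i powr a" using si by (simp add: a_def powr_diff)
    ultimately show ?thesis by (simp add: algebra_simps)
  qed simp
  then have "(\<Sum>i\<in>UNIV. s i powr x) \<ge> (\<Sum>i\<in>UNIV. \<mu> powr a * (s i * (1 + a * (s i / \<mu> - 1))))"
    by (rule sum_mono)
  moreover have "(\<Sum>i\<in>UNIV. \<mu> powr a * (s i * (1 + a * (s i / \<mu> - 1)))) =
      \<mu> powr a * ((\<Sum>i\<in>UNIV. s i) * (1 - a) + a / \<mu> * (\<Sum>i\<in>UNIV. (s i)\<^sup>2))"
    by (simp add: sum_distrib_left[symmetric] sum_distrib_right[symmetric] sum.distrib[symmetric] sum_distrib_left power2_eq_square algebra_simps)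
  moreover have "\<dots> = \<mu> powr a" using \<mu> s by (simp add: \<mu>_def[symmetric] prob_vec_def)
  ultimately have "\<mu> powr a \<le> (\<Sum>i\<in>UNIV. s i powr x)" by metis
  then have "ln (\<mu> powr a) \<le> ln (\<Sum>i\<in>UNIV. s i powr x)" using \<mu> by (intro ln_mono) auto
  then have "a * ln \<mu> \<le> ln (\<Sum>i\<in>UNIV. s i powr x)" using \<mu> by (simp add: ln_powr)
  moreover have "renyi_vec (ereal x) s = - (1 / a) * ln (\<Sum>i\<in>UNIV. s i powr x)"
  proof -
    have "1 / (1 - x) = - (1 / (x - 1))" using x by (simp add: field_simps)
    then show ?thesis using x by (simp add: renyi_vec_def a_def)
  qed
  moreover have "1 / a * (a * ln \<mu>) \<le> 1 / a * ln (\<Sum>i\<in>UNIV. s i powr x)"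
    using calculation(1) a by (intro mult_left_mono) auto
  ultimately show ?thesis using a by (simp add: \<mu>_def[symmetric])
qed

text \<open>The other squares lie above their tangents at the uniform value 1/N; what remains is a
  parabola in \<open>s j\<close> that increases beyond 1/N.\<close>

lemma collision_ge_of_large_entry:
  fixes s :: "'n::finite \<Rightarrow> real"
  assumes s: "prob_vec s" and l: "l \<le> s j" and l0: "1 / real CARD('n) \<le> l"
  shows "(\<Sum>i\<in>UNIV. (s i)\<^sup>2) \<ge> l\<^sup>2 + (1 - 2 * l) / real CARD('n)"
proof -
  define N where "N = real CARD('n)"
  have N: "N > 0" by (simp add: N_def)
  have "2 * s i / N - 1 / N\<^sup>2 \<le> (s i)\<^sup>2" for i
    using zero_le_power2[of "s i - 1 / N"] by (simp add: power2_diff power_divide)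
  then have "(\<Sum>i\<in>UNIV - {j}. 2 * s i / N - 1 / N\<^sup>2) \<le> (\<Sum>i\<in>UNIV - {j}. (s i)\<^sup>2)" by (intro sum_mono)
  moreover have "(\<Sum>i\<in>UNIV - {j}. 2 * s i / N - 1 / N\<^sup>2) = 2 * (1 - s j) / N - (N - 1) / N\<^sup>2"
  proof -
    have "(\<Sum>i\<in>UNIV - {j}. s i) = 1 - s j" using s by (simp add: prob_vec_def sum_diff1)
    moreover have "real (card (UNIV - {j})) = N - 1" by (simp add: N_def of_nat_diff)
    ultimately show ?thesis
      by (simp add: sum_subtractf sum_divide_distrib[symmetric] sum_distrib_left[symmetric])
  qed
  moreover have "(\<Sum>i\<in>UNIV. (s i)\<^sup>2) = (s j)\<^sup>2 + (\<Sum>i\<in>UNIV - {j}. (s i)\<^sup>2)"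
    by (simp add: sum.remove)
  moreover have "(N - 1) / N\<^sup>2 \<le> 1 / N" using N by (simp add: field_simps power2_eq_square)
  moreover have "2 * (1 - s j) / N - 1 / N = (1 - 2 * s j) / N" by (simp add: diff_divide_distrib algebra_simps)
  moreover have "l\<^sup>2 - 2 * l / N \<le> (s j)\<^sup>2 - 2 * s j / N"
  proof -
    have "(l - 1 / N)\<^sup>2 \<le> (s j - 1 / N)\<^sup>2" using l l0 by (intro power_mono) (auto simp: N_def)
    then show ?thesis by (simp add: power2_diff)
  qed
  ultimately show ?thesis by (simp add: N_def[symmetric] diff_divide_distrib)
qed

lemma renyi_vec_le_of_large_entry:
  assumes s: "prob_vec s" and l: "l \<le> s j" "0 < l" and x: "1 < x"
  shows "renyi_vec (ereal x) s \<le> x / (x - 1) * (- ln l)"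
proof -
  have "l powr x \<le> s j powr x" using l x by (intro powr_mono2) auto
  also have "\<dots> \<le> (\<Sum>i\<in>UNIV. s i powr x)" by (intro member_le_sum) auto
  finally have "ln (l powr x) \<le> ln (\<Sum>i\<in>UNIV. s i powr x)" using l by (intro ln_mono) auto
  then have "1 / (x - 1) * (x * ln l) \<le> 1 / (x - 1) * ln (\<Sum>i\<in>UNIV. s i powr x)"
    using x l by (intro mult_left_mono) (auto simp: ln_powr)
  moreover have "renyi_vec (ereal x) s = - (1 / (x - 1) * ln (\<Sum>i\<in>UNIV. s i powr x))"
  proof -
    have "1 / (1 - x) = - (1 / (x - 1))" using x by (simp add: field_simps)
    then show ?thesis using x by (simp add: renyi_vec_def)
  qed
  ultimately show ?thesis by simp
qed

lemma renyi_vec_infinity_le_of_large_entry: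
  assumes "l \<le> s j" "0 < l"
  shows "renyi_vec \<infinity> s \<le> - ln l"
proof -
  have "l \<le> Max (range s)" using assms(1) by (meson Max_ge finite finite_imageI order_trans rangeI)
  then have "ln l \<le> ln (Max (range s))" using assms(2) by (intro ln_mono)
  then show ?thesis by (simp add: renyi_vec_def)
qed

text \<open>The squared distance to the uniform vector is the collision sum minus 1/N, and it
  dominates the deviation of any single entry.\<close>

lemma entry_le_of_collision:
  fixes s :: "'n::finite \<Rightarrow> real"
  assumes s: "prob_vec s" and Q: "(\<Sum>i\<in>UNIV. (s i)\<^sup>2) \<le> 1 / real CARD('n) + c\<^sup>2 / (real CARD('n))\<^sup>2" and c: "c \<ge> 0"
  shows "s j \<le> (1 + c) / real CARD('n)"
proof -
  define N where "N = real CARD('n)"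
  have N: "N > 0" by (simp add: N_def)
  have "(s j - 1 / N)\<^sup>2 \<le> (\<Sum>i\<in>UNIV. (s i - 1 / N)\<^sup>2)" by (intro member_le_sum) auto
  also have "\<dots> = (\<Sum>i\<in>UNIV. (s i)\<^sup>2) - 2 / N * (\<Sum>i\<in>UNIV. s i) + N * (1 / N)\<^sup>2"
    by (simp add: power2_diff sum.distrib sum_subtractf sum_distrib_left N_def)
  also have "\<dots> = (\<Sum>i\<in>UNIV. (s i)\<^sup>2) - 1 / N" using s N by (simp add: prob_vec_def power2_eq_square)
  also have "\<dots> \<le> (c / N)\<^sup>2" using Q by (simp add: N_def power_divide)
  finally have "\<bar>s j - 1 / N\<bar> \<le> c / N" using c N by (metis abs_le_square_iff abs_of_nonneg divide_nonneg_pos)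
  then show ?thesis by (simp add: N_def add_divide_distrib)
qed

section \<open>Entropies of density matrices\<close>

lemma onorm_unitary_conj_diag:
  fixes V :: "complex^'n^'n"
  assumes V: "unitary_mat V" and e: "\<And>i. 0 \<le> e i"
  shows "onorm (\<lambda>v. (V ** diag_mat (\<lambda>i. of_real (e i)) ** adj_mat V) *v v) = Max (range e)"
proof -
  define D where "D = diag_mat (\<lambda>i. complex_of_real (e i))"
  define S where "S = V ** D ** adj_mat V"
  define M where "M = Max (range e)"
  have M: "e i \<le> M" for i by (simp add: M_def)
  have "M \<ge> 0" using e M order_trans by blast
  have n: "norm (S *v x) = norm (D *v (adj_mat V *v x))" for x
  proof -
    have "adj_mat V *v (S *v x) = (adj_mat V ** V) ** D ** adj_mat V *v x"
      by (simp add: matrix_vector_mul_assoc matrix_mul_assoc S_def)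
    also have "\<dots> = D *v (adj_mat V *v x)" using V by (simp add: unitary_mat_def matrix_vector_mul_assoc)
    finally show ?thesis by (metis norm_unitary_mult[OF V])
  qed
  have "onorm (\<lambda>v. S *v v) \<le> M"
  proof (rule onorm_le)
    fix x
    have "(norm (S *v x))\<^sup>2 = (\<Sum>i\<in>UNIV. (e i)\<^sup>2 * (cmod ((adj_mat V *v x) $ i))\<^sup>2)"
      by (simp add: n norm_vec_sq D_def diag_mat_mult_vec_nth norm_mult power_mult_distrib)
    also have "\<dots> \<le> (\<Sum>i\<in>UNIV. M\<^sup>2 * (cmod ((adj_mat V *v x) $ i))\<^sup>2)"
      using e M by (intro sum_mono mult_right_mono power_mono) auto
    also have "\<dots> = (M * norm x)\<^sup>2"
      using norm_unitary_mult[OF V, of x] norm_vec_sq[of "adj_mat V *v x"]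
      by (simp add: sum_distrib_left[symmetric] power_mult_distrib)
    finally show "norm (S *v x) \<le> M * norm x" using \<open>M \<ge> 0\<close> by (meson mult_nonneg_nonneg norm_ge_zero power2_le_imp_le)
  qed
  moreover have "e i \<le> onorm (\<lambda>v. S *v v)" for i
  proof -
    have bl: "bounded_linear (\<lambda>v. S *v v)"
      by (intro linear_conv_bounded_linear[THEN iffD1] linearI)
         (auto simp: matrix_vector_right_distrib matrix_vector_mult_scaleR_right)
    have column_axis: "column i V = V *v axis i 1"
      by (simp add: vec_eq_iff column_def matrix_vector_mult_nth axis_def mult_delta_right)
    have "S *v column i V = (V ** D ** (adj_mat V ** V)) *v axis i 1"
      by (simp add: S_def matrix_vector_mul_assoc[symmetric] matrix_mul_assoc column_axis)
    also have "\<dots> = V *v (D *v axis i 1)" using V by (simp add: unitary_mat_def matrix_vector_mul_assoc)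
    also have "D *v axis i 1 = e i *\<^sub>R axis i 1"
      by (simp add: vec_eq_iff D_def diag_mat_mult_vec_nth axis_def) (simp add: scaleR_conv_of_real)
    finally have "S *v column i V = e i *\<^sub>R column i V"
      by (simp add: matrix_vector_mult_scaleR_right column_axis)
    then have "norm (S *v column i V) = e i" using e by (simp add: norm_column_unitary[OF V])
    then show ?thesis using onorm[OF bl, of "column i V"] by (simp add: norm_column_unitary[OF V])
  qed
  then have "M \<le> onorm (\<lambda>v. S *v v)" by (simp add: M_def)
  ultimately have "onorm (\<lambda>v. S *v v) = M" by (rule antisym)
  then show ?thesis by (simp only: S_def D_def M_def)
qed

lemma renyi_entropy_eq_renyi_vec:
  fixes V :: "complex^'n^'n"
  assumes V: "unitary_mat V" and e: "\<And>i. 0 \<le> e i"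
    and \<sigma>: "\<sigma> = V ** diag_mat (\<lambda>i. of_real (e i)) ** adj_mat V"
  shows "renyi_entropy p \<sigma> = renyi_vec p e"
  unfolding renyi_entropy_def renyi_vec_def \<sigma> herm_fun_diag[OF V] onorm_unitary_conj_diag[OF V e]
    unitary_conj_diag_mult[OF V] trace_unitary_conj_diag[OF V]
  by simp

lemma density_matrix_spectral:
  fixes \<sigma> :: "complex^'n^'n"
  assumes "density_matrix \<sigma>"
  obtains V and e :: "'n \<Rightarrow> real" where "unitary_mat V" "prob_vec e"
    "\<sigma> = V ** diag_mat (\<lambda>i. of_real (e i)) ** adj_mat V" "\<And>p. renyi_entropy p \<sigma> = renyi_vec p e"
proof -
  have herm: "adj_mat \<sigma> = \<sigma>" and psd: "\<And>v. cdot v (\<sigma> *v v) \<in> \<real>\<^sub>\<ge>\<^sub>0" and tr: "trace \<sigma> = 1"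
    using assms by (auto simp: density_matrix_def psd_mat_def)
  obtain V and e :: "'n \<Rightarrow> real" where V: "unitary_mat V"
    and \<sigma>: "\<sigma> = V ** diag_mat (\<lambda>i. of_real (e i)) ** adj_mat V"
    using spectral_theorem[OF herm] by blast
  have "e i \<ge> 0" for i
    using psd[of "column i V"] unfolding \<sigma> cdot_column_eigen[OF V] by simp
  moreover have "complex_of_real (\<Sum>i\<in>UNIV. e i) = 1"
    using tr unfolding \<sigma> trace_unitary_conj_diag[OF V] by simp
  then have "(\<Sum>i\<in>UNIV. e i) = 1" using of_real_eq_1_iff by blast
  ultimately show ?thesis using that[OF V _ \<sigma>] renyi_entropy_eq_renyi_vec[OF V _ \<sigma>]
    by (auto simp: prob_vec_def)
qed

section \<open>Kraus maps\<close>

definition kraus_map :: "('a \<Rightarrow> complex^'n^'m) \<Rightarrow> 'a set \<Rightarrow> complex^'n^'n \<Rightarrow> complex^'m^'m" where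
  "kraus_map K S X = (\<Sum>a\<in>S. K a ** X ** adj_mat (K a))"

lemma sum_nonneg_Reals: "(\<And>a. a \<in> S \<Longrightarrow> f a \<in> \<real>\<^sub>\<ge>\<^sub>0) \<Longrightarrow> (\<Sum>a\<in>S. f a :: complex) \<in> \<real>\<^sub>\<ge>\<^sub>0"
  by (induction S rule: infinite_finite_induct) auto

lemma cdot_kraus:
  "cdot v ((K ** X ** adj_mat K) *v w) = cdot (adj_mat K *v v) (X *v (adj_mat K *v w))"
  by (simp only: matrix_vector_mul_assoc[symmetric] cdot_adj_mat[of v K])

lemma cdot_kraus_map:
  "cdot v (kraus_map K S X *v w) = (\<Sum>a\<in>S. cdot (adj_mat (K a) *v v) (X *v (adj_mat (K a) *v w)))"
  by (simp add: kraus_map_def matrix_vector_mult_sum_left cdot_sum_right cdot_kraus)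

lemma clinear_map_kraus_map: "clinear_map (kraus_map K S)"
proof -
  have "kraus_map K S (A + B) = kraus_map K S A + kraus_map K S B" for A B
    by (simp add: kraus_map_def matrix_add_ldistrib matrix_mult_add_left sum.distrib)
  moreover have "kraus_map K S (smult_mat c A) = smult_mat c (kraus_map K S A)" for c A
    by (simp add: kraus_map_def smult_mat_mult_left smult_mat_mult_right)
       (simp add: vec_eq_iff sum_distrib_left)
  ultimately show ?thesis by (simp add: clinear_map_def)
qed

lemma completely_positive_kraus_map:
  fixes K :: "'a \<Rightarrow> complex^'n^'m"
  shows "completely_positive (kraus_map K S)"
  unfolding completely_positive_def block_psd_def
proof (intro allI impI)
  fix N and X :: "nat \<Rightarrow> nat \<Rightarrow> complex^'n^'n" and v :: "nat \<Rightarrow> complex^'m"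
  assume X: "\<forall>v. (\<Sum>i<N. \<Sum>j<N. cdot (v i) (X i j *v v j)) \<in> \<real>\<^sub>\<ge>\<^sub>0"
  have "(\<Sum>i<N. \<Sum>j<N. cdot (v i) (kraus_map K S (X i j) *v v j)) =
      (\<Sum>i<N. \<Sum>a\<in>S. \<Sum>j<N. cdot (adj_mat (K a) *v v i) (X i j *v (adj_mat (K a) *v v j)))"
    unfolding cdot_kraus_map by (intro sum.cong refl sum.swap)
  also have "\<dots> = (\<Sum>a\<in>S. \<Sum>i<N. \<Sum>j<N. cdot (adj_mat (K a) *v v i) (X i j *v (adj_mat (K a) *v v j)))"
    by (rule sum.swap)
  also have "\<dots> \<in> \<real>\<^sub>\<ge>\<^sub>0"
    using X[rule_format, of "\<lambda>i. adj_mat (K _) *v v i"] by (rule sum_nonneg_Reals)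
  finally show "(\<Sum>i<N. \<Sum>j<N. cdot (v i) (kraus_map K S (X i j) *v v j)) \<in> \<real>\<^sub>\<ge>\<^sub>0" .
qed

lemma psd_mat_kraus_map:
  assumes "psd_mat X"
  shows "psd_mat (kraus_map K S X)"
  using assms unfolding psd_mat_def
  by (auto simp: cdot_kraus_map intro!: sum_nonneg_Reals)
     (simp add: kraus_map_def adj_mat_sum adj_mat_mult matrix_mul_assoc)

lemma mult_ketbra_mult_nth: "(A ** ketbra i j ** B) $ p $ q = A $ p $ i * B $ j $ q"
proof -
  have "(A ** ketbra i j) $ p $ l = (if l = j then A $ p $ i else 0)" for l
  proof -
    have "(A ** ketbra i j) $ p $ l = (\<Sum>k\<in>UNIV. if k = i then (if l = j then A $ p $ k else 0) else 0)"
      unfolding matrix_mult_nth by (intro sum.cong) (auto simp: ketbra_nth)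
    then show ?thesis by simp
  qed
  then show ?thesis by (simp add: matrix_mult_nth[of "A ** ketbra i j"] mult_delta_left)
qed

lemma sum_UNIV_Times: "(\<Sum>z\<in>UNIV. f z) = (\<Sum>x\<in>UNIV. \<Sum>y\<in>UNIV. f (x :: 'a::finite, y :: 'b::finite))"
  by (subst UNIV_Times_UNIV[symmetric], subst sum.cartesian_product) simp

text \<open>Replaces the expansion in matrix units by a Kraus form, from which positivity of the
  outputs of the tensor product is immediate.\<close>

lemma tensor_map_kraus_map:
  fixes K :: "'a \<Rightarrow> complex^'n^'m" and L :: "'b \<Rightarrow> complex^'q^'p"
  shows "tensor_map (kraus_map K S) (kraus_map L T) =
    kraus_map (\<lambda>(a, b). kron_mat (K a) (L b)) (S \<times> T)"
proof (intro ext, unfold vec_eq_iff, intro allI)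
  fix X :: "complex^('n \<times> 'q)^('n \<times> 'q)" and u v :: "'m \<times> 'p"
  have k: "kraus_map K S (ketbra i j) $ p $ q = (\<Sum>a\<in>S. K a $ p $ i * cnj (K a $ q $ j))" for i j p q
    by (simp add: kraus_map_def mult_ketbra_mult_nth)
  have l: "kraus_map L T (ketbra i j) $ p $ q = (\<Sum>b\<in>T. L b $ p $ i * cnj (L b $ q $ j))" for i j p q
    by (simp add: kraus_map_def mult_ketbra_mult_nth)
  let ?f = "\<lambda>i j a b. X $ i $ j * ((K a $ fst u $ fst i * cnj (K a $ fst v $ fst j)) *
      (L b $ snd u $ snd i * cnj (L b $ snd v $ snd j)))"
  have "tensor_map (kraus_map K S) (kraus_map L T) X $ u $ v =
      (\<Sum>i\<in>UNIV. \<Sum>j\<in>UNIV. \<Sum>(a, b)\<in>S \<times> T. ?f i j a b)"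
    by (simp add: tensor_map_def kron_mat_def k l sum_product)
       (simp add: sum_distrib_left sum.cartesian_product case_prod_beta)
  also have "\<dots> = (\<Sum>j\<in>UNIV. \<Sum>i\<in>UNIV. \<Sum>(a, b)\<in>S \<times> T. ?f i j a b)" by (rule sum.swap)
  also have "\<dots> = (\<Sum>j\<in>UNIV. \<Sum>c\<in>S \<times> T. \<Sum>i\<in>UNIV. ?f i j (fst c) (snd c))"
    by (intro sum.cong refl) (simp add: case_prod_beta, rule sum.swap)
  also have "\<dots> = (\<Sum>c\<in>S \<times> T. \<Sum>j\<in>UNIV. \<Sum>i\<in>UNIV. ?f i j (fst c) (snd c))" by (rule sum.swap)
  also have "\<dots> = kraus_map (\<lambda>(a, b). kron_mat (K a) (L b)) (S \<times> T) X $ u $ v"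
    by (simp add: kraus_map_def case_prod_beta matrix_mult_nth kron_mat_def sum_distrib_left sum_distrib_right mult_ac)
  finally show "tensor_map (kraus_map K S) (kraus_map L T) X $ u $ v =
    kraus_map (\<lambda>(a, b). kron_mat (K a) (L b)) (S \<times> T) X $ u $ v" .
qed

lemma trace_kron_mat: "trace (kron_mat A B) = trace A * trace B"
  by (simp add: trace_eq_sum kron_mat_def sum_UNIV_Times sum_product)

lemma trace_ketbra: "trace (ketbra a b) = (if a = b then 1 else 0)"
proof (cases "a = b")
  case False
  then have "trace (ketbra a b) = 0" unfolding trace_eq_sum by (intro sum.neutral) (auto simp: ketbra_nth)
  with False show ?thesis by simp
qed (simp add: trace_eq_sum ketbra_nth)

lemma trace_tensor_map:
  assumes "\<And>A. trace (\<Phi> A) = trace A" "\<And>A. trace (\<Psi> A) = trace A"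
  shows "trace (tensor_map \<Phi> \<Psi> X) = trace X"
proof -
  have "trace (tensor_map \<Phi> \<Psi> X) = (\<Sum>i\<in>UNIV. \<Sum>j\<in>UNIV. if i = j then X $ i $ j else 0)"
    unfolding tensor_map_def
    by (auto simp: trace_sum trace_smult_mat trace_kron_mat trace_ketbra assms prod_eq_iff intro!: sum.cong)
  then show ?thesis by (simp add: trace_eq_sum)
qed

lemma density_matrix_tensor_map:
  assumes "\<And>A. trace (kraus_map K S A) = trace A" "density_matrix \<rho>"
  shows "density_matrix (tensor_map (kraus_map K S) (kraus_map K S) \<rho>)"
  using assms(2) trace_tensor_map[of "kraus_map K S" "kraus_map K S", OF assms(1) assms(1)]
  by (simp add: density_matrix_def tensor_map_kraus_map psd_mat_kraus_map)

section \<open>Pure states and Rayleigh quotients\<close>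

definition outer :: "complex^'n \<Rightarrow> complex^'n^'n" where
  "outer v = (\<chi> i j. v $ i * cnj (v $ j))"

lemma cdot_outer: "cdot x (outer v *v x) = of_real ((cmod (cdot v x))\<^sup>2)"
proof -
  have "outer v *v x = (\<chi> i. v $ i * cdot v x)"
    by (simp add: vec_eq_iff matrix_vector_mult_nth outer_def cdot_def sum_distrib_left mult_ac)
  then have "cdot x (outer v *v x) = cdot x v * cdot v x"
    by (simp add: cdot_def[of x] sum_distrib_right mult.assoc)
  then show ?thesis by (metis cnj_cdot complex_norm_square mult.commute)
qed

lemma density_matrix_outer:
  assumes "norm v = 1"
  shows "density_matrix (outer v)"
proof -
  have "trace (outer v) = cdot v v" by (simp add: trace_eq_sum outer_def cdot_def mult.commute)
  then have "trace (outer v) = 1" using assms by (simp add: cdot_self)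
  moreover have "adj_mat (outer v) = outer v" by (simp add: vec_eq_iff outer_def)
  ultimately show ?thesis by (simp add: density_matrix_def psd_mat_def cdot_outer)
qed

text \<open>The quadratic form at a unit vector is a weighted average of the eigenvalues, so they
  cannot all lie below it.\<close>

lemma exists_large_eigenvalue:
  fixes V :: "complex^'n^'n"
  assumes V: "unitary_mat V" and w: "norm w = 1"
    and l: "l \<le> Re (cdot w ((V ** diag_mat (\<lambda>i. of_real (e i)) ** adj_mat V) *v w))"
  shows "\<exists>j. l \<le> e j"
proof (rule ccontr)
  assume "\<not> (\<exists>j. l \<le> e j)"
  then have less: "e j < l" for j by (simp add: not_le)
  have n: "(\<Sum>i\<in>UNIV. (cmod ((adj_mat V *v w) $ i))\<^sup>2) = 1"
    using norm_unitary_mult[OF V, of w] w by (simp flip: norm_vec_sq)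
  have "(\<Sum>i\<in>UNIV. e i * (cmod ((adj_mat V *v w) $ i))\<^sup>2) < (\<Sum>i\<in>UNIV. l * (cmod ((adj_mat V *v w) $ i))\<^sup>2)"
  proof (rule sum_strict_mono_ex1)
    obtain i where "(cmod ((adj_mat V *v w) $ i))\<^sup>2 \<noteq> 0"
      using n by (metis (mono_tags, lifting) sum.neutral zero_neq_one)
    then show "\<exists>i\<in>UNIV. e i * (cmod ((adj_mat V *v w) $ i))\<^sup>2 < l * (cmod ((adj_mat V *v w) $ i))\<^sup>2"
      using less by (intro bexI[of _ i]) auto
    show "\<forall>i\<in>UNIV. e i * (cmod ((adj_mat V *v w) $ i))\<^sup>2 \<le> l * (cmod ((adj_mat V *v w) $ i))\<^sup>2"
      by (intro ballI mult_right_mono less_imp_le[OF less]) simp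
  qed simp
  also have "\<dots> = l" using n by (simp flip: sum_distrib_left)
  finally show False using l unfolding cdot_unitary_conj_diag by simp
qed

section \<open>The damped channel\<close>

text \<open>The completely positive part \<open>\<rho> \<mapsto> F \<rho> F\<close> followed by the isometry built from the unitaries \<open>U i\<close>
  gives the first family of Kraus operators; the second one, built from a square root \<open>S\<close> of
  \<open>1 - F\<^sup>2\<close>, restores the trace.\<close>

definition damped_channel :: "('k::finite \<Rightarrow> complex^'d^'d) \<Rightarrow> complex^'d^'d \<Rightarrow> complex^'d^'d \<Rightarrow> complex^'k^'k" where
  "damped_channel U F \<rho> = (\<chi> i j.
      1 / of_nat CARD('k) * trace (U i ** F ** \<rho> ** F ** adj_mat (U j))
      + (if i = j then 1 else 0) / of_nat CARD('k) * trace ((mat 1 - F ** F) ** \<rho>))"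

definition damped_kraus :: "('k::finite \<Rightarrow> complex^'d^'d) \<Rightarrow> complex^'d^'d \<Rightarrow> complex^'d^'d \<Rightarrow> 'd + 'k \<times> 'd \<Rightarrow> complex^'d^'k" where
  "damped_kraus U F S a = (case a of
      Inl g \<Rightarrow> (\<chi> i x. of_real (1 / sqrt (real CARD('k))) * (U i ** F) $ g $ x)
    | Inr (l, g) \<Rightarrow> (\<chi> i x. if i = l then of_real (1 / sqrt (real CARD('k))) * S $ g $ x else 0))"

lemma damped_channel_eq_kraus_map:
  fixes U :: "'k::finite \<Rightarrow> complex^'d^'d"
  assumes F: "adj_mat F = F" and S: "adj_mat S = S" "S ** S = mat 1 - F ** F"
  shows "damped_channel U F = kraus_map (damped_kraus U F S) UNIV"
proof (intro ext, unfold vec_eq_iff, intro allI)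
  fix \<rho> :: "complex^'d^'d" and i j :: 'k
  define k where "k = real CARD('k)"
  have k: "of_real (1 / sqrt k) * of_real (1 / sqrt k) = (1 / of_real k :: complex)"
    by (simp add: k_def flip: of_real_mult)
  have k': "of_real (1 / sqrt k) * x * y * (of_real (1 / sqrt k) * z) = 1 / of_real k * (x * y * z)" for x y z :: complex
    using k by (metis (no_types, opaque_lifting) mult.assoc mult.left_commute)
  have scaled: "((\<chi> i x. of_real (1 / sqrt k) * f i x) ** \<rho> ** adj_mat (\<chi> i x. of_real (1 / sqrt k) * f i x)) $ i $ j
      = 1 / of_real k * (\<Sum>y\<in>UNIV. \<Sum>x\<in>UNIV. f i x * \<rho> $ x $ y * cnj (f j y))" for f :: "'k \<Rightarrow> 'd \<Rightarrow> complex"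
    by (simp only: matrix_mult_nth sum_distrib_right sum_distrib_left adj_mat_nth vec_lambda_beta
        complex_cnj_mult complex_cnj_complex_of_real k')
  have sandwich: "(A ** \<rho> ** adj_mat B) $ g $ g = (\<Sum>y\<in>UNIV. \<Sum>x\<in>UNIV. A $ g $ x * \<rho> $ x $ y * cnj (B $ g $ y))"
    for A B :: "complex^'d^'d" and g
    by (simp add: matrix_mult_nth sum_distrib_right)
  have 1: "(damped_kraus U F S (Inl g) ** \<rho> ** adj_mat (damped_kraus U F S (Inl g))) $ i $ j =
      1 / of_real k * (U i ** F ** \<rho> ** adj_mat (U j ** F)) $ g $ g" for g
    unfolding damped_kraus_def sum.case k_def[symmetric] scaled sandwich ..
  have 2: "(damped_kraus U F S (Inr (l, g)) ** \<rho> ** adj_mat (damped_kraus U F S (Inr (l, g)))) $ i $ j =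
      (if i = l then if j = l then 1 / of_real k * (S ** \<rho> ** adj_mat S) $ g $ g else 0 else 0)" for l g
  proof -
    have "damped_kraus U F S (Inr (l, g)) = (\<chi> i x. of_real (1 / sqrt k) * (if i = l then S $ g $ x else 0))"
      by (simp add: damped_kraus_def vec_eq_iff k_def)
    then show ?thesis by (simp only: scaled sandwich) (auto simp: sum_distrib_left)
  qed
  have "kraus_map (damped_kraus U F S) UNIV \<rho> $ i $ j =
      (\<Sum>a\<in>UNIV <+> UNIV. (damped_kraus U F S a ** \<rho> ** adj_mat (damped_kraus U F S a)) $ i $ j)"
    by (simp add: kraus_map_def)
  also have "\<dots> = (\<Sum>g\<in>UNIV. 1 / of_real k * (U i ** F ** \<rho> ** adj_mat (U j ** F)) $ g $ g)
      + (\<Sum>l\<in>UNIV. \<Sum>g\<in>UNIV. if i = l then if j = l then 1 / of_real k * (S ** \<rho> ** adj_mat S) $ g $ g else 0 else 0)"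
    by (subst sum.Plus) (simp_all add: 1 sum_UNIV_Times 2)
  also have "(\<Sum>g\<in>UNIV. 1 / of_real k * (U i ** F ** \<rho> ** adj_mat (U j ** F)) $ g $ g) =
      1 / of_real k * trace (U i ** F ** \<rho> ** F ** adj_mat (U j))"
    by (simp add: trace_eq_sum sum_distrib_left adj_mat_mult F matrix_mul_assoc)
  also have "(\<Sum>l\<in>UNIV. \<Sum>g\<in>UNIV. if i = l then if j = l then 1 / of_real k * (S ** \<rho> ** adj_mat S) $ g $ g else 0 else 0)
      = (\<Sum>l\<in>UNIV. if i = l then \<Sum>g\<in>UNIV. if j = l then 1 / of_real k * (S ** \<rho> ** adj_mat S) $ g $ g else 0 else 0)"
    by (intro sum.cong) auto
  also have "\<dots> = (if i = j then 1 else 0) / of_real k * trace (S ** \<rho> ** S)"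
    by (simp add: trace_eq_sum sum_distrib_left S(1))
  also have "trace (S ** \<rho> ** S) = trace ((mat 1 - F ** F) ** \<rho>)"
    using trace_mult_commute[of "S ** \<rho>" S] by (simp add: matrix_mul_assoc S(2))
  finally show "damped_channel U F \<rho> $ i $ j = kraus_map (damped_kraus U F S) UNIV \<rho> $ i $ j"
    by (simp add: damped_channel_def k_def)
qed

text \<open>The unitaries cancel under the trace and the second summand restores what the damping
  removed. Diagonal entries are therefore constant, and only off-diagonal ones can move an output
  away from the maximally mixed state.\<close>

lemma damped_channel_diag:
  fixes U :: "'k::finite \<Rightarrow> complex^'d^'d"
  assumes "\<And>i. unitary_mat (U i)"
  shows "damped_channel U F \<rho> $ i $ i = trace \<rho> / of_nat CARD('k)"
proof -
  have "trace (U i ** F ** \<rho> ** F ** adj_mat (U i)) = trace (adj_mat (U i) ** (U i ** F ** \<rho> ** F))"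
    by (rule trace_mult_commute)
  also have "\<dots> = trace (F ** (\<rho> ** F))" using assms[of i] by (simp add: matrix_mul_assoc unitary_mat_def)
  also have "\<dots> = trace ((\<rho> ** F) ** F)" by (rule trace_mult_commute)
  also have "\<dots> = trace (\<rho> ** (F ** F))" by (simp add: matrix_mul_assoc)
  also have "\<dots> = trace ((F ** F) ** \<rho>)" by (rule trace_mult_commute)
  finally have "damped_channel U F \<rho> $ i $ i =
      1 / of_nat CARD('k) * (trace (F ** F ** \<rho>) + trace ((mat 1 - F ** F) ** \<rho>))"
    by (simp add: damped_channel_def distrib_left add_divide_distrib)
  also have "trace (F ** F ** \<rho>) + trace ((mat 1 - F ** F) ** \<rho>) = trace \<rho>"
    by (simp add: matrix_mult_diff_left trace_eq_sum sum_subtractf)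
  finally show ?thesis by simp
qed

lemma trace_damped_channel:
  fixes U :: "'k::finite \<Rightarrow> complex^'d^'d"
  assumes "\<And>i. unitary_mat (U i)"
  shows "trace (damped_channel U F \<rho>) = trace \<rho>"
  by (simp add: trace_eq_sum[of "damped_channel U F \<rho>"] damped_channel_diag[OF assms])

lemma cmod_sum_squared_le_card:
  fixes z :: "'a \<Rightarrow> complex"
  assumes "finite S"
  shows "(cmod (\<Sum>a\<in>S. z a))\<^sup>2 \<le> real (card S) * (\<Sum>a\<in>S. (cmod (z a))\<^sup>2)"
proof -
  have "(cmod (\<Sum>a\<in>S. z a))\<^sup>2 \<le> (\<Sum>a\<in>S. 1 * cmod (z a))\<^sup>2" by (intro power_mono) (auto simp: norm_sum)
  also have "\<dots> \<le> (\<Sum>a\<in>S. 1\<^sup>2) * (\<Sum>a\<in>S. (cmod (z a))\<^sup>2)" by (rule Cauchy_Schwarz_ineq_sum)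
  finally show ?thesis by simp
qed

section \<open>The maximally entangled input\<close>

definition max_entangled :: "complex^('n::finite \<times> 'n)" where
  "max_entangled = (\<chi> z. if fst z = snd z then of_real (1 / sqrt (real CARD('n))) else 0)"

lemma norm_max_entangled: "norm (max_entangled :: complex^('n::finite \<times> 'n)) = 1"
proof -
  have "(norm (max_entangled :: complex^('n \<times> 'n)))\<^sup>2 = (\<Sum>x\<in>(UNIV :: 'n set). \<Sum>y\<in>UNIV. if x = y then 1 / real CARD('n) else 0)"
    unfolding norm_vec_sq sum_UNIV_Times max_entangled_def
    by (intro sum.cong) (auto simp: norm_divide power_divide)
  then have "(norm (max_entangled :: complex^('n \<times> 'n)))\<^sup>2 = 1" by simp
  then show ?thesis by (metis norm_ge_zero real_sqrt_abs abs_of_nonneg real_sqrt_one)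
qed

lemma cdot_max_entangled_kron:
  fixes A B :: "complex^'n^'m"
  shows "cdot max_entangled (kron_mat A B *v max_entangled) =
    of_real (1 / sqrt (real CARD('m)) * (1 / sqrt (real CARD('n)))) * (\<Sum>i\<in>UNIV. \<Sum>x\<in>UNIV. A $ i $ x * B $ i $ x)"
proof -
  let ?a = "complex_of_real (1 / sqrt (real CARD('m)))" and ?b = "complex_of_real (1 / sqrt (real CARD('n)))"
  have "(kron_mat A B *v max_entangled) $ (i, j) = ?b * (\<Sum>x\<in>UNIV. A $ i $ x * B $ j $ x)" for i j
  proof -
    have "(kron_mat A B *v max_entangled) $ (i, j) =
       (\<Sum>x\<in>UNIV. \<Sum>y\<in>UNIV. if x = y then A $ i $ x * B $ j $ y * ?b else 0)"
      unfolding matrix_vector_mult_nth sum_UNIV_Times max_entangled_def kron_mat_def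
      by (intro sum.cong) auto
    then show ?thesis by (simp add: sum_distrib_left mult_ac)
  qed
  then have "cdot max_entangled (kron_mat A B *v max_entangled) =
      (\<Sum>i\<in>UNIV. \<Sum>j\<in>UNIV. if i = j then ?a * (?b * (\<Sum>x\<in>UNIV. A $ i $ x * B $ j $ x)) else 0)"
    unfolding cdot_def sum_UNIV_Times max_entangled_def
    by (intro sum.cong refl) (simp only: vec_lambda_beta fst_conv snd_conv, auto)
  then show ?thesis by (simp add: sum_distrib_left mult_ac)
qed

text \<open>Since the \<open>U i\<close> are real, each \<open>U i \<otimes> U i\<close> fixes the maximally entangled vector, so the output
  of the maximally entangled input has a large overlap with the maximally entangled vector.\<close>

lemma max_entangled_output_overlap:
  fixes U :: "'k::finite \<Rightarrow> complex^'d^'d"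
  assumes F: "adj_mat F = F" and S: "adj_mat S = S" "S ** S = mat 1 - F ** F"
    and U: "\<And>i. unitary_mat (U i)" and real: "\<And>i g h. cnj (U i $ g $ h) = U i $ g $ h"
  shows "(cmod (\<Sum>g\<in>UNIV. \<Sum>x\<in>UNIV. (F $ g $ x)\<^sup>2))\<^sup>2 / (real CARD('k) * (real CARD('d))\<^sup>2) \<le>
    Re (cdot max_entangled (tensor_map (damped_channel U F) (damped_channel U F) (outer max_entangled) *v max_entangled))"
proof -
  define K where "K = damped_kraus U F S"
  define t where "t = (\<Sum>g\<in>UNIV. \<Sum>x\<in>UNIV. (F $ g $ x)\<^sup>2)"
  define z where "z a b = cdot max_entangled (kron_mat (K a) (K b) *v (max_entangled :: complex^('d \<times> 'd)))" for a b
  define k where "k = real CARD('k)"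
  define d where "d = real CARD('d)"
  have kd: "k > 0" "d > 0" by (auto simp: k_def d_def)
  have "cdot max_entangled (tensor_map (damped_channel U F) (damped_channel U F) (outer max_entangled) *v max_entangled)
      = (\<Sum>c\<in>UNIV. of_real ((cmod (z (fst c) (snd c)))\<^sup>2))"
  proof -
    have "cmod (cdot v (adj_mat A *v w)) = cmod (cdot w (A *v v))" for A :: "complex^('d \<times> 'd)^('k \<times> 'k)" and v w
      by (metis cdot_adj_mat cnj_cdot complex_mod_cnj)
    then show ?thesis
      unfolding damped_channel_eq_kraus_map[OF F S] tensor_map_kraus_map cdot_kraus_map cdot_outer z_def K_def
      by (simp add: case_prod_beta)
  qed
  then have "Re (cdot max_entangled (tensor_map (damped_channel U F) (damped_channel U F) (outer max_entangled) *v max_entangled))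
      = (\<Sum>c\<in>UNIV. (cmod (z (fst c) (snd c)))\<^sup>2)" by (simp flip: of_real_sum)
  \<comment> \<open>All terms are nonnegative; only pairs of equal Kraus operators of the damped
    part are kept.\<close>
  also have "\<dots> \<ge> (\<Sum>c\<in>range (\<lambda>g. (Inl g, Inl g)). (cmod (z (fst c) (snd c)))\<^sup>2)"
    by (rule sum_mono2) auto
  also have "(\<Sum>c\<in>range (\<lambda>g. (Inl g, Inl g)). (cmod (z (fst c) (snd c)))\<^sup>2) = (\<Sum>g\<in>UNIV. (cmod (z (Inl g) (Inl g)))\<^sup>2)"
    by (subst sum.reindex) (auto intro: injI)
  finally have *: "(\<Sum>g\<in>UNIV. (cmod (z (Inl g) (Inl g)))\<^sup>2) \<le>
      Re (cdot max_entangled (tensor_map (damped_channel U F) (damped_channel U F) (outer max_entangled) *v max_entangled))" .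
  have z: "z (Inl g) (Inl g) = of_real (1 / sqrt k * (1 / sqrt d) * (1 / k)) * (\<Sum>i\<in>UNIV. \<Sum>x\<in>UNIV. ((U i ** F) $ g $ x)\<^sup>2)" for g
  proof -
    have "of_real (1 / sqrt k) * x * (of_real (1 / sqrt k) * x) = of_real (1 / k) * x\<^sup>2" for x :: complex
    proof -
      have "of_real (1 / sqrt k) * x * (of_real (1 / sqrt k) * x) = (complex_of_real (1 / sqrt k) * of_real (1 / sqrt k)) * x\<^sup>2"
        by (simp add: power2_eq_square)
      also have "complex_of_real (1 / sqrt k) * of_real (1 / sqrt k) = of_real (1 / k)"
        using kd by (simp flip: of_real_mult)
      finally show ?thesis .
    qed
    then show ?thesis
      unfolding z_def cdot_max_entangled_kron K_def damped_kraus_def sum.case k_def[symmetric] d_def[symmetric]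
      by (simp only: vec_lambda_beta sum_distrib_left[symmetric] of_real_mult mult.assoc)
  qed
  \<comment> \<open>Reality enters here: squares without conjugation are entries of a transpose
    product, and for real \<open>U i\<close> the transpose is the inverse, so \<open>U i\<close>
    drops out.\<close>
  have UF: "(\<Sum>g\<in>UNIV. ((U i ** F) $ g $ x)\<^sup>2) = (\<Sum>g\<in>UNIV. (F $ g $ x)\<^sup>2)" for i x
  proof -
    have tr: "transpose (U i) = adj_mat (U i)" by (simp add: vec_eq_iff transpose_def real)
    have nth: "(transpose A ** B) $ x $ x = (\<Sum>g\<in>UNIV. A $ g $ x * B $ g $ x)" for A B :: "complex^'d^'d"
      by (simp add: matrix_mult_nth transpose_def)
    have "(\<Sum>g\<in>UNIV. ((U i ** F) $ g $ x)\<^sup>2) = (transpose (U i ** F) ** (U i ** F)) $ x $ x"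
      unfolding nth by (simp add: power2_eq_square)
    also have "transpose (U i ** F) ** (U i ** F) = transpose F ** (adj_mat (U i) ** U i) ** F"
      by (simp add: matrix_transpose_mul tr matrix_mul_assoc)
    also have "\<dots> = transpose F ** F" using U[of i] by (simp add: unitary_mat_def)
    finally show ?thesis unfolding nth by (simp add: power2_eq_square)
  qed
  have "(\<Sum>g\<in>UNIV. \<Sum>i\<in>UNIV. \<Sum>x\<in>UNIV. ((U i ** F) $ g $ x)\<^sup>2) =
      (\<Sum>i\<in>UNIV. \<Sum>x\<in>UNIV. \<Sum>g\<in>UNIV. ((U i ** F) $ g $ x)\<^sup>2)"
    by (subst sum.swap) (intro sum.cong refl sum.swap)
  also have "\<dots> = of_real k * t"
    unfolding UF by (simp add: k_def t_def) (rule sum.swap)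
  finally have "(\<Sum>g\<in>UNIV. z (Inl g) (Inl g)) = of_real (1 / sqrt k * (1 / sqrt d) * (1 / k)) * (of_real k * t)"
    unfolding z sum_distrib_left[symmetric] by simp
  also have "\<dots> = of_real (1 / sqrt k * (1 / sqrt d)) * t" using kd by simp
  finally have "(cmod (\<Sum>g\<in>UNIV. z (Inl g) (Inl g)))\<^sup>2 = (cmod t)\<^sup>2 / (k * d)"
    using kd by (simp add: norm_mult norm_divide power_mult_distrib power_divide)
  \<comment> \<open>Cauchy-Schwarz passes to the sum over \<open>g\<close>, where the unitaries have
    cancelled; the single overlaps still contain them.\<close>
  moreover have "(cmod (\<Sum>g\<in>UNIV. z (Inl g) (Inl g)))\<^sup>2 \<le> d * (\<Sum>g\<in>UNIV. (cmod (z (Inl g) (Inl g)))\<^sup>2)"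
    using cmod_sum_squared_le_card[of "UNIV :: 'd set" "\<lambda>g. z (Inl g) (Inl g)"] by (simp add: d_def)
  ultimately have "(cmod t)\<^sup>2 / (k * d) / d \<le> (\<Sum>g\<in>UNIV. (cmod (z (Inl g) (Inl g)))\<^sup>2)"
    using kd by (simp add: divide_le_eq mult_ac)
  then show ?thesis using * by (simp add: t_def k_def d_def power2_eq_square mult.assoc)
qed

text \<open>With K = 1 - F the sum equals d - 2 tr K plus the sum of the squared entries of K. In
  modulus the latter is at most tr(K^2), hence at most tr K because the eigenvalues of K lie in
  [0, 1]; hence the factor 3 = 2 + 1.\<close>

lemma damping_square_sum_bound:
  fixes V :: "complex^'d^'d"
  assumes V: "unitary_mat V" and F: "F = V ** diag_mat (\<lambda>i. of_real (f i)) ** adj_mat V"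
    and f: "\<And>i. 0 \<le> f i" "\<And>i. f i \<le> 1"
  shows "real CARD('d) - 3 * (\<Sum>i\<in>UNIV. 1 - f i) \<le> Re (\<Sum>g\<in>UNIV. \<Sum>x\<in>UNIV. (F $ g $ x)\<^sup>2)"
proof -
  define K where "K = V ** diag_mat (\<lambda>i. of_real (1 - f i)) ** adj_mat V"
  have "mat 1 - F = K"
    unfolding F K_def unitary_conj_1[OF V, symmetric] unitary_conj_diag_diff by simp
  then have F_K: "F $ g $ x = (if g = x then 1 else 0) - K $ g $ x" for g x
    by (auto simp: mat_def algebra_simps dest!: arg_cong[of _ _ "\<lambda>A. A $ g $ x"])
  have "(\<Sum>g\<in>UNIV. \<Sum>x\<in>UNIV. (F $ g $ x)\<^sup>2) =
      (\<Sum>g\<in>UNIV. \<Sum>x\<in>UNIV. (if g = x then 1 - 2 * K $ g $ x else 0) + (K $ g $ x)\<^sup>2)"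
    unfolding F_K by (intro sum.cong refl) (auto simp: power2_eq_square algebra_simps)
  also have "\<dots> = of_nat CARD('d) - 2 * trace K + (\<Sum>g\<in>UNIV. \<Sum>x\<in>UNIV. (K $ g $ x)\<^sup>2)"
    by (simp add: sum.distrib sum_subtractf trace_eq_sum sum_distrib_left)
  finally have 1: "Re (\<Sum>g\<in>UNIV. \<Sum>x\<in>UNIV. (F $ g $ x)\<^sup>2) =
      real CARD('d) - 2 * Re (trace K) + Re (\<Sum>g\<in>UNIV. \<Sum>x\<in>UNIV. (K $ g $ x)\<^sup>2)" by simp
  have tr: "Re (trace K) = (\<Sum>i\<in>UNIV. 1 - f i)"
    unfolding K_def trace_unitary_conj_diag[OF V] by simp
  have "- Re (\<Sum>g\<in>UNIV. \<Sum>x\<in>UNIV. (K $ g $ x)\<^sup>2) \<le> (\<Sum>g\<in>UNIV. \<Sum>x\<in>UNIV. (cmod (K $ g $ x))\<^sup>2)"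
  proof -
    have "- Re (z\<^sup>2) \<le> (cmod z)\<^sup>2" for z by (metis abs_Re_le_cmod abs_le_D2 norm_power)
    then show ?thesis unfolding Re_sum sum_negf[symmetric] by (intro sum_mono)
  qed
  also have "(\<Sum>g\<in>UNIV. \<Sum>x\<in>UNIV. (cmod (K $ g $ x))\<^sup>2) = Re (trace (K ** adj_mat K))"
    by (simp add: trace_eq_sum matrix_mult_nth complex_mult_cnj cmod_power2)
  also have "K ** adj_mat K = K ** K" by (simp add: K_def adj_unitary_conj_diag del: of_real_diff)
  also have "Re (trace (K ** K)) = (\<Sum>i\<in>UNIV. (1 - f i) * (1 - f i))"
    unfolding K_def unitary_conj_diag_mult[OF V] trace_unitary_conj_diag[OF V] by simp
  also have "\<dots> \<le> (\<Sum>i\<in>UNIV. 1 - f i)"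
    using f by (intro sum_mono) (simp add: mult_left_le)
  finally show ?thesis using 1 tr by simp
qed

section \<open>Walks on alternating words\<close>

text \<open>A list \<open>[i, j, i', j', \<dots>]\<close> of even length stands for the free group element
  \<open>inv (u i) \<cdot> u j \<cdot> inv (u i') \<cdot> u j' \<cdots>\<close>, which is reduced iff adjacent entries differ.  The
  exponents alternate, so multiplying on the left by the generator or inverse that continues the alternation
  either prepends a letter or cancels the first one.\<close>

definition toggle :: "'k \<Rightarrow> 'k list \<Rightarrow> 'k list" where
  "toggle i w = (case w of [] \<Rightarrow> [i] | j # v \<Rightarrow> if i = j then v else i # w)"

definition reduced_words :: "'k list set" where
  "reduced_words = {w. distinct_adj w \<and> even (length w)}"

text \<open>The coefficient at \<open>v\<close> of the n-th power of the sum of \<open>A i j\<close>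
  times inv(u_i) u_j in the free group algebra: inv(u_i) u_j w = v holds iff w = inv(u_j) u_i v. The
  cutoff makes the function vanish on lists that represent no reduced word, so that square sums may
  run over arbitrary lists.\<close>

fun walk :: "('k \<Rightarrow> 'k \<Rightarrow> complex) \<Rightarrow> nat \<Rightarrow> 'k::finite list \<Rightarrow> complex" where
  "walk A 0 v = (if v = [] then 1 else 0)"
| "walk A (Suc n) v = (if v \<in> reduced_words
     then \<Sum>i\<in>UNIV. \<Sum>j\<in>UNIV. A i j * walk A n (toggle j (toggle i v)) else 0)"

lemma walk_eq_0: "v \<notin> reduced_words \<Longrightarrow> walk A n v = 0"
  by (cases n) (auto simp: reduced_words_def)

lemma distinct_adj_toggle: "distinct_adj w \<Longrightarrow> distinct_adj (toggle i w)"
  by (auto simp: toggle_def split: list.splits dest: distinct_adj_ConsD)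

lemma even_length_toggle: "even (length (toggle i w)) \<longleftrightarrow> odd (length w)"
  by (auto simp: toggle_def split: list.splits)

lemma length_toggle_le: "length (toggle i w) \<le> Suc (length w)"
  by (auto simp: toggle_def split: list.splits)

lemma toggle_toggle_in_reduced_words: "v \<in> reduced_words \<Longrightarrow> toggle j (toggle i v) \<in> reduced_words"
  by (simp add: reduced_words_def distinct_adj_toggle even_length_toggle)

text \<open>The names of the three operators tell where the mass of \<open>f\<close> moves: upwards
  means that the value at \<open>v\<close> is read off at a word shorter by two.\<close>

definition walk_up :: "('k \<Rightarrow> 'k \<Rightarrow> complex) \<Rightarrow> ('k list \<Rightarrow> complex) \<Rightarrow> 'k list \<Rightarrow> complex" where
  "walk_up A f v = (case v of i # j # w \<Rightarrow> A i j * f w | _ \<Rightarrow> 0)"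

definition walk_level :: "('k \<Rightarrow> 'k \<Rightarrow> complex) \<Rightarrow> ('k::finite list \<Rightarrow> complex) \<Rightarrow> 'k list \<Rightarrow> complex" where
  "walk_level A f v = (case v of i # w \<Rightarrow> \<Sum>j\<in>UNIV. A i j * f (j # w) | _ \<Rightarrow> 0)"

definition walk_down :: "('k \<Rightarrow> 'k \<Rightarrow> complex) \<Rightarrow> ('k::finite list \<Rightarrow> complex) \<Rightarrow> 'k list \<Rightarrow> complex" where
  "walk_down A f v = (\<Sum>i\<in>UNIV. \<Sum>j\<in>UNIV. A i j * f (j # i # v))"

text \<open>The level and downward operators sum over all letters, including those that in truth
  cancel. These surplus terms read \<open>f\<close> at lists with equal neighbours, where it
  vanishes, or carry a coefficient \<open>A i i = 0\<close>.\<close>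

lemma walk_step_decomp:
  assumes A: "\<And>i. A i i = 0" and f: "\<And>v. v \<notin> reduced_words \<Longrightarrow> f v = 0" and v: "v \<in> reduced_words"
  shows "(\<Sum>i\<in>UNIV. \<Sum>j\<in>UNIV. A i j * f (toggle j (toggle i v))) =
    walk_up A f v + walk_level A f v + walk_down A f v"
proof (cases v)
  case Nil
  then show ?thesis
    by (auto simp: walk_up_def walk_level_def walk_down_def toggle_def A intro!: sum.cong)
next
  case (Cons i1 v')
  with v obtain j1 w where w: "v = i1 # j1 # w" "i1 \<noteq> j1"
    by (cases v') (auto simp: reduced_words_def)
  have f0: "f (j1 # j1 # w) = 0" "f (j # i1 # i1 # u) = 0" for j u
    by (auto intro!: f simp: reduced_words_def)
  have "A i j * f (toggle j (toggle i v)) =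
      (if i = i1 then (if j = j1 then A i1 j1 * f w else 0) + A i1 j * f (j # j1 # w) else 0) + A i j * f (j # i # v)" for i j
    using w by (auto simp: toggle_def A f0)
  then have "(\<Sum>i\<in>UNIV. \<Sum>j\<in>UNIV. A i j * f (toggle j (toggle i v))) =
      (\<Sum>i\<in>UNIV. if i = i1 then (\<Sum>j\<in>UNIV. (if j = j1 then A i1 j1 * f w else 0) + A i1 j * f (j # j1 # w)) else 0)
      + walk_down A f v"
    by (simp only: walk_down_def sum.distrib[symmetric]) (intro sum.cong refl, auto simp: sum.distrib)
  then show ?thesis by (simp add: sum.distrib walk_up_def walk_level_def w)
qed

text \<open>An l^2 norm bound expressed by finite partial sums, so that summability over the
  infinite set of words never has to be discussed.\<close>

definition l2_bounded :: "('a \<Rightarrow> complex) \<Rightarrow> real \<Rightarrow> bool" where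
  "l2_bounded f C \<longleftrightarrow> (\<forall>B. finite B \<longrightarrow> (\<Sum>v\<in>B. (cmod (f v))\<^sup>2) \<le> C\<^sup>2)"

lemma cmod_sum_mult_squared_le:
  "(cmod (\<Sum>a\<in>S. f a * g a))\<^sup>2 \<le> (\<Sum>a\<in>S. (cmod (f a))\<^sup>2) * (\<Sum>a\<in>S. (cmod (g a))\<^sup>2)"
proof -
  have "(cmod (\<Sum>a\<in>S. f a * g a))\<^sup>2 \<le> (\<Sum>a\<in>S. cmod (f a) * cmod (g a))\<^sup>2"
    by (intro power_mono) (auto simp: norm_mult[symmetric] intro: norm_sum)
  also have "\<dots> \<le> (\<Sum>a\<in>S. (cmod (f a))\<^sup>2) * (\<Sum>a\<in>S. (cmod (g a))\<^sup>2)" by (rule Cauchy_Schwarz_ineq_sum)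
  finally show ?thesis .
qed

text \<open>On words \<open>i # j # w\<close> the function is the tensor product of \<open>A\<close>
  and \<open>f\<close>. After enlarging \<open>B\<close> to a product set (other lists contribute
  0), the square sum factors.\<close>

lemma l2_bounded_walk_up:
  fixes A :: "'k::finite \<Rightarrow> 'k \<Rightarrow> complex"
  assumes A: "(\<Sum>i\<in>UNIV. \<Sum>j\<in>UNIV. (cmod (A i j))\<^sup>2) \<le> 1" and f: "l2_bounded f C"
  shows "l2_bounded (walk_up A f) C"
  unfolding l2_bounded_def
proof (intro allI impI)
  fix B :: "'k list set" assume B: "finite B"
  define B' where "B' = (\<lambda>v. tl (tl v)) ` B"
  define \<phi> :: "'k \<times> 'k \<times> 'k list \<Rightarrow> 'k list" where "\<phi> = (\<lambda>(i, j, w). i # j # w)"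
  have inj: "inj_on \<phi> S" for S by (auto simp: inj_on_def \<phi>_def)
  have fin: "finite B'" using B by (simp add: B'_def)
  have "(\<Sum>v\<in>B. (cmod (walk_up A f v))\<^sup>2) \<le> (\<Sum>v\<in>B \<union> \<phi> ` (UNIV \<times> UNIV \<times> B'). (cmod (walk_up A f v))\<^sup>2)"
    using B fin by (intro sum_mono2) auto
  also have "\<dots> = (\<Sum>v\<in>\<phi> ` (UNIV \<times> UNIV \<times> B'). (cmod (walk_up A f v))\<^sup>2)"
  proof (rule sum.mono_neutral_right)
    show "\<forall>v\<in>B \<union> \<phi> ` (UNIV \<times> UNIV \<times> B') - \<phi> ` (UNIV \<times> UNIV \<times> B'). (cmod (walk_up A f v))\<^sup>2 = 0"
    proof
      fix v assume v: "v \<in> B \<union> \<phi> ` (UNIV \<times> UNIV \<times> B') - \<phi> ` (UNIV \<times> UNIV \<times> B')"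
      show "(cmod (walk_up A f v))\<^sup>2 = 0"
      proof (cases "\<exists>i j w. v = i # j # w")
        case True
        then obtain i j w where w: "v = i # j # w" by blast
        then have "w \<in> B'" using v by (force simp: B'_def)
        then have "v \<in> \<phi> ` (UNIV \<times> UNIV \<times> B')" by (force simp: \<phi>_def w)
        with v show ?thesis by blast
      qed (auto simp: walk_up_def split: list.splits)
    qed
  qed (use B fin in auto)
  also have "\<dots> = (\<Sum>i\<in>UNIV. \<Sum>j\<in>UNIV. \<Sum>w\<in>B'. (cmod (A i j))\<^sup>2 * (cmod (f w))\<^sup>2)"
    by (subst sum.reindex[OF inj]) (simp add: sum.cartesian_product \<phi>_def case_prod_beta walk_up_def norm_mult power_mult_distrib)
  also have "\<dots> = (\<Sum>i\<in>UNIV. \<Sum>j\<in>UNIV. (cmod (A i j))\<^sup>2) * (\<Sum>w\<in>B'. (cmod (f w))\<^sup>2)"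
    by (simp only: sum_distrib_right[symmetric] sum_distrib_left[symmetric])
  also have "\<dots> \<le> 1 * C\<^sup>2" using A f fin by (intro mult_mono) (auto simp: l2_bounded_def sum_nonneg)
  finally show "(\<Sum>v\<in>B. (cmod (walk_up A f v))\<^sup>2) \<le> C\<^sup>2" by simp
qed

text \<open>For each fixed tail the operator is the matrix \<open>A\<close> acting on the first
  letter, and its norm is at most the Hilbert-Schmidt norm by Cauchy-Schwarz in each row.\<close>

lemma l2_bounded_walk_level:
  fixes A :: "'k::finite \<Rightarrow> 'k \<Rightarrow> complex"
  assumes A: "(\<Sum>i\<in>UNIV. \<Sum>j\<in>UNIV. (cmod (A i j))\<^sup>2) \<le> 1" and f: "l2_bounded f C"
  shows "l2_bounded (walk_level A f) C"
  unfolding l2_bounded_def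
proof (intro allI impI)
  fix B :: "'k list set" assume B: "finite B"
  define B' where "B' = tl ` B"
  define \<phi> :: "'k \<times> 'k list \<Rightarrow> 'k list" where "\<phi> = (\<lambda>(i, w). i # w)"
  have inj: "inj_on \<phi> S" for S by (auto simp: inj_on_def \<phi>_def)
  have fin: "finite B'" using B by (simp add: B'_def)
  have "(\<Sum>v\<in>B. (cmod (walk_level A f v))\<^sup>2) \<le> (\<Sum>v\<in>B \<union> \<phi> ` (UNIV \<times> B'). (cmod (walk_level A f v))\<^sup>2)"
    using B fin by (intro sum_mono2) auto
  also have "\<dots> = (\<Sum>v\<in>\<phi> ` (UNIV \<times> B'). (cmod (walk_level A f v))\<^sup>2)"
  proof (rule sum.mono_neutral_right)
    show "\<forall>v\<in>B \<union> \<phi> ` (UNIV \<times> B') - \<phi> ` (UNIV \<times> B'). (cmod (walk_level A f v))\<^sup>2 = 0"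
    proof
      fix v assume v: "v \<in> B \<union> \<phi> ` (UNIV \<times> B') - \<phi> ` (UNIV \<times> B')"
      show "(cmod (walk_level A f v))\<^sup>2 = 0"
      proof (cases v)
        case (Cons i w)
        then have "w \<in> B'" using v by (force simp: B'_def)
        then have "v \<in> \<phi> ` (UNIV \<times> B')" by (force simp: \<phi>_def Cons)
        with v show ?thesis by blast
      qed (simp add: walk_level_def)
    qed
  qed (use B fin in auto)
  also have "\<dots> = (\<Sum>i\<in>UNIV. \<Sum>w\<in>B'. (cmod (\<Sum>j\<in>UNIV. A i j * f (j # w)))\<^sup>2)"
    by (subst sum.reindex[OF inj]) (simp add: sum.cartesian_product \<phi>_def case_prod_beta walk_level_def)
  also have "\<dots> \<le> (\<Sum>i\<in>UNIV. \<Sum>w\<in>B'. (\<Sum>j\<in>UNIV. (cmod (A i j))\<^sup>2) * (\<Sum>j\<in>UNIV. (cmod (f (j # w)))\<^sup>2))"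
    by (intro sum_mono cmod_sum_mult_squared_le)
  also have "\<dots> = (\<Sum>i\<in>UNIV. \<Sum>j\<in>UNIV. (cmod (A i j))\<^sup>2) * (\<Sum>w\<in>B'. \<Sum>j\<in>UNIV. (cmod (f (j # w)))\<^sup>2)"
    by (simp only: sum_distrib_left[symmetric] sum_distrib_right[symmetric])
  also have "(\<Sum>w\<in>B'. \<Sum>j\<in>UNIV. (cmod (f (j # w)))\<^sup>2) = (\<Sum>v\<in>\<phi> ` (UNIV \<times> B'). (cmod (f v))\<^sup>2)"
    by (subst sum.swap, subst sum.reindex[OF inj]) (simp add: sum.cartesian_product \<phi>_def case_prod_beta)
  also have "(\<Sum>i\<in>UNIV. \<Sum>j\<in>UNIV. (cmod (A i j))\<^sup>2) * \<dots> \<le> 1 * C\<^sup>2"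
    using A f fin by (intro mult_mono) (auto simp: l2_bounded_def sum_nonneg)
  finally show "(\<Sum>v\<in>B. (cmod (walk_level A f v))\<^sup>2) \<le> C\<^sup>2" by simp
qed

text \<open>Cauchy-Schwarz over the removed pair of letters; the lists \<open>j # i # v\<close> are
  distinct for distinct triples, so no value of \<open>f\<close> is counted twice.\<close>

lemma l2_bounded_walk_down:
  fixes A :: "'k::finite \<Rightarrow> 'k \<Rightarrow> complex"
  assumes A: "(\<Sum>i\<in>UNIV. \<Sum>j\<in>UNIV. (cmod (A i j))\<^sup>2) \<le> 1" and f: "l2_bounded f C"
  shows "l2_bounded (walk_down A f) C"
  unfolding l2_bounded_def
proof (intro allI impI)
  fix B :: "'k list set" assume B: "finite B"
  define \<phi> :: "'k list \<times> 'k \<times> 'k \<Rightarrow> 'k list" where "\<phi> = (\<lambda>(v, i, j). j # i # v)"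
  have inj: "inj_on \<phi> S" for S by (auto simp: inj_on_def \<phi>_def)
  have A': "(\<Sum>c\<in>UNIV \<times> UNIV. (cmod (A (fst c) (snd c)))\<^sup>2) \<le> 1"
    using A by (simp add: sum.cartesian_product case_prod_beta)
  have "(\<Sum>v\<in>B. (cmod (walk_down A f v))\<^sup>2) =
      (\<Sum>v\<in>B. (cmod (\<Sum>c\<in>UNIV \<times> UNIV. A (fst c) (snd c) * f (snd c # fst c # v)))\<^sup>2)"
    by (simp add: walk_down_def sum.cartesian_product case_prod_beta)
  also have "\<dots> \<le> (\<Sum>v\<in>B. (\<Sum>c\<in>UNIV \<times> UNIV. (cmod (A (fst c) (snd c)))\<^sup>2) *
      (\<Sum>c\<in>UNIV \<times> UNIV. (cmod (f (snd c # fst c # v)))\<^sup>2))"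
    by (intro sum_mono cmod_sum_mult_squared_le)
  also have "\<dots> \<le> (\<Sum>v\<in>B. 1 * (\<Sum>c\<in>UNIV \<times> UNIV. (cmod (f (snd c # fst c # v)))\<^sup>2))"
    by (intro sum_mono mult_right_mono A') (auto intro: sum_nonneg)
  also have "\<dots> = (\<Sum>v\<in>\<phi> ` (B \<times> UNIV \<times> UNIV). (cmod (f v))\<^sup>2)"
    by (subst sum.reindex[OF inj]) (simp add: sum.cartesian_product \<phi>_def case_prod_beta)
  also have "\<dots> \<le> C\<^sup>2" using f B by (simp add: l2_bounded_def)
  finally show "(\<Sum>v\<in>B. (cmod (walk_down A f v))\<^sup>2) \<le> C\<^sup>2" .
qed

lemma l2_bounded_add:
  assumes "l2_bounded f C" "l2_bounded g D" "C \<ge> 0" "D \<ge> 0"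
  shows "l2_bounded (\<lambda>v. f v + g v) (C + D)"
  unfolding l2_bounded_def
proof (intro allI impI)
  fix B :: "'a set" assume B: "finite B"
  have "L2_set (\<lambda>v. cmod (f v + g v)) B \<le> L2_set (\<lambda>v. cmod (f v) + cmod (g v)) B"
    by (intro L2_set_mono norm_triangle_ineq) auto
  also have "\<dots> \<le> L2_set (\<lambda>v. cmod (f v)) B + L2_set (\<lambda>v. cmod (g v)) B" by (rule L2_set_triangle_ineq)
  also have "L2_set (\<lambda>v. cmod (f v)) B \<le> C"
    using assms B by (simp add: L2_set_def l2_bounded_def real_le_lsqrt sum_nonneg)
  also have "L2_set (\<lambda>v. cmod (g v)) B \<le> D"
    using assms B by (simp add: L2_set_def l2_bounded_def real_le_lsqrt sum_nonneg)
  finally have "sqrt (\<Sum>v\<in>B. (cmod (f v + g v))\<^sup>2) \<le> C + D" by (simp add: L2_set_def)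
  then show "(\<Sum>v\<in>B. (cmod (f v + g v))\<^sup>2) \<le> (C + D)\<^sup>2" by (rule sqrt_le_D)
qed

lemma l2_bounded_walk:
  assumes A: "(\<Sum>i\<in>UNIV. \<Sum>j\<in>UNIV. (cmod (A i j))\<^sup>2) \<le> 1" "\<And>i. A i i = 0"
  shows "l2_bounded (walk A n) (3 ^ n)"
proof (induction n)
  case 0
  show ?case unfolding l2_bounded_def
  proof (intro allI impI)
    fix B :: "'a list set" assume "finite B"
    have "(\<Sum>v\<in>B. (cmod (walk A 0 v))\<^sup>2) = (\<Sum>v\<in>B. if v = [] then 1 else 0)" by (intro sum.cong) auto
    also have "\<dots> \<le> 1" using \<open>finite B\<close> by simp
    finally show "(\<Sum>v\<in>B. (cmod (walk A 0 v))\<^sup>2) \<le> (3 ^ 0)\<^sup>2" by simp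
  qed
next
  case (Suc n)
  let ?g = "\<lambda>v. walk_up A (walk A n) v + walk_level A (walk A n) v + walk_down A (walk A n) v"
  have "l2_bounded ?g (3 ^ n + 3 ^ n + 3 ^ n)"
    by (intro l2_bounded_add l2_bounded_walk_up l2_bounded_walk_level l2_bounded_walk_down A Suc) auto
  moreover have "(cmod (walk A (Suc n) v))\<^sup>2 \<le> (cmod (?g v))\<^sup>2" for v
    using walk_step_decomp[of A "walk A n" v, OF A(2) walk_eq_0] by (cases "v \<in> reduced_words") auto
  then have "(\<Sum>v\<in>B. (cmod (walk A (Suc n) v))\<^sup>2) \<le> (\<Sum>v\<in>B. (cmod (?g v))\<^sup>2)" for B by (rule sum_mono)
  moreover have "3 ^ n + 3 ^ n + 3 ^ n = (3 ^ Suc n :: real)" by simp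
  ultimately show ?case unfolding l2_bounded_def by (metis (no_types, lifting) order_trans)
qed

lemma norm_walk_le:
  assumes "(\<Sum>i\<in>UNIV. \<Sum>j\<in>UNIV. (cmod (A i j))\<^sup>2) \<le> 1" "\<And>i. A i i = 0"
  shows "cmod (walk A n v) \<le> 3 ^ n"
proof -
  have "(\<Sum>v\<in>{v}. (cmod (walk A n v))\<^sup>2) \<le> (3 ^ n)\<^sup>2"
    using l2_bounded_walk[OF assms] unfolding l2_bounded_def by blast
  then have "(cmod (walk A n v))\<^sup>2 \<le> (3 ^ n)\<^sup>2" by (simp del: power_mult_numeral)
  then show ?thesis by (rule power2_le_imp_le) simp
qed

section \<open>Freeness of the matrices modulo \<open>M\<close> on short words\<close>

text \<open>The first column of the integer matrix product spelled by a word.\<close>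

fun word_column :: "idx list \<Rightarrow> int \<times> int" where
  "word_column [] = (1, 0)"
| "word_column (l # w) = (let j = int (num_of_idx l); s = (if even (length w) then 1 else -1); (x, y) = word_column w
     in ((1 + 4 * j * s) * x - 8 * j\<^sup>2 * s * y, 2 * s * x + (1 - 4 * j * s) * y))"

text \<open>Ping-pong: \<open>a\<^sub>j\<close> and its inverse map the outside of the interval \<open>[2j - 1, 2j + 1]\<close> of the
  projective line into the open interval; \<open>\<infinity>\<close> is outside all of them.\<close>

lemma word_column_ping_pong:
  "distinct_adj (l # w) \<Longrightarrow> word_column (l # w) = (x, y) \<Longrightarrow> \<bar>x - 2 * int (num_of_idx l) * y\<bar> < \<bar>y\<bar>"
proof (induction w arbitrary: l x y)
  case Nil
  then show ?case by (auto simp: Let_def)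
next
  case (Cons l' w)
  obtain x' y' where xy': "word_column (l' # w) = (x', y')" by (cases "word_column (l' # w)")
  define j j' where "j = int (num_of_idx l)" and "j' = int (num_of_idx l')"
  define s :: int where "s = (if even (length (l' # w)) then 1 else -1)"
  have s: "s = 1 \<or> s = -1" by (simp add: s_def)
  have "l \<noteq> l'" using Cons.prems(1) by simp
  then have "j \<noteq> j'" by (simp add: j_def j'_def num_of_idx_inject)
  then have jj: "1 \<le> \<bar>j - j'\<bar>" by simp
  have IH: "\<bar>x' - 2 * j' * y'\<bar> < \<bar>y'\<bar>"
    unfolding j'_def using Cons.prems(1) by (intro Cons.IH xy') simp
  \<comment> \<open>The linear form \<open>u\<close> is invariant under \<open>a_j\<close> and its
    inverse, while \<open>y\<close> changes by 2su. So it suffices that \<open>u\<close> exceeds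
    \<open>y'\<close> in absolute value: then |y| >= 2|u| - |y'| > |u|.\<close>
  define u where "u = x' - 2 * j * y'"
  \<comment> \<open>The centres 2j and 2j' of the two intervals are at distance at least 2, and the
    induction hypothesis uses up less than 1.\<close>
  have "2 * \<bar>y'\<bar> \<le> 2 * (\<bar>j - j'\<bar> * \<bar>y'\<bar>)" using jj by (simp add: mult_le_cancel_right1)
  also have "\<dots> = \<bar>2 * ((j - j') * y')\<bar>" by (simp add: abs_mult)
  also have "\<dots> = \<bar>2 * j * y' - 2 * j' * y'\<bar>" by (rule arg_cong[of _ _ abs]) (simp add: algebra_simps)
  also have "\<dots> \<le> \<bar>u\<bar> + \<bar>x' - 2 * j' * y'\<bar>" by (simp add: u_def)
  finally have u: "\<bar>y'\<bar> < \<bar>u\<bar>" using IH by linarith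
  have "word_column (l # l' # w) = ((1 + 4 * j * s) * x' - 8 * j\<^sup>2 * s * y', 2 * s * x' + (1 - 4 * j * s) * y')"
    by (subst word_column.simps(2)) (simp only: xy' Let_def j_def s_def prod.case)
  then have x: "x = (1 + 4 * j * s) * x' - 8 * j\<^sup>2 * s * y'" and y: "y = 2 * s * x' + (1 - 4 * j * s) * y'"
    using Cons.prems(2) by simp_all
  have 1: "x - 2 * j * y = u" by (simp add: x y u_def algebra_simps power2_eq_square)
  have 2: "y = y' + 2 * s * u" by (simp add: y u_def algebra_simps)
  show ?case unfolding j_def[symmetric] 1 using u s by (auto simp: 2)
qed

lemma num_of_idx_bounds: "1 \<le> num_of_idx l" "num_of_idx l \<le> k_par"
  using num_of_idx[of l] by auto

text \<open>The base 1 + 4k + 8k^2 dominates both absolute row sums of every letter, so each letter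
  multiplies the maximum norm by at most this factor.\<close>

lemma word_column_bound:
  assumes "word_column w = (x, y)"
  shows "\<bar>x\<bar> \<le> (1 + 4 * int k_par + 8 * (int k_par)\<^sup>2) ^ length w \<and> \<bar>y\<bar> \<le> (1 + 4 * int k_par + 8 * (int k_par)\<^sup>2) ^ length w"
  using assms
proof (induction w arbitrary: x y)
  case (Cons l w)
  obtain x' y' where xy': "word_column w = (x', y')" by (cases "word_column w")
  define j where "j = int (num_of_idx l)"
  define k where "k = int k_par"
  define s :: int where "s = (if even (length w) then 1 else -1)"
  define C where "C = (1 + 4 * k + 8 * k\<^sup>2) ^ length w"
  have s: "\<bar>s\<bar> = 1" by (simp add: s_def)
  have j: "1 \<le> j" "j \<le> k" using num_of_idx_bounds[of l] by (auto simp: j_def k_def)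
  have b: "\<bar>x'\<bar> \<le> C" "\<bar>y'\<bar> \<le> C" using Cons.IH[OF xy'] by (auto simp: C_def k_def)
  have C: "C \<ge> 0" using b(1) by linarith
  have "word_column (l # w) = ((1 + 4 * j * s) * x' - 8 * j\<^sup>2 * s * y', 2 * s * x' + (1 - 4 * j * s) * y')"
    by (simp add: xy' Let_def j_def s_def)
  then have x: "x = (1 + 4 * j * s) * x' - 8 * j\<^sup>2 * s * y'" and y: "y = 2 * s * x' + (1 - 4 * j * s) * y'"
    using Cons.prems by simp_all
  have sq: "j\<^sup>2 \<le> k\<^sup>2" "1 \<le> k\<^sup>2" using j by (auto intro: power_mono one_le_power)
  have "\<bar>1 + 4 * j * s\<bar> \<le> 1 + 4 * k" "\<bar>1 - 4 * j * s\<bar> \<le> 1 + 4 * k"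
    using j by (auto simp: s_def)
  moreover have "\<bar>8 * j\<^sup>2 * s\<bar> \<le> 8 * k\<^sup>2" using s sq by (simp add: abs_mult)
  moreover have "\<bar>2 * s\<bar> \<le> 8 * k\<^sup>2" using s sq by (simp add: abs_mult)
  ultimately have "\<bar>(1 + 4 * j * s) * x'\<bar> \<le> (1 + 4 * k) * C" "\<bar>8 * j\<^sup>2 * s * y'\<bar> \<le> 8 * k\<^sup>2 * C"
    "\<bar>2 * s * x'\<bar> \<le> 8 * k\<^sup>2 * C" "\<bar>(1 - 4 * j * s) * y'\<bar> \<le> (1 + 4 * k) * C"
    unfolding abs_mult[of _ x'] abs_mult[of _ y'] using b j by (auto intro!: mult_mono)
  then have "\<bar>x\<bar> \<le> (1 + 4 * k) * C + 8 * k\<^sup>2 * C" "\<bar>y\<bar> \<le> (1 + 4 * k) * C + 8 * k\<^sup>2 * C"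
    unfolding x y by linarith+
  then show ?case by (simp add: C_def k_def algebra_simps)
qed simp

lemma m_par_pos: "m_par > 0"
  by (simp add: m_par_def r_par_def k_par_def)

lemma word_column_lt_modulus:
  assumes "word_column w = (x, y)" "length w \<le> 4 * m_par"
  shows "\<bar>y\<bar> < 2 ^ n_par"
proof -
  define k where "k = int k_par"
  have k: "k \<ge> 1" by (simp add: k_def k_par_def)
  \<comment> \<open>Here n = 272 m originates: the base is below 16k^2 = 2^68, and 4m letters give
    68 * 4m = 272m bits.\<close>
  have kk: "16 * k\<^sup>2 = 2 ^ 68" by (simp add: k_def k_par_def)
  have lt: "1 + 4 * k + 8 * k\<^sup>2 < 16 * k\<^sup>2" by (simp add: k_def k_par_def)
  have "\<bar>y\<bar> \<le> (1 + 4 * k + 8 * k\<^sup>2) ^ length w" using word_column_bound[OF assms(1)] by (simp add: k_def)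
  also have "\<dots> \<le> (1 + 4 * k + 8 * k\<^sup>2) ^ (4 * m_par)" using k assms(2) by (intro power_increasing) auto
  also have "\<dots> < (16 * k\<^sup>2) ^ (4 * m_par)" using k lt m_par_pos by (intro power_strict_mono) auto
  also have "\<dots> = 2 ^ (68 * (4 * m_par))" unfolding kk power_mult ..
  also have "68 * (4 * m_par) = n_par" by (simp add: n_par_def)
  finally show ?thesis .
qed

lemma of_int_word_eq_0_imp:
  assumes "(of_int y :: 'a::len word) = 0" "\<bar>y\<bar> < 2 ^ LENGTH('a)"
  shows "y = 0"
proof -
  have "2 ^ LENGTH('a) dvd y" using assms(1) word_of_int_eq_0_iff by blast
  then show ?thesis using assms(2) by (metis abs_of_nonneg dvd_imp_le_int linorder_not_less zero_le_numeral zero_le_power)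
qed

section \<open>Words acting on SL_2 over the integers modulo M\<close>

definition lmul :: "idx \<Rightarrow> SL2 \<Rightarrow> SL2" where
  "lmul j g = Abs_SL2 (a_mod j ** Rep_SL2 g)"

text \<open>The adjugate. As \<open>a_j\<close> has trace 2 and determinant 1, it is 1 + N with N^2
  = 0 and inverse 1 - N, which is why a mere sign \<open>s\<close> distinguishes the two cases in
  \<open>word_column\<close>.\<close>

definition a_inv :: "idx \<Rightarrow> Z_M^2^2" where
  "a_inv j = vector [vector [a_mod j $ 2 $ 2, - a_mod j $ 1 $ 2], vector [- a_mod j $ 2 $ 1, a_mod j $ 1 $ 1]]"

definition lmul_inv :: "idx \<Rightarrow> SL2 \<Rightarrow> SL2" where
  "lmul_inv j g = Abs_SL2 (a_inv j ** Rep_SL2 g)"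

lemma a_mod_nth:
  "a_mod j $ 1 $ 1 = of_int (1 + 4 * int (num_of_idx j))" "a_mod j $ 1 $ 2 = of_int (- 8 * (int (num_of_idx j))\<^sup>2)"
  "a_mod j $ 2 $ 1 = of_int 2" "a_mod j $ 2 $ 2 = of_int (1 - 4 * int (num_of_idx j))"
  by (simp_all only: a_mod_def a_int_def Let_def vec_lambda_beta vector_2)

lemma a_inv_nth:
  "a_inv j $ 1 $ 1 = of_int (1 - 4 * int (num_of_idx j))" "a_inv j $ 1 $ 2 = of_int (8 * (int (num_of_idx j))\<^sup>2)"
  "a_inv j $ 2 $ 1 = of_int (- 2)" "a_inv j $ 2 $ 2 = of_int (1 + 4 * int (num_of_idx j))"
  by (simp_all only: a_inv_def a_mod_nth vector_2 of_int_minus[symmetric] mult_minus_left minus_minus)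

lemma det_a_mod: "det (a_mod j) = 1"
proof -
  have "(1 + 4 * i) * (1 - 4 * i) - (- 8 * i\<^sup>2) * 2 = (1 :: int)" for i
    by (simp add: algebra_simps power2_eq_square)
  then show ?thesis
    unfolding det_2 a_mod_nth of_int_mult[symmetric] of_int_diff[symmetric] by (simp only: of_int_1)
qed

lemma matrix_2x2_eqI:
  fixes A B :: "'a^2^2"
  assumes "A $ 1 $ 1 = B $ 1 $ 1" "A $ 1 $ 2 = B $ 1 $ 2" "A $ 2 $ 1 = B $ 2 $ 1" "A $ 2 $ 2 = B $ 2 $ 2"
  shows "A = B"
  using assms by (simp add: vec_eq_iff forall_2)

lemma matrix_mult_2x2_nth:
  fixes A B :: "'a::semiring_1^2^2"
  shows "(A ** B) $ i $ j = A $ i $ 1 * B $ 1 $ j + A $ i $ 2 * B $ 2 $ j"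
  by (simp add: matrix_matrix_mult_def sum_2)

lemma a_inv_mult: "a_inv j ** a_mod j = mat 1" "a_mod j ** a_inv j = mat 1"
proof -
  have d: "a_mod j $ 1 $ 1 * a_mod j $ 2 $ 2 - a_mod j $ 1 $ 2 * a_mod j $ 2 $ 1 = 1"
    using det_a_mod[of j] by (simp only: det_2)
  then have d': "a_mod j $ 1 $ 1 * a_mod j $ 2 $ 2 = 1 + a_mod j $ 1 $ 2 * a_mod j $ 2 $ 1"
    by (simp only: diff_eq_eq)
  show "a_inv j ** a_mod j = mat 1" "a_mod j ** a_inv j = mat 1"
    by (rule matrix_2x2_eqI; use d' in \<open>simp add: matrix_mult_2x2_nth a_inv_def vector_2 mat_def algebra_simps\<close>)+
qed

lemma det_a_inv: "det (a_inv j) = 1"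
  using arg_cong[OF a_inv_mult(1)[of j], of det] by (simp add: det_mul det_a_mod)

lemma Rep_lmul: "Rep_SL2 (lmul j g) = a_mod j ** Rep_SL2 g"
  using Rep_SL2[of g] by (simp add: lmul_def Abs_SL2_inverse det_mul det_a_mod)

lemma Rep_lmul_inv: "Rep_SL2 (lmul_inv j g) = a_inv j ** Rep_SL2 g"
  using Rep_SL2[of g] by (simp add: lmul_inv_def Abs_SL2_inverse det_mul det_a_inv)

lemma lmul_lmul_inv [simp]: "lmul j (lmul_inv j g) = g"
  by (simp add: Rep_SL2_inject[symmetric] Rep_lmul Rep_lmul_inv matrix_mul_assoc a_inv_mult)

lemma lmul_inv_lmul [simp]: "lmul_inv j (lmul j g) = g"
  by (simp add: Rep_SL2_inject[symmetric] Rep_lmul Rep_lmul_inv matrix_mul_assoc a_inv_mult)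

fun word_act :: "idx list \<Rightarrow> SL2 \<Rightarrow> SL2" where
  "word_act [] g = g"
| "word_act (j # w) g = (if even (length w) then lmul j else lmul_inv j) (word_act w g)"

lemma word_act_toggle:
  "word_act (toggle i w) g = (if even (length w) then lmul i else lmul_inv i) (word_act w g)"
  by (cases w) (auto simp: toggle_def)

lemma word_act_toggle_toggle:
  "w \<in> reduced_words \<Longrightarrow> word_act (toggle j (toggle i w)) g = lmul_inv j (lmul i (word_act w g))"
  by (simp add: word_act_toggle even_length_toggle reduced_words_def)

text \<open>Only the first column of \<open>P\<close> is tracked, since a nonzero lower left entry
  is enough to exclude fixed points.\<close>

lemma word_act_matrix:
  "\<exists>P :: Z_M^2^2. (\<forall>g. Rep_SL2 (word_act w g) = P ** Rep_SL2 g) \<and>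
     P $ 1 $ 1 = of_int (fst (word_column w)) \<and> P $ 2 $ 1 = of_int (snd (word_column w))"
proof (induction w)
  case Nil
  have "(mat 1 :: Z_M^2^2) $ 1 $ 1 = 1" "(mat 1 :: Z_M^2^2) $ 2 $ 1 = 0" by (simp_all add: mat_def)
  then show ?case by (intro exI[of _ "mat 1"]) simp
next
  case (Cons j w)
  then obtain P :: "Z_M^2^2" where P: "\<And>g. Rep_SL2 (word_act w g) = P ** Rep_SL2 g"
    "P $ 1 $ 1 = of_int (fst (word_column w))" "P $ 2 $ 1 = of_int (snd (word_column w))" by blast
  obtain x y where xy: "word_column w = (x, y)" by (cases "word_column w")
  show ?case
  proof (cases "even (length w)")
    case True
    have "(a_mod j ** P) $ 1 $ 1 = of_int (fst (word_column (j # w)))" "(a_mod j ** P) $ 2 $ 1 = of_int (snd (word_column (j # w)))"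
      using True by (simp_all add: matrix_mult_2x2_nth a_mod_nth P xy Let_def)
    then show ?thesis
      using True by (intro exI[of _ "a_mod j ** P"]) (simp add: Rep_lmul P(1) matrix_mul_assoc)
  next
    case False
    have "(a_inv j ** P) $ 1 $ 1 = of_int (fst (word_column (j # w)))" "(a_inv j ** P) $ 2 $ 1 = of_int (snd (word_column (j # w)))"
      using False by (simp_all add: matrix_mult_2x2_nth a_inv_nth P xy Let_def)
    then show ?thesis
      using False by (intro exI[of _ "a_inv j ** P"]) (simp add: Rep_lmul_inv P(1) matrix_mul_assoc)
  qed
qed

text \<open>A fixed point gives P G = G with det G = 1, and Cramer's rule yields
  \<open>P $ 2 $ 1 = 0\<close>. The integer behind this residue is smaller than the modulus, so it
  is 0, but the ping-pong inequality has its absolute value as a strict upper bound.\<close>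

lemma word_act_fixpoint_free:
  assumes w: "distinct_adj w" "w \<noteq> []" "length w \<le> 4 * m_par"
  shows "word_act w g \<noteq> g"
proof
  assume fix_g: "word_act w g = g"
  obtain P :: "Z_M^2^2" where P: "\<And>g. Rep_SL2 (word_act w g) = P ** Rep_SL2 g"
    "P $ 2 $ 1 = of_int (snd (word_column w))" using word_act_matrix[of w] by blast
  obtain x y where xy: "word_column w = (x, y)" by (cases "word_column w")
  define G where "G = Rep_SL2 g"
  have PG: "P ** G = G" using P(1)[of g] fix_g by (simp add: G_def)
  have detG: "G $ 1 $ 1 * G $ 2 $ 2 - G $ 1 $ 2 * G $ 2 $ 1 = 1"
    using Rep_SL2[of g] by (simp add: G_def det_2)
  have e1: "P $ 2 $ 1 * G $ 1 $ 1 + P $ 2 $ 2 * G $ 2 $ 1 = G $ 2 $ 1"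
    using arg_cong[OF PG, of "\<lambda>A. A $ 2 $ 1"] by (simp only: matrix_mult_2x2_nth)
  have e2: "P $ 2 $ 1 * G $ 1 $ 2 + P $ 2 $ 2 * G $ 2 $ 2 = G $ 2 $ 2"
    using arg_cong[OF PG, of "\<lambda>A. A $ 2 $ 2"] by (simp only: matrix_mult_2x2_nth)
  have "P $ 2 $ 1 = P $ 2 $ 1 * (G $ 1 $ 1 * G $ 2 $ 2 - G $ 1 $ 2 * G $ 2 $ 1)" by (simp only: detG mult_1_right)
  also have "\<dots> = (P $ 2 $ 1 * G $ 1 $ 1 + P $ 2 $ 2 * G $ 2 $ 1) * G $ 2 $ 2 - (P $ 2 $ 1 * G $ 1 $ 2 + P $ 2 $ 2 * G $ 2 $ 2) * G $ 2 $ 1"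
    by (simp only: algebra_simps)
  also have "\<dots> = 0" unfolding e1 e2 by (simp only: mult.commute diff_self)
  finally have "of_int y = (0 :: Z_M)" using P(2) by (simp only: xy snd_conv)
  moreover have "\<bar>y\<bar> < 2 ^ LENGTH(1756130035408268427264000)"
    unfolding length_Z_M by (rule word_column_lt_modulus[OF xy w(3)])
  ultimately have "y = 0" by (rule of_int_word_eq_0_imp)
  moreover obtain l v where lv: "w = l # v" using w(2) by (cases w) auto
  have "\<bar>x - 2 * int (num_of_idx l) * y\<bar> < \<bar>y\<bar>"
    using w(1) xy unfolding lv by (rule word_column_ping_pong)
  ultimately show False by simp
qed

section \<open>Moments of the matrices \<open>T\<^sub>A\<close>\<close>

lemma U_mat_nth: "U_mat j $ h $ g = (if h = lmul j g then 1 else 0)"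
  by (simp add: U_mat_def Rep_SL2_inject[symmetric] Rep_lmul)

lemma U_mat_real: "cnj (U_mat j $ h $ g) = U_mat j $ h $ g"
  by (simp add: U_mat_nth)

lemma U_mat_mult_nth: "(U_mat j ** X) $ h $ g = X $ lmul_inv j h $ g"
proof -
  have "h = lmul j l \<longleftrightarrow> l = lmul_inv j h" for l by auto
  then show ?thesis by (simp add: matrix_mult_nth U_mat_nth mult_delta_left)
qed

lemma adj_U_mat_mult_nth: "(adj_mat (U_mat j) ** X) $ h $ g = X $ lmul j h $ g"
  by (simp add: matrix_mult_nth U_mat_real) (simp add: U_mat_nth mult_delta_left)

lemma unitary_U_mat: "unitary_mat (U_mat j)"
proof -
  have 1: "adj_mat (U_mat j) ** U_mat j = mat 1"
    unfolding vec_eq_iff adj_U_mat_mult_nth by (auto simp: U_mat_nth mat_def dest: arg_cong[of _ _ "lmul_inv j"])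
  then show ?thesis using matrix_left_right_inverse unfolding unitary_mat_def by blast
qed

lemma sum_delete_eq_sum_if:
  fixes f :: "'a::finite \<Rightarrow> complex"
  shows "(\<Sum>j\<in>UNIV - {i}. f j) = (\<Sum>j\<in>UNIV. if i = j then 0 else f j)"
  by (rule sum.mono_neutral_cong_left) auto

lemma T_mat_mult_nth:
  "(T_mat A ** X) $ h $ g =
     (\<Sum>i\<in>UNIV. \<Sum>j\<in>UNIV. (if i = j then 0 else A $ i $ j) * X $ lmul_inv j (lmul i h) $ g)"
proof -
  have "(T_mat A ** X) $ h $ g = (\<Sum>i\<in>UNIV. \<Sum>j\<in>UNIV - {i}. A $ i $ j * (adj_mat (U_mat i) ** (U_mat j ** X)) $ h $ g)"
    by (simp add: T_mat_def matrix_mult_sum_left smult_mat_mult_left matrix_mul_assoc)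
  also have "\<dots> = (\<Sum>i\<in>UNIV. \<Sum>j\<in>UNIV - {i}. A $ i $ j * X $ lmul_inv j (lmul i h) $ g)"
    by (simp add: adj_U_mat_mult_nth U_mat_mult_nth)
  also have "\<dots> = (\<Sum>i\<in>UNIV. \<Sum>j\<in>UNIV. (if i = j then 0 else A $ i $ j) * X $ lmul_inv j (lmul i h) $ g)"
    unfolding sum_delete_eq_sum_if by (intro sum.cong refl) auto
  finally show ?thesis .
qed

text \<open>On words too short to distinguish \<open>G\<close> from the free group, the powers of \<open>T\<^sub>A\<close> count walks on
  the free group.\<close>

lemma mat_pow_T_mat_eq_walk:
  assumes "v \<in> reduced_words" "length v + 2 * n \<le> 4 * m_par"
  shows "mat_pow (T_mat A) n $ word_act v g $ g = walk (\<lambda>i j. if i = j then 0 else A $ i $ j) n v"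
  using assms
proof (induction n arbitrary: v)
  case 0
  have "word_act v g = g \<longleftrightarrow> v = []"
    using word_act_fixpoint_free[of v g] 0 by (auto simp: reduced_words_def)
  then show ?case by (simp add: mat_def)
next
  case (Suc n)
  have "mat_pow (T_mat A) n $ lmul_inv j (lmul i (word_act v g)) $ g =
      walk (\<lambda>i j. if i = j then 0 else A $ i $ j) n (toggle j (toggle i v))" for i j
  proof -
    have "length (toggle j (toggle i v)) \<le> Suc (Suc (length v))"
      using length_toggle_le[of j "toggle i v"] length_toggle_le[of i v] by linarith
    then show ?thesis
      using Suc.IH[OF toggle_toggle_in_reduced_words[OF Suc.prems(1)], of j i] Suc.prems
      by (simp add: word_act_toggle_toggle)
  qed
  then show ?case using Suc.prems(1) by (simp add: mat_pow_Suc T_mat_mult_nth)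
qed

text \<open>Diagonal entries belong to the empty word, for which the length budget 2n <= 4m is
  exactly the hypothesis on \<open>n\<close>.\<close>

lemma norm_mat_pow_T_mat_diag_le:
  assumes A: "(\<Sum>i\<in>UNIV. \<Sum>j\<in>UNIV. (cmod (A $ i $ j))\<^sup>2) \<le> 1" and n: "n \<le> 2 * m_par"
  shows "cmod (mat_pow (T_mat A) n $ g $ g) \<le> 3 ^ n"
proof -
  have "mat_pow (T_mat A) n $ word_act [] g $ g = walk (\<lambda>i j. if i = j then 0 else A $ i $ j) n []"
    using n by (intro mat_pow_T_mat_eq_walk) (auto simp: reduced_words_def)
  moreover have "(\<Sum>i\<in>UNIV. \<Sum>j\<in>UNIV. (cmod (if i = j then 0 else A $ i $ j))\<^sup>2) \<le> 1"
    by (rule order_trans[OF _ A]) (intro sum_mono, auto)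
  ultimately show ?thesis using norm_walk_le[of "\<lambda>i j. if i = j then 0 else A $ i $ j" n "[]"] by simp
qed

section \<open>The net of coefficient matrices\<close>

lemma pairs_cases: "p \<noteq> q \<Longrightarrow> (p, q) \<in> pairs \<or> (q, p) \<in> pairs"
  using num_of_idx_inject[of p q] by (auto simp: pairs_def)

lemma pairs_asym: "(p, q) \<in> pairs \<Longrightarrow> (q, p) \<notin> pairs" "(p, p) \<notin> pairs"
  by (auto simp: pairs_def)

lemma sum_off_diagonal_eq_sum_pairs:
  fixes f :: "idx \<Rightarrow> idx \<Rightarrow> 'a::comm_monoid_add"
  shows "(\<Sum>i\<in>UNIV. \<Sum>j\<in>UNIV - {i}. f i j) = (\<Sum>(a, b)\<in>pairs. f a b + f b a)"
proof -
  have "(\<Sum>i\<in>UNIV. \<Sum>j\<in>UNIV - {i}. f i j) = (\<Sum>c\<in>Sigma UNIV (\<lambda>i. UNIV - {i}). f (fst c) (snd c))"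
    by (simp add: sum.Sigma case_prod_beta)
  also have "Sigma UNIV (\<lambda>i. UNIV - {i}) = pairs \<union> prod.swap ` pairs"
    using pairs_cases pairs_asym by (fastforce simp: image_iff)
  also have "(\<Sum>c\<in>pairs \<union> prod.swap ` pairs. f (fst c) (snd c)) =
      (\<Sum>c\<in>pairs. f (fst c) (snd c)) + (\<Sum>c\<in>prod.swap ` pairs. f (fst c) (snd c))"
    using pairs_asym by (intro sum.union_disjoint) auto
  also have "(\<Sum>c\<in>prod.swap ` pairs. f (fst c) (snd c)) = (\<Sum>c\<in>pairs. f (snd c) (fst c))"
    by (subst sum.reindex) (auto simp: inj_on_def)
  finally show ?thesis by (simp add: sum.distrib case_prod_beta)
qed

lemma card_idx: "CARD(idx) = k_par"
  using type_definition.card[OF type_definition_idx] by simp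

lemma card_pairs: "2 * card pairs = r_par"
proof -
  have "(\<Sum>i\<in>(UNIV :: idx set). \<Sum>j\<in>UNIV - {i}. 1) = (2 * card pairs :: nat)"
    unfolding sum_off_diagonal_eq_sum_pairs by (simp add: case_prod_beta)
  then show ?thesis by (simp add: card_idx r_par_def)
qed

section \<open>Entries of the net matrices\<close>

definition net_norm :: "(idx \<times> idx \<Rightarrow> int) \<times> (idx \<times> idx \<Rightarrow> int) \<Rightarrow> real" where
  "net_norm q = sqrt (\<Sum>e\<in>pairs. (real_of_int (fst q e))\<^sup>2 + (real_of_int (snd q e))\<^sup>2)"

lemma A_mat_nth:
  "A_mat q $ a $ b = of_real (1 / net_norm q) *
     ((if (a, b) \<in> pairs then (of_int (fst q (a, b)) + \<i> * of_int (snd q (a, b))) / of_real (sqrt 2) else 0)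
      + (if (b, a) \<in> pairs then (of_int (fst q (b, a)) - \<i> * of_int (snd q (b, a))) / of_real (sqrt 2) else 0))"
proof -
  let ?c = "\<lambda>e. (of_int (fst q e) + \<i> * of_int (snd q e)) / complex_of_real (sqrt 2)"
  let ?d = "\<lambda>e. (of_int (fst q e) - \<i> * of_int (snd q e)) / complex_of_real (sqrt 2)"
  have "(\<Sum>e\<in>pairs. real_of_int (fst q e) *\<^sub>R E_R e + real_of_int (snd q e) *\<^sub>R E_I e) $ a $ b =
      (\<Sum>e\<in>pairs. (if e = (a, b) then ?c e else 0) + (if e = (b, a) then ?d e else 0))"
    unfolding sum_component
  proof (intro sum.cong refl)
    fix e assume e: "e \<in> pairs"
    obtain s t where st: "e = (s, t)" by (cases e)
    then have "s \<noteq> t" using e pairs_asym by blast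
    have nth: "(real_of_int (fst q e) *\<^sub>R E_R e + real_of_int (snd q e) *\<^sub>R E_I e) $ a $ b =
        of_int (fst q e) * (1 / of_real (sqrt 2) * (ketbra s t $ a $ b + ketbra t s $ a $ b))
        + of_int (snd q e) * (\<i> / of_real (sqrt 2) * (ketbra s t $ a $ b - ketbra t s $ a $ b))"
      unfolding st E_R_def E_I_def prod.case vector_add_component vector_scaleR_component smult_mat_nth vector_minus_component
      by (simp only: scaleR_conv_of_real of_real_of_int_eq)
    consider "a = s" "b = t" | "a = t" "b = s" | "e \<noteq> (a, b)" "e \<noteq> (b, a)" using st by blast
    then show "(real_of_int (fst q e) *\<^sub>R E_R e + real_of_int (snd q e) *\<^sub>R E_I e) $ a $ b =
        (if e = (a, b) then ?c e else 0) + (if e = (b, a) then ?d e else 0)"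
    proof cases
      case 1
      then have k: "ketbra s t $ a $ b = 1" "ketbra t s $ a $ b = 0" using \<open>s \<noteq> t\<close> by (auto simp: ketbra_nth)
      have e': "e = (a, b)" "e \<noteq> (b, a)" using 1 st \<open>s \<noteq> t\<close> by auto
      show ?thesis unfolding nth k using e' by (simp add: add_divide_distrib)
    next
      case 2
      then have k: "ketbra s t $ a $ b = 0" "ketbra t s $ a $ b = 1" using \<open>s \<noteq> t\<close> by (auto simp: ketbra_nth)
      have e': "e \<noteq> (a, b)" "e = (b, a)" using 2 st \<open>s \<noteq> t\<close> by auto
      show ?thesis unfolding nth k using e' by (simp add: divide_inverse algebra_simps)
    next
      case 3
      then have k: "ketbra s t $ a $ b = 0" "ketbra t s $ a $ b = 0" using st by (auto simp: ketbra_nth)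
      show ?thesis unfolding nth k using 3 by simp
    qed
  qed
  also have "\<dots> = (if (a, b) \<in> pairs then ?c (a, b) else 0) + (if (b, a) \<in> pairs then ?d (b, a) else 0)"
    by (simp add: sum.distrib)
  finally have *: "(\<Sum>e\<in>pairs. real_of_int (fst q e) *\<^sub>R E_R e + real_of_int (snd q e) *\<^sub>R E_I e) $ a $ b =
      (if (a, b) \<in> pairs then ?c (a, b) else 0) + (if (b, a) \<in> pairs then ?d (b, a) else 0)" .
  have "A_mat q = (1 / net_norm q) *\<^sub>R (\<Sum>e\<in>pairs. real_of_int (fst q e) *\<^sub>R E_R e + real_of_int (snd q e) *\<^sub>R E_I e)"
    unfolding A_mat_def case_prod_beta net_norm_def ..
  then show ?thesis by (simp only: vector_scaleR_component scaleR_conv_of_real[of _ "_ :: complex"] *)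
qed

lemma adj_A_mat: "adj_mat (A_mat q) = A_mat q"
  using pairs_asym by (auto simp: vec_eq_iff A_mat_nth)

lemma A_mat_diag: "A_mat q $ a $ a = 0"
  by (simp add: A_mat_nth pairs_asym)

lemma sum_cmod_A_mat_le: "(\<Sum>i\<in>UNIV. \<Sum>j\<in>UNIV. (cmod (A_mat q $ i $ j))\<^sup>2) \<le> 1"
proof -
  define N where "N = net_norm q"
  have N2: "N\<^sup>2 = (\<Sum>e\<in>pairs. (real_of_int (fst q e))\<^sup>2 + (real_of_int (snd q e))\<^sup>2)"
    by (simp add: N_def net_norm_def sum_nonneg)
  have "(\<Sum>i\<in>UNIV. \<Sum>j\<in>UNIV. (cmod (A_mat q $ i $ j))\<^sup>2) = (\<Sum>i\<in>UNIV. \<Sum>j\<in>UNIV - {i}. (cmod (A_mat q $ i $ j))\<^sup>2)"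
    by (intro sum.cong refl sum.mono_neutral_right) (auto simp: A_mat_diag)
  also have "\<dots> = (\<Sum>(a, b)\<in>pairs. (cmod (A_mat q $ a $ b))\<^sup>2 + (cmod (A_mat q $ b $ a))\<^sup>2)"
    by (rule sum_off_diagonal_eq_sum_pairs)
  also have "\<dots> = (\<Sum>e\<in>pairs. ((real_of_int (fst q e))\<^sup>2 + (real_of_int (snd q e))\<^sup>2) / N\<^sup>2)"
  proof (intro sum.cong refl)
    fix e assume "e \<in> pairs"
    obtain a b where e: "e = (a, b)" by (cases e)
    have ab: "(a, b) \<in> pairs" "(b, a) \<notin> pairs" using \<open>e \<in> pairs\<close> pairs_asym by (auto simp: e)
    have c: "(cmod (of_real (1 / N) * (z / of_real (sqrt 2))))\<^sup>2 = (cmod z)\<^sup>2 / (2 * N\<^sup>2)" for z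
      by (simp add: norm_mult norm_divide power_divide power_mult_distrib)
    have z: "(cmod (of_int x + \<i> * of_int y))\<^sup>2 = (real_of_int x)\<^sup>2 + (real_of_int y)\<^sup>2"
      "(cmod (of_int x - \<i> * of_int y))\<^sup>2 = (real_of_int x)\<^sup>2 + (real_of_int y)\<^sup>2" for x y
      by (simp_all add: cmod_power2)
    show "(case e of (a, b) \<Rightarrow> (cmod (A_mat q $ a $ b))\<^sup>2 + (cmod (A_mat q $ b $ a))\<^sup>2) =
        ((real_of_int (fst q e))\<^sup>2 + (real_of_int (snd q e))\<^sup>2) / N\<^sup>2"
      unfolding e prod.case A_mat_nth N_def[symmetric] using ab
      by (simp only: if_True if_False add_0_left add_0_right c z)
  qed
  also have "\<dots> = N\<^sup>2 / N\<^sup>2" unfolding N2 by (rule sum_divide_distrib[symmetric])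
  \<comment> \<open>An inequality because \<open>N\<close> can be 0 for an arbitrary
    \<open>q\<close>, and then the quotient is 0.\<close>
  also have "\<dots> \<le> 1" by simp
  finally show ?thesis .
qed

lemma adj_T_mat:
  assumes "adj_mat A = A"
  shows "adj_mat (T_mat A) = T_mat A"
proof -
  have herm: "cnj (A $ i $ j) = A $ j $ i" for i j
    using arg_cong[OF assms, of "\<lambda>B. B $ j $ i"] by simp
  have "adj_mat (smult_mat (A $ i $ j) (adj_mat (U_mat i) ** U_mat j)) = smult_mat (A $ j $ i) (adj_mat (U_mat j) ** U_mat i)" for i j
  proof -
    have "adj_mat (smult_mat c B) = smult_mat (cnj c) (adj_mat B)" for c and B :: "complex^SL2^SL2"
      by (simp add: vec_eq_iff)
    then show ?thesis by (simp add: herm adj_mat_mult)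
  qed
  then show ?thesis
    unfolding T_mat_def adj_mat_sum sum_off_diagonal_eq_sum_pairs by (intro sum.cong refl) (auto simp: adj_mat_add add.commute)
qed

text \<open>A linear functional that is small on all directions of the integer grid is small in its own
  direction, which is rounded to the grid.\<close>

lemma functional_norm_le_of_net:
  fixes b :: "'i \<Rightarrow> real" and k L :: real and \<eta> :: int
  assumes I: "finite I" "real (card I) \<le> k\<^sup>2" and k: "k > 0" and \<eta>: "real_of_int \<eta> = 64 * k" and L: "L \<ge> 0"
    and net: "\<And>x :: 'i \<Rightarrow> int. (\<And>i. i \<in> I \<Longrightarrow> - \<eta> \<le> x i \<and> x i \<le> \<eta>) \<Longrightarrow> (\<exists>i\<in>I. x i \<noteq> 0) \<Longrightarrow>
        \<bar>\<Sum>i\<in>I. real_of_int (x i) * b i\<bar> \<le> L * sqrt (\<Sum>i\<in>I. (real_of_int (x i))\<^sup>2)"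
  shows "(\<Sum>i\<in>I. (b i)\<^sup>2) \<le> (L * 129 / 127)\<^sup>2"
proof -
  define B where "B = L2_set b I"
  have B2: "B\<^sup>2 = (\<Sum>i\<in>I. (b i)\<^sup>2)" by (simp add: B_def L2_set_def sum_nonneg)
  have B0: "B \<ge> 0" by (simp add: B_def)
  show ?thesis
  proof (cases "B = 0")
    case True
    then show ?thesis using B2 by simp
  next
    case False
    with B0 have B: "B > 0" by simp
    \<comment> \<open>The functional is scaled to length \<open>\<eta>\<close> before rounding. The
      error is at most 1/2 per coordinate, hence at most k/2 in total, small against
      \<open>\<eta> = 64 k\<close>.\<close>
    define x where "x i = round (\<eta> * b i / B)" for i
    define \<delta> where "\<delta> i = \<eta> * b i / B - real_of_int (x i)" for i
    have b_le: "\<bar>b i\<bar> \<le> B" if "i \<in> I" for i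
    proof -
      have "(b i)\<^sup>2 \<le> B\<^sup>2" unfolding B2 using that I by (intro member_le_sum) auto
      then show ?thesis using B by (metis abs_le_square_iff abs_of_pos)
    qed
    have \<eta>0: "real_of_int \<eta> > 0" using \<eta> k by simp
    have box: "- \<eta> \<le> x i \<and> x i \<le> \<eta>" if "i \<in> I" for i
    proof -
      have "- 1 \<le> b i / B" "b i / B \<le> 1" using b_le[OF that] B by (auto simp: le_divide_eq divide_le_eq abs_le_iff)
      then have "real_of_int \<eta> * (- 1) \<le> \<eta> * (b i / B)" "\<eta> * (b i / B) \<le> real_of_int \<eta> * 1"
        using \<eta>0 by (simp_all only: mult_le_cancel_left_pos)
      then have "\<eta> * b i / B \<le> \<eta>" "real_of_int (- \<eta>) \<le> \<eta> * b i / B" by simp_all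
      then have "round (\<eta> * b i / B) \<le> round (real_of_int \<eta>)" "round (real_of_int (- \<eta>)) \<le> round (\<eta> * b i / B)"
        by - (rule round_mono; assumption)+
      then show ?thesis by (simp only: x_def round_of_int)
    qed
    have \<delta>: "\<bar>\<delta> i\<bar> \<le> 1 / 2" for i
      using of_int_round_abs_le[of "\<eta> * b i / B"] by (simp add: \<delta>_def x_def abs_minus_commute)
    have "L2_set \<delta> I \<le> sqrt (\<Sum>i\<in>I. (1 / 2)\<^sup>2)"
      unfolding L2_set_def using \<delta> by (intro real_sqrt_le_mono sum_mono) (metis abs_le_square_iff abs_of_nonneg zero_le_divide_1_iff zero_le_numeral)
    also have "\<dots> \<le> sqrt ((k / 2)\<^sup>2)" using I by (intro real_sqrt_le_mono) (simp add: power_divide)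
    also have "\<dots> = k / 2" using k by simp
    finally have d: "L2_set \<delta> I \<le> k / 2" .
    have x_eq: "real_of_int (x i) = \<eta> / B * b i + - \<delta> i" for i by (simp add: \<delta>_def)
    have "L2_set (\<lambda>i. real_of_int (x i)) I \<le> L2_set (\<lambda>i. \<eta> / B * b i) I + L2_set (\<lambda>i. - \<delta> i) I"
      unfolding x_eq by (rule L2_set_triangle_ineq)
    also have "L2_set (\<lambda>i. \<eta> / B * b i) I = \<eta> / B * B"
      using \<eta>0 B unfolding B_def by (intro L2_set_right_distrib[symmetric]) auto
    also have "L2_set (\<lambda>i. - \<delta> i) I = L2_set \<delta> I" by (simp add: L2_set_def)
    finally have xn: "L2_set (\<lambda>i. real_of_int (x i)) I \<le> 64 * k + k / 2" using d B \<eta> by simp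
    have "\<bar>\<Sum>i\<in>I. real_of_int (x i) * b i\<bar> \<le> L * L2_set (\<lambda>i. real_of_int (x i)) I"
    proof (cases "\<exists>i\<in>I. x i \<noteq> 0")
      case True
      then show ?thesis unfolding L2_set_def using box by (intro net)
    next
      case False
      then have "(\<Sum>i\<in>I. real_of_int (x i) * b i) = 0" by (intro sum.neutral) auto
      then show ?thesis using L by (simp add: L2_set_nonneg)
    qed
    also have "\<dots> \<le> L * (64 * k + k / 2)" using xn L by (intro mult_left_mono)
    finally have 1: "(\<Sum>i\<in>I. real_of_int (x i) * b i) \<le> L * (64 * k + k / 2)" by simp
    have "(\<Sum>i\<in>I. \<delta> i * b i) \<le> (\<Sum>i\<in>I. \<bar>\<delta> i\<bar> * \<bar>b i\<bar>)"
      by (rule sum_mono) (simp add: abs_mult[symmetric])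
    also have "\<dots> \<le> L2_set \<delta> I * L2_set b I" by (rule L2_set_mult_ineq)
    also have "\<dots> \<le> k / 2 * B" using d B by (simp add: B_def mult_right_mono)
    finally have 2: "(\<Sum>i\<in>I. \<delta> i * b i) \<le> k / 2 * B" .
    \<comment> \<open>Evaluating the functional in its own scaled direction and splitting off the
      rounding error gives 64kB <= L(64k + k/2) + (k/2)B, whence the factor 129/127.\<close>
    have "64 * k * B = \<eta> / B * B\<^sup>2" using B \<eta> by (simp add: power2_eq_square)
    also have "\<dots> = (\<Sum>i\<in>I. real_of_int (x i) * b i) + (\<Sum>i\<in>I. \<delta> i * b i)"
      unfolding B2 sum_distrib_left sum.distrib[symmetric]
      by (intro sum.cong refl) (simp add: x_eq algebra_simps power2_eq_square)
    also have "\<dots> \<le> L * (64 * k + k / 2) + k / 2 * B" using 1 2 by simp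
    finally have "k * (127 * B) \<le> k * (129 * L)" by (simp add: algebra_simps)
    then have "B \<le> L * 129 / 127" using k by simp
    then show ?thesis unfolding B2[symmetric] using B0 by (intro power_mono)
  qed
qed

section \<open>The damping matrix\<close>

lemma mat_pow_T_mat_spectral:
  obtains V and t :: "SL2 \<Rightarrow> real" where "unitary_mat V"
    "(1 / L_par) *\<^sub>R T_mat (A_mat q) = V ** diag_mat (\<lambda>i. of_real (t i)) ** adj_mat V"
    "\<And>n. mat_pow ((1 / L_par) *\<^sub>R T_mat (A_mat q)) n = V ** diag_mat (\<lambda>i. of_real (t i ^ n)) ** adj_mat V"
proof -
  have "adj_mat ((1 / L_par) *\<^sub>R T_mat (A_mat q)) = (1 / L_par) *\<^sub>R T_mat (A_mat q)"
    by (simp add: adj_mat_scaleR adj_T_mat adj_A_mat)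
  then obtain V and t :: "SL2 \<Rightarrow> real" where "unitary_mat V"
    "(1 / L_par) *\<^sub>R T_mat (A_mat q) = V ** diag_mat (\<lambda>i. of_real (t i)) ** adj_mat V"
    by (rule spectral_theorem)
  then show ?thesis using that mat_pow_unitary_conj by metis
qed

definition R_term :: "(idx \<times> idx \<Rightarrow> int) \<times> (idx \<times> idx \<Rightarrow> int) \<Rightarrow> complex^SL2^SL2" where
  "R_term q = mat_pow ((1 / L_par) *\<^sub>R T_mat (A_mat q)) (2 * m_par)"

lemma adj_R_term: "adj_mat (R_term q) = R_term q"
  by (rule mat_pow_T_mat_spectral[of q]) (simp add: R_term_def adj_unitary_conj_diag del: of_real_power)

text \<open>The exponent 2m is even, so the eigenvalues are nonnegative. Hence each single term is
  dominated by \<open>R_mat\<close>, and one damping matrix serves all directions.\<close>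

lemma cdot_R_term_nonneg: "0 \<le> Re (cdot x (R_term q *v x))"
  by (rule mat_pow_T_mat_spectral[of q])
     (simp add: R_term_def cdot_unitary_conj_diag sum_nonneg del: of_real_power of_real_sum)

lemma finite_Q_set: "finite Q_set"
  unfolding Q_set_def by (intro finite_Diff finite_cartesian_product finite_PiE) auto

lemma Re_cdot_R_mat: "Re (cdot x (R_mat *v x)) = (\<Sum>q\<in>Q_set. Re (cdot x (R_term q *v x)))"
  by (simp add: R_mat_def R_term_def matrix_vector_mult_sum_left cdot_sum_right)

lemma cdot_R_term_le: "q \<in> Q_set \<Longrightarrow> Re (cdot x (R_term q *v x)) \<le> Re (cdot x (R_mat *v x))"
  unfolding Re_cdot_R_mat using finite_Q_set cdot_R_term_nonneg by (intro member_le_sum)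

lemma card_Q_set_le: "real (card Q_set) \<le> (2 * real_of_int eta_par + 1) ^ r_par"
proof -
  have "card Q_set \<le> card ((pairs \<rightarrow>\<^sub>E {- eta_par..eta_par}) \<times> (pairs \<rightarrow>\<^sub>E {- eta_par..eta_par}))"
    unfolding Q_set_def by (intro card_mono finite_cartesian_product finite_PiE) auto
  also have "\<dots> = card {- eta_par..eta_par} ^ (2 * card pairs)"
    by (simp add: card_cartesian_product card_PiE power_add mult_2 del: card_atLeastAtMost_int)
  also have "\<dots> = nat (2 * eta_par + 1) ^ r_par" by (simp add: card_pairs)
  finally have "real (card Q_set) \<le> real (nat (2 * eta_par + 1) ^ r_par)" by (rule of_nat_mono)
  moreover have "real (nat (2 * eta_par + 1)) = 2 * real_of_int eta_par + 1"
    by (simp add: eta_par_def)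
  ultimately show ?thesis by simp
qed

text \<open>The count is per coordinate: at most 2^40 grid values against the 700th power of 24/25,
  which is at most 2^(-41) since 700 = 17 * 41 + 3 and (24/25)^17 <= 1/2. A factor 1/2 remains for
  each of the r coordinates, and 14 of them suffice.\<close>

lemma damping_decay: "real (card Q_set) * (3 / L_par) ^ (2 * m_par) \<le> 1 / 10000"
proof -
  define b :: real where "b = 2 * real_of_int eta_par + 1"
  have b: "0 \<le> b" "b \<le> 2 ^ 40" by (simp_all add: b_def eta_par_def k_par_def)
  have "(24 / 25 :: real) ^ 700 = ((24 / 25) ^ 17) ^ 41 * (24 / 25) ^ 3"
    unfolding power_mult[symmetric] power_add[symmetric] by simp
  also have "\<dots> \<le> (1 / 2) ^ 41 * 1"
  proof (intro mult_mono power_mono)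
    show "(24 / 25 :: real) ^ 17 \<le> 1 / 2" by (simp add: power_divide divide_le_eq)
    show "(24 / 25 :: real) ^ 3 \<le> 1" by (simp add: power_divide)
  qed auto
  finally have p: "(24 / 25 :: real) ^ 700 \<le> (1 / 2) ^ 41" by simp
  have "b * (24 / 25) ^ 700 \<le> 2 ^ 40 * (1 / 2) ^ 41" using b p by (intro mult_mono) auto
  also have "\<dots> = 1 / 2" by (simp add: power_divide)
  finally have step: "b * (24 / 25) ^ 700 \<le> 1 / 2" .
  have m: "2 * m_par = 700 * r_par" by (simp add: m_par_def)
  have L: "3 / L_par = 24 / 25" by (simp add: L_par_def)
  have "real (card Q_set) * (3 / L_par) ^ (2 * m_par) \<le> b ^ r_par * (24 / 25) ^ (700 * r_par)"
    unfolding m L using card_Q_set_le by (intro mult_right_mono) (auto simp: b_def)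
  also have "\<dots> = (b * (24 / 25) ^ 700) ^ r_par" by (simp only: power_mult power_mult_distrib)
  also have "\<dots> \<le> (1 / 2) ^ r_par" using b step by (intro power_mono) auto
  also have "\<dots> \<le> (1 / 2) ^ 14"
    by (intro power_decreasing) (auto simp: r_par_def k_par_def)
  also have "\<dots> \<le> (1 / 10000 :: real)" by (simp add: power_divide)
  finally show ?thesis .
qed

lemma R_mat_spectral:
  obtains V and r :: "SL2 \<Rightarrow> real" where "unitary_mat V" "\<And>i. 0 \<le> r i"
    "R_mat = V ** diag_mat (\<lambda>i. of_real (r i)) ** adj_mat V"
    "(\<Sum>i\<in>UNIV. r i) \<le> real CARD(SL2) / 10000"
proof -
  have "adj_mat R_mat = R_mat"
    using adj_R_term by (simp add: R_mat_def R_term_def[symmetric] adj_mat_sum)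
  then obtain V and r :: "SL2 \<Rightarrow> real" where V: "unitary_mat V"
    and R: "R_mat = V ** diag_mat (\<lambda>i. of_real (r i)) ** adj_mat V" by (rule spectral_theorem)
  have r: "0 \<le> r i" for i
  proof -
    have "0 \<le> Re (cdot (column i V) (R_mat *v column i V))"
      unfolding Re_cdot_R_mat by (intro sum_nonneg cdot_R_term_nonneg)
    then show ?thesis unfolding R cdot_column_eigen[OF V] by simp
  qed
  have term_le: "cmod (trace (R_term q)) \<le> real CARD(SL2) * (3 / L_par) ^ (2 * m_par)" for q
  proof -
    have "cmod (R_term q $ g $ g) \<le> (3 / L_par) ^ (2 * m_par)" for g
    proof -
      have "cmod (R_term q $ g $ g) = (1 / L_par) ^ (2 * m_par) * cmod (mat_pow (T_mat (A_mat q)) (2 * m_par) $ g $ g)"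
        unfolding R_term_def mat_pow_scaleR by (simp add: L_par_def)
      also have "\<dots> \<le> (1 / L_par) ^ (2 * m_par) * 3 ^ (2 * m_par)"
        by (intro mult_left_mono norm_mat_pow_T_mat_diag_le sum_cmod_A_mat_le) (auto simp: L_par_def)
      also have "\<dots> = (3 / L_par) ^ (2 * m_par)" by (simp add: power_mult_distrib[symmetric])
      finally show ?thesis .
    qed
    then have "(\<Sum>g\<in>UNIV. cmod (R_term q $ g $ g)) \<le> (\<Sum>g\<in>(UNIV :: SL2 set). (3 / L_par) ^ (2 * m_par))"
      by (rule sum_mono)
    then show ?thesis unfolding trace_eq_sum by (simp add: norm_sum order_trans[OF norm_sum])
  qed
  have "(\<Sum>i\<in>UNIV. r i) = Re (trace R_mat)" unfolding R trace_unitary_conj_diag[OF V] by simp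
  also have "\<dots> \<le> cmod (trace R_mat)" by (rule complex_Re_le_cmod)
  also have "\<dots> \<le> (\<Sum>q\<in>Q_set. cmod (trace (R_term q)))"
    by (simp add: R_mat_def R_term_def trace_sum norm_sum)
  also have "\<dots> \<le> (\<Sum>q\<in>Q_set. real CARD(SL2) * (3 / L_par) ^ (2 * m_par))" by (intro sum_mono term_le)
  also have "\<dots> = real CARD(SL2) * (real (card Q_set) * (3 / L_par) ^ (2 * m_par))" by simp
  also have "\<dots> \<le> real CARD(SL2) * (1 / 10000)" by (intro mult_left_mono damping_decay) simp
  finally show ?thesis using that[OF V r R] by simp
qed

lemma F_mat_spectral:
  obtains V and f :: "SL2 \<Rightarrow> real" where "unitary_mat V" "\<And>i. 0 < f i" "\<And>i. f i \<le> 1"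
    "F_mat = V ** diag_mat (\<lambda>i. of_real (f i)) ** adj_mat V"
    "(\<Sum>i\<in>UNIV. 1 - f i) \<le> real CARD(SL2) / 10000"
    "(mat 1 + R_mat) ** F_mat = mat 1" "F_mat ** (mat 1 + R_mat) = mat 1"
proof -
  obtain V and r :: "SL2 \<Rightarrow> real" where V: "unitary_mat V" and r: "\<And>i. 0 \<le> r i"
    and R: "R_mat = V ** diag_mat (\<lambda>i. of_real (r i)) ** adj_mat V"
    and sum: "(\<Sum>i\<in>UNIV. r i) \<le> real CARD(SL2) / 10000" using R_mat_spectral by blast
  define f where "f i = 1 / (1 + r i)" for i
  define F where "F = V ** diag_mat (\<lambda>i. of_real (f i)) ** adj_mat V"
  have pos: "1 + r i > 0" for i using r[of i] by simp
  have IR: "mat 1 + R_mat = V ** diag_mat (\<lambda>i. of_real (1 + r i)) ** adj_mat V"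
    unfolding R unitary_conj_1[OF V, symmetric] unitary_conj_diag_add by simp
  have "(1 + r i) * f i = 1" "f i * (1 + r i) = 1" for i using pos[of i] by (auto simp: f_def)
  then have inv: "(mat 1 + R_mat) ** F = mat 1" "F ** (mat 1 + R_mat) = mat 1"
    unfolding IR F_def unitary_conj_diag_mult[OF V] by (simp_all add: unitary_conj_1[OF V])
  \<comment> \<open>\<open>matrix_inv\<close> is a choice operator; exhibiting an inverse makes the
    choice meaningful, and uniqueness identifies it.\<close>
  have "F_mat = F"
  proof -
    have "\<exists>A'. (mat 1 + R_mat) ** A' = mat 1 \<and> A' ** (mat 1 + R_mat) = mat 1" using inv by blast
    then have "F_mat ** (mat 1 + R_mat) = mat 1" unfolding F_mat_def matrix_inv_def by (metis (mono_tags, lifting) someI_ex)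
    then show ?thesis by (metis inv(1) matrix_mul_assoc matrix_mul_lid matrix_mul_rid)
  qed
  have f: "0 < f i" "f i \<le> 1" "1 - f i \<le> r i" for i
  proof -
    show "0 < f i" "f i \<le> 1" using r[of i] pos[of i] by (auto simp: f_def)
    have "1 - f i = r i / (1 + r i)" using pos[of i] by (simp add: f_def field_simps)
    also have "\<dots> \<le> r i / 1" using r[of i] by (intro divide_left_mono) auto
    finally show "1 - f i \<le> r i" by simp
  qed
  have "(\<Sum>i\<in>UNIV. 1 - f i) \<le> (\<Sum>i\<in>UNIV. r i)" by (intro sum_mono f)
  then have "(\<Sum>i\<in>UNIV. 1 - f i) \<le> real CARD(SL2) / 10000" using sum by linarith
  then show ?thesis
    by (rule that[OF V f(1) f(2) \<open>F_mat = F\<close>[unfolded F_def] _ inv[folded \<open>F_mat = F\<close>]])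
qed

lemma abs_le_1_add_even_power:
  fixes t :: real
  assumes "m > 0"
  shows "\<bar>t\<bar> \<le> 1 + t ^ (2 * m)"
proof (cases "\<bar>t\<bar> \<le> 1")
  case True
  then show ?thesis by (simp add: add_increasing2)
next
  case False
  then have "\<bar>t\<bar> ^ 1 \<le> \<bar>t\<bar> ^ (2 * m)" using assms by (intro power_increasing) auto
  then show ?thesis by (simp add: power_mult)
qed

lemma adj_F_mat: "adj_mat F_mat = F_mat"
proof -
  obtain V and f :: "SL2 \<Rightarrow> real" where F: "F_mat = V ** diag_mat (\<lambda>i. of_real (f i)) ** adj_mat V"
    using F_mat_spectral by metis
  show ?thesis unfolding F by (rule adj_unitary_conj_diag)
qed

text \<open>With \<open>\<phi> = F \<psi>\<close>, so that \<open>\<psi> = \<phi> + R \<phi>\<close>, the quadratic form of \<open>T\<^sub>q / L\<close> at \<open>\<phi>\<close> is at most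
  \<open>\<parallel>\<phi>\<parallel>\<^sup>2 + \<langle>\<phi>, R \<phi>\<rangle> \<le> \<parallel>\<psi>\<parallel>\<^sup>2\<close>, because \<open>\<bar>t\<bar> \<le> 1 + t\<^bsup>2m\<^esup>\<close>.\<close>

lemma damped_T_mat_form_le:
  assumes q: "q \<in> Q_set"
  shows "cmod (cdot \<psi> ((F_mat ** T_mat (A_mat q) ** F_mat) *v \<psi>)) \<le> L_par * (norm \<psi>)\<^sup>2"
proof -
  define \<phi> where "\<phi> = F_mat *v \<psi>"
  have "(mat 1 + R_mat) ** F_mat = mat 1" by (rule F_mat_spectral)
  then have "(mat 1 + R_mat) *v \<phi> = \<psi>" by (simp add: \<phi>_def matrix_vector_mul_assoc)
  then have \<psi>: "\<psi> = \<phi> + R_mat *v \<phi>" by (simp add: matrix_vector_mult_add_rdistrib)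
  obtain V and t :: "SL2 \<Rightarrow> real" where V: "unitary_mat V"
    and T: "(1 / L_par) *\<^sub>R T_mat (A_mat q) = V ** diag_mat (\<lambda>i. of_real (t i)) ** adj_mat V"
    and P: "\<And>n. mat_pow ((1 / L_par) *\<^sub>R T_mat (A_mat q)) n = V ** diag_mat (\<lambda>i. of_real (t i ^ n)) ** adj_mat V"
    using mat_pow_T_mat_spectral[of q] by blast
  define y where "y i = (cmod ((adj_mat V *v \<phi>) $ i))\<^sup>2" for i
  have y: "y i \<ge> 0" for i by (simp add: y_def)
  have sum_y: "(\<Sum>i\<in>UNIV. y i) = (norm \<phi>)\<^sup>2"
    unfolding y_def norm_vec_sq[symmetric] norm_unitary_mult[OF V] ..
  have L: "L_par > 0" by (simp add: L_par_def)
  have "cdot \<phi> (T_mat (A_mat q) *v \<phi>) = L_par *\<^sub>R cdot \<phi> (((1 / L_par) *\<^sub>R T_mat (A_mat q)) *v \<phi>)"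
    using L by (simp add: matrix_vector_mult_scaleR_left cdot_scaleR_right)
  also have "\<dots> = L_par *\<^sub>R of_real (\<Sum>i\<in>UNIV. t i * y i)"
    unfolding T cdot_unitary_conj_diag y_def ..
  finally have "cdot \<phi> (T_mat (A_mat q) *v \<phi>) = L_par *\<^sub>R of_real (\<Sum>i\<in>UNIV. t i * y i)" .
  moreover have "cdot \<psi> ((F_mat ** T_mat (A_mat q) ** F_mat) *v \<psi>) = cdot \<phi> (T_mat (A_mat q) *v \<phi>)"
    by (simp add: \<phi>_def matrix_vector_mul_assoc[symmetric] cdot_adj_mat[of \<psi>] adj_F_mat)
  ultimately have "cmod (cdot \<psi> ((F_mat ** T_mat (A_mat q) ** F_mat) *v \<psi>)) = L_par * \<bar>\<Sum>i\<in>UNIV. t i * y i\<bar>"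
    using L by (simp del: of_real_sum of_real_mult)
  also have "\<bar>\<Sum>i\<in>UNIV. t i * y i\<bar> \<le> (norm \<psi>)\<^sup>2"
  proof -
    have "\<bar>\<Sum>i\<in>UNIV. t i * y i\<bar> \<le> (\<Sum>i\<in>UNIV. \<bar>t i\<bar> * y i)"
      using y by (intro order_trans[OF sum_abs]) (simp add: abs_mult)
    also have "\<dots> \<le> (\<Sum>i\<in>UNIV. (1 + t i ^ (2 * m_par)) * y i)"
      using y by (intro sum_mono mult_right_mono abs_le_1_add_even_power m_par_pos)
    also have "\<dots> = (norm \<phi>)\<^sup>2 + Re (cdot \<phi> (R_term q *v \<phi>))"
      unfolding R_term_def P cdot_unitary_conj_diag y_def[symmetric] Re_complex_of_real
      by (simp add: distrib_right sum.distrib sum_y)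
    also have "\<dots> \<le> (norm \<phi>)\<^sup>2 + Re (cdot \<phi> (R_mat *v \<phi>))" using cdot_R_term_le[OF q] by simp
    also have "\<dots> \<le> (norm \<psi>)\<^sup>2"
    proof -
      have "0 \<le> Re (cdot \<phi> (R_mat *v \<phi>))"
        unfolding Re_cdot_R_mat by (intro sum_nonneg cdot_R_term_nonneg)
      moreover have "Re (cdot (R_mat *v \<phi>) \<phi>) = Re (cdot \<phi> (R_mat *v \<phi>))" by (metis cnj_cdot cnj.sel(1))
      moreover have "(norm \<psi>)\<^sup>2 = Re (cdot \<psi> \<psi>)" by (simp only: cdot_self Re_complex_of_real)
      moreover have "Re (cdot \<psi> \<psi>) = (norm \<phi>)\<^sup>2 + Re (cdot \<phi> (R_mat *v \<phi>)) + Re (cdot (R_mat *v \<phi>) \<phi>) + (norm (R_mat *v \<phi>))\<^sup>2"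
        unfolding \<psi> cdot_add_left cdot_add_right plus_complex.sel
        unfolding cdot_self Re_complex_of_real by simp
      ultimately show ?thesis by simp
    qed
    finally show ?thesis .
  qed
  finally show ?thesis using L by simp
qed

lemma damped_T_mat_expectation_le:
  assumes q: "q \<in> Q_set" and \<rho>: "density_matrix \<rho>"
  shows "cmod (trace (T_mat (A_mat q) ** (F_mat ** \<rho> ** F_mat))) \<le> L_par"
proof -
  obtain V and e :: "SL2 \<Rightarrow> real" where V: "unitary_mat V" and e: "prob_vec e"
    and \<rho>_eq: "\<rho> = V ** diag_mat (\<lambda>i. of_real (e i)) ** adj_mat V" using density_matrix_spectral[OF \<rho>] by metis
  have e0: "e i \<ge> 0" for i using e by (simp add: prob_vec_def)
  let ?T = "T_mat (A_mat q)"
  have "trace (?T ** (F_mat ** \<rho> ** F_mat)) = trace ((?T ** F_mat ** \<rho>) ** F_mat)" by (simp add: matrix_mul_assoc)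
  also have "\<dots> = trace (F_mat ** (?T ** F_mat ** \<rho>))" by (rule trace_mult_commute)
  also have "\<dots> = trace ((F_mat ** ?T ** F_mat) ** \<rho>)" by (simp add: matrix_mul_assoc)
  also have "\<dots> = (\<Sum>i\<in>UNIV. of_real (e i) * cdot (column i V) ((F_mat ** ?T ** F_mat) *v column i V))"
    unfolding \<rho>_eq by (rule trace_mult_unitary_conj_diag)
  also have "cmod \<dots> \<le> (\<Sum>i\<in>UNIV. e i * L_par)"
  proof (rule sum_norm_le)
    fix i
    show "cmod (of_real (e i) * cdot (column i V) ((F_mat ** ?T ** F_mat) *v column i V)) \<le> e i * L_par"
      using damped_T_mat_form_le[OF q, of "column i V"] e0[of i]
      by (simp add: norm_mult norm_column_unitary[OF V] mult_left_mono)
  qed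
  also have "\<dots> = L_par" using e by (simp add: sum_distrib_right[symmetric] prob_vec_def)
  finally show ?thesis .
qed

section \<open>Outputs of the channel are nearly maximally mixed\<close>

definition overlap :: "complex^SL2^SL2 \<Rightarrow> idx \<Rightarrow> idx \<Rightarrow> complex" where
  "overlap Y i j = trace (U_mat i ** Y ** adj_mat (U_mat j))"

lemma cnj_overlap:
  assumes "adj_mat Y = Y"
  shows "cnj (overlap Y i j) = overlap Y j i"
proof -
  have "cnj (trace A) = trace (adj_mat A)" for A :: "complex^SL2^SL2" by (simp add: trace_eq_sum)
  then show ?thesis by (simp add: overlap_def adj_mat_mult assms matrix_mul_assoc)
qed

lemma trace_T_mat_mult: "trace (T_mat A ** Y) = (\<Sum>i\<in>UNIV. \<Sum>j\<in>UNIV - {i}. A $ i $ j * overlap Y j i)"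
proof -
  have "trace (adj_mat (U_mat i) ** U_mat j ** Y) = overlap Y j i" for i j
    using trace_mult_commute[of "adj_mat (U_mat i)" "U_mat j ** Y"] by (simp add: overlap_def matrix_mul_assoc)
  then show ?thesis
    by (simp add: T_mat_def matrix_mult_sum_left trace_sum smult_mat_mult_left trace_smult_mat)
qed

lemma trace_T_mat_A_mat_mult:
  assumes "adj_mat Y = Y"
  shows "trace (T_mat (A_mat q) ** Y) = of_real (1 / net_norm q *
     (\<Sum>e\<in>pairs. sqrt 2 * (real_of_int (fst q e) * Re (overlap Y (fst e) (snd e)) +
        real_of_int (snd q e) * Im (overlap Y (fst e) (snd e)))))"
proof -
  have "trace (T_mat (A_mat q) ** Y) =
      (\<Sum>(a, b)\<in>pairs. A_mat q $ a $ b * overlap Y b a + A_mat q $ b $ a * overlap Y a b)"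
    unfolding trace_T_mat_mult by (rule sum_off_diagonal_eq_sum_pairs)
  also have "\<dots> = (\<Sum>e\<in>pairs. of_real (1 / net_norm q * (sqrt 2 * (real_of_int (fst q e) * Re (overlap Y (fst e) (snd e)) +
        real_of_int (snd q e) * Im (overlap Y (fst e) (snd e))))))"
  proof (intro sum.cong refl)
    fix e assume "e \<in> pairs"
    obtain a b where e: "e = (a, b)" by (cases e)
    have ab: "(a, b) \<in> pairs" "(b, a) \<notin> pairs" using \<open>e \<in> pairs\<close> pairs_asym by (auto simp: e)
    define X where "X = overlap Y a b"
    define x y where "x = real_of_int (fst q e)" and "y = real_of_int (snd q e)"
    have ba: "overlap Y b a = cnj X" using cnj_overlap[OF assms, of a b] by (simp add: X_def)
    have A: "A_mat q $ a $ b = of_real (1 / net_norm q) * ((of_real x + \<i> * of_real y) / of_real (sqrt 2))"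
      "A_mat q $ b $ a = of_real (1 / net_norm q) * ((of_real x - \<i> * of_real y) / of_real (sqrt 2))"
      using ab by (simp_all add: A_mat_nth x_def y_def e)
    have dist: "n * (u / s) * p + n * (v / s) * r = n * ((u * p + v * r) / s)" for n u v s p r :: complex
      by (simp add: divide_inverse algebra_simps)
    have "A_mat q $ a $ b * overlap Y b a + A_mat q $ b $ a * overlap Y a b =
        of_real (1 / net_norm q) * (((of_real x + \<i> * of_real y) * cnj X + (of_real x - \<i> * of_real y) * X) / of_real (sqrt 2))"
      unfolding ba A X_def[symmetric] by (rule dist)
    also have "\<dots> = of_real (1 / net_norm q / sqrt 2) * ((of_real x + \<i> * of_real y) * cnj X + (of_real x - \<i> * of_real y) * X)"
      by simp
    also have "(of_real x + \<i> * of_real y) * cnj X + (of_real x - \<i> * of_real y) * X = of_real (2 * (x * Re X + y * Im X))"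
      by (simp add: complex_eq_iff algebra_simps)
    also have "of_real (1 / net_norm q / sqrt 2) * complex_of_real (2 * (x * Re X + y * Im X)) =
        of_real (1 / net_norm q * (2 / sqrt 2 * (x * Re X + y * Im X)))" by (simp flip: of_real_mult add: algebra_simps)
    also have "2 / sqrt 2 = sqrt (2 :: real)" by (simp add: real_div_sqrt)
    finally show "(case e of (a, b) \<Rightarrow> A_mat q $ a $ b * overlap Y b a + A_mat q $ b $ a * overlap Y a b) =
        of_real (1 / net_norm q * (sqrt 2 * (real_of_int (fst q e) * Re (overlap Y (fst e) (snd e)) +
          real_of_int (snd q e) * Im (overlap Y (fst e) (snd e)))))"
      by (simp add: e X_def x_def y_def)
  qed
  finally show ?thesis by (simp only: of_real_sum sum_distrib_left)
qed

text \<open>\<open>129/127 \<cdot> L\<close>, where the factor comes from rounding directions to the grid \<open>{-\<eta>..\<eta>}\<^sup>r\<close>.\<close>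

definition offdiag_bound :: real where "offdiag_bound = 3225 / 1016"

lemma sum_offdiag_overlap_le:
  assumes \<rho>: "density_matrix \<rho>"
  shows "(\<Sum>i\<in>UNIV. \<Sum>j\<in>UNIV - {i}. (cmod (overlap (F_mat ** \<rho> ** F_mat) i j))\<^sup>2) \<le> offdiag_bound\<^sup>2"
proof -
  define Y where "Y = F_mat ** \<rho> ** F_mat"
  have herm: "adj_mat Y = Y"
    using \<rho> by (simp add: Y_def adj_mat_mult adj_F_mat matrix_mul_assoc density_matrix_def psd_mat_def)
  define X where "X e = overlap Y (fst e) (snd e)" for e
  define b where "b = case_sum (\<lambda>e. sqrt 2 * Re (X e)) (\<lambda>e. sqrt 2 * Im (X e))"
  define I where "I = pairs <+> pairs"
  have sum_I: "(\<Sum>i\<in>I. f i) = (\<Sum>e\<in>pairs. f (Inl e) + f (Inr e))" for f :: "_ \<Rightarrow> real"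
    unfolding I_def by (subst sum.Plus) (simp_all add: sum.distrib)
  have "(\<Sum>i\<in>I. (b i)\<^sup>2) \<le> (L_par * 129 / 127)\<^sup>2"
  proof (rule functional_norm_le_of_net[where k = "real k_par" and \<eta> = eta_par])
    show "finite I" by (simp add: I_def)
    have "card I = r_par" using card_pairs by (simp add: I_def card_Plus)
    also have "r_par \<le> k_par\<^sup>2" by (simp add: r_par_def power2_eq_square)
    finally show "real (card I) \<le> (real k_par)\<^sup>2" by (metis of_nat_le_iff of_nat_power)
    show "real k_par > 0" "L_par \<ge> 0" by (simp_all add: k_par_def L_par_def)
    show "real_of_int eta_par = 64 * real k_par" by (simp add: eta_par_def)
    fix x :: "(idx \<times> idx) + (idx \<times> idx) \<Rightarrow> int"
    assume box: "\<And>i. i \<in> I \<Longrightarrow> - eta_par \<le> x i \<and> x i \<le> eta_par" and nz: "\<exists>i\<in>I. x i \<noteq> 0"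
    define q where "q = (\<lambda>e\<in>pairs. x (Inl e), \<lambda>e\<in>pairs. x (Inr e))"
    have q: "fst q e = x (Inl e)" "snd q e = x (Inr e)" if "e \<in> pairs" for e using that by (simp_all add: q_def)
    have "q \<noteq> (\<lambda>e\<in>pairs. 0, \<lambda>e\<in>pairs. 0)"
    proof
      assume "q = (\<lambda>e\<in>pairs. 0, \<lambda>e\<in>pairs. 0)"
      then have "x (Inl e) = 0" "x (Inr e) = 0" if "e \<in> pairs" for e using q[OF that] that by simp_all
      then show False using nz by (auto simp: I_def)
    qed
    moreover have "- eta_par \<le> x (Inl e) \<and> x (Inl e) \<le> eta_par" "- eta_par \<le> x (Inr e) \<and> x (Inr e) \<le> eta_par"
      if "e \<in> pairs" for e using box[of "Inl e"] box[of "Inr e"] that by (auto simp: I_def)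
    ultimately have "q \<in> Q_set" by (auto simp: Q_set_def q_def)
    have nn: "net_norm q = sqrt (\<Sum>i\<in>I. (real_of_int (x i))\<^sup>2)"
      unfolding net_norm_def sum_I by (intro arg_cong[of _ _ sqrt] sum.cong refl) (simp add: q)
    have "net_norm q > 0"
    proof -
      obtain i where "i \<in> I" "x i \<noteq> 0" using nz by blast
      then have "0 < (\<Sum>i\<in>I. (real_of_int (x i))\<^sup>2)" by (intro sum_pos2[of _ i]) (auto simp: I_def)
      then show ?thesis by (simp add: nn)
    qed
    have "(\<Sum>i\<in>I. real_of_int (x i) * b i) = (\<Sum>e\<in>pairs. sqrt 2 * (real_of_int (fst q e) * Re (X e) + real_of_int (snd q e) * Im (X e)))"
      unfolding sum_I by (intro sum.cong refl) (simp add: q b_def algebra_simps)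
    then have "trace (T_mat (A_mat q) ** Y) = of_real (1 / net_norm q * (\<Sum>i\<in>I. real_of_int (x i) * b i))"
      unfolding trace_T_mat_A_mat_mult[OF herm] X_def by simp
    then have "\<bar>1 / net_norm q * (\<Sum>i\<in>I. real_of_int (x i) * b i)\<bar> \<le> L_par"
      using damped_T_mat_expectation_le[OF \<open>q \<in> Q_set\<close> \<rho>] by (simp only: Y_def[symmetric] norm_of_real)
    then have "\<bar>\<Sum>i\<in>I. real_of_int (x i) * b i\<bar> \<le> L_par * net_norm q"
      using \<open>net_norm q > 0\<close> by (simp add: abs_mult divide_le_eq)
    then show "\<bar>\<Sum>i\<in>I. real_of_int (x i) * b i\<bar> \<le> L_par * sqrt (\<Sum>i\<in>I. (real_of_int (x i))\<^sup>2)" by (simp add: nn)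
  qed
  also have "L_par * 129 / 127 = offdiag_bound" by (simp add: L_par_def offdiag_bound_def)
  also have "(\<Sum>i\<in>I. (b i)\<^sup>2) = (\<Sum>e\<in>pairs. 2 * (cmod (X e))\<^sup>2)"
    unfolding sum_I by (intro sum.cong refl) (simp add: b_def power_mult_distrib cmod_power2)
  also have "\<dots> = (\<Sum>i\<in>UNIV. \<Sum>j\<in>UNIV - {i}. (cmod (overlap Y i j))\<^sup>2)"
  proof -
    have "cmod (overlap Y i j) = cmod (overlap Y j i)" for i j by (metis cnj_overlap[OF herm] complex_mod_cnj)
    then show ?thesis unfolding sum_off_diagonal_eq_sum_pairs by (intro sum.cong refl) (auto simp: X_def)
  qed
  finally show ?thesis by (simp add: Y_def)
qed

section \<open>The entropy gap\<close>

lemma ln_2_ge: "11 / 16 \<le> ln (2 :: real)"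
proof -
  have "exp (11 :: real) = exp 1 ^ 11" by (simp flip: exp_of_nat_mult)
  also have "\<dots> \<le> (272 / 100) ^ 11" using e_less_272 by (intro power_mono) auto
  also have "\<dots> \<le> 2 ^ 16" by (simp add: power_divide)
  finally have "ln (exp 11) \<le> ln ((2 :: real) ^ 16)" by (intro ln_mono) auto
  moreover have "ln ((2 :: real) ^ 16) = 16 * ln 2" by (subst ln_realpow) simp_all
  ultimately show ?thesis by (simp only: ln_exp)
qed

lemma ln_mult_nat_le: "0 < x \<Longrightarrow> x ^ n \<le> y \<Longrightarrow> real n * ln x \<le> ln (y :: real)"
  by (metis ln_mono ln_realpow zero_less_power)

text \<open>For \<open>p \<le> 2\<close> the output entropies of \<open>\<Phi>\<close> are compared through their value at \<open>p = 2\<close> and those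
  of \<open>\<Phi> \<otimes> \<Phi>\<close> through their value at \<open>p = 1\<close>; for \<open>2 < p \<le> 11/5\<close> through interpolation between \<open>2\<close> and
  \<open>\<infinity>\<close> and the value at \<open>p = 2\<close>; for larger \<open>p\<close> through the largest eigenvalues.\<close>

lemma entropy_gap:
  fixes p :: ereal
  defines "k \<equiv> real CARD(idx)"
  assumes p: "1 \<le> p"
  shows "\<exists>low up. (\<forall>s :: idx \<Rightarrow> real. prob_vec s \<longrightarrow> (\<Sum>i\<in>UNIV. (s i)\<^sup>2) \<le> 1 / k + offdiag_bound\<^sup>2 / k\<^sup>2 \<longrightarrow> low \<le> renyi_vec p s) \<and>
    (\<forall>(e :: idx \<times> idx \<Rightarrow> real) j. prob_vec e \<longrightarrow> 999 / 1000 / k \<le> e j \<longrightarrow> renyi_vec p e \<le> up) \<and>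
    3 / 17179869184 \<le> 2 * low - up"
proof -
  define c where "c = offdiag_bound"
  define l where "l = 999 / 1000 / k"
  define Q where "Q = 1 / k + c\<^sup>2 / k\<^sup>2"
  define \<kappa> where "\<kappa> = ln (2 :: real)"
  have k: "k = 4294967296" by (simp add: k_def card_idx k_par_def)
  have k_pos: "k > 0" by (simp add: k)
  have card2: "real CARD(idx \<times> idx) = k\<^sup>2" by (simp add: k_def power2_eq_square)
  have c: "c = 3225 / 1016" by (simp add: c_def offdiag_bound_def)
  have c0: "c \<ge> 0" by (simp add: c)
  have c2: "c\<^sup>2 \<le> 101 / 10" by (simp add: c power2_eq_square)
  have \<kappa>: "11 / 16 \<le> \<kappa>" using ln_2_ge by (simp add: \<kappa>_def)
  have ln_k: "ln k = 32 * \<kappa>"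
  proof -
    have "ln ((2 :: real) ^ 32) = 32 * \<kappa>" unfolding \<kappa>_def by (subst ln_realpow) simp_all
    then show ?thesis by (simp add: k)
  qed
  have l: "l > 0" "l \<le> 1" by (simp_all add: l_def k)
  have ln_Q: "ln Q \<le> - ln k + c\<^sup>2 / k"
  proof -
    have "Q = (1 + c\<^sup>2 / k) / k" using k_pos by (simp add: Q_def field_simps power2_eq_square)
    moreover have "1 + c\<^sup>2 / k > 0" using k_pos by (simp add: add_pos_nonneg)
    ultimately have "ln Q = - ln k + ln (1 + c\<^sup>2 / k)" using k_pos by (simp add: ln_div)
    also have "\<dots> \<le> - ln k + c\<^sup>2 / k" using k_pos by (simp add: ln_add_one_self_le_self)
    finally show ?thesis .
  qed
  have Bc: "ln ((1 + c) / k) \<le> - ln k + 9 / 4 * \<kappa>"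
  proof -
    have "real 4 * ln (1 + c) \<le> ln (2 ^ 9)" by (rule ln_mult_nat_le) (simp_all add: c power_divide)
    moreover have "ln ((2 :: real) ^ 9) = 9 * \<kappa>" unfolding \<kappa>_def by (subst ln_realpow) simp_all
    ultimately have "ln (1 + c) \<le> 9 / 4 * \<kappa>" by simp
    then show ?thesis using k_pos c0 by (simp add: ln_div)
  qed
  have entry: "s i \<le> (1 + c) / k"
    if "prob_vec s" "(\<Sum>i\<in>UNIV. (s i)\<^sup>2) \<le> 1 / k + c\<^sup>2 / k\<^sup>2" for s :: "idx \<Rightarrow> real" and i
    using entry_le_of_collision[OF that(1), of c i] that(2) c0 by (simp add: k_def)
  have ln_l: "- ln l \<le> ln k + 1 / 500"
  proof -
    have "ln l = ln (999 / 1000) - ln k" unfolding l_def using k_pos by (intro ln_divide_pos) auto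
    moreover have "- ln (999 / 1000 :: real) = ln (1000 / 999)" by (simp add: ln_div)
    moreover have "ln (1000 / 999 :: real) \<le> 1000 / 999 - 1" by (rule ln_le_minus_one) simp
    ultimately show ?thesis by simp
  qed
  consider "p \<le> 2" | x where "p = ereal x" "2 < x" "x \<le> 11 / 5" | x where "p = ereal x" "11 / 5 < x" | "p = \<infinity>"
  proof (cases p)
    case (real x)
    then show ?thesis using that by (cases "x \<le> 2"; cases "x \<le> 11 / 5") (auto simp: not_le)
  qed (use p that in auto)
  then show ?thesis
  proof cases
    case 1
    define t u where "t = 1 / k" and "u = 1 / (k * (k + 1))"
    have u: "0 < u" "u \<le> t" using k_pos by (auto simp: t_def u_def field_simps k)
    have tu: "t + real (CARD(idx \<times> idx) - 1) * u \<le> 1"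
    proof -
      have "real (CARD(idx \<times> idx) - 1) = k\<^sup>2 - 1"
        using card2 by (simp add: of_nat_diff card_gt_0_iff Suc_leI)
      then show ?thesis by (simp add: t_def u_def k)
    qed
    have "renyi_vec p e \<le> - ln u - l * (ln t - ln u)" if "prob_vec e" "l \<le> e j" for e :: "idx \<times> idx \<Rightarrow> real" and j
    proof -
      have "p \<noteq> \<infinity>" using 1 by auto
      then show ?thesis
        using renyi_vec_le_shannon[OF that(1) p] shannon_le_of_large_entry[OF that u tu] by linarith
    qed
    moreover have "- ln Q \<le> renyi_vec p s" if "prob_vec s" "(\<Sum>i\<in>UNIV. (s i)\<^sup>2) \<le> Q" for s :: "idx \<Rightarrow> real"
      by (rule renyi_vec_ge_collision[OF that(1) p 1 that(2)])
    moreover have "3 / 17179869184 \<le> 2 * (- ln Q) - (- ln u - l * (ln t - ln u))"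
    proof -
      have ln1: "ln (k + 1) \<le> ln k + 1 / k"
      proof -
        have "k + 1 = k * (1 + 1 / k)" using k_pos by (simp add: field_simps)
        then have "ln (k + 1) = ln (k * (1 + 1 / k))" by (rule arg_cong)
        also have "\<dots> = ln k + ln (1 + 1 / k)" using k_pos by (intro ln_mult_pos) (auto intro: add_pos_pos)
        also have "\<dots> \<le> ln k + 1 / k" using k_pos by (simp add: ln_add_one_self_le_self)
        finally show ?thesis .
      qed
      have lu: "ln u = - ln k - ln (k + 1)" and lt: "ln t = - ln k"
        using k_pos by (simp_all add: u_def t_def ln_div ln_mult)
      have "- ln u - l * (ln t - ln u) = ln k + (1 - l) * ln (k + 1)" unfolding lu lt by (simp add: algebra_simps)
      also have "(1 - l) * ln (k + 1) \<le> (1 - l) * (ln k + 1 / k)" using l ln1 by (intro mult_left_mono) auto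
      also have "\<dots> \<le> ln k + 1 / k - l * ln k"
      proof -
        have "(1 - l) * (1 / k) \<le> 1 * (1 / k)" using l k_pos by (intro mult_right_mono) auto
        then show ?thesis by (simp add: algebra_simps)
      qed
      finally have "2 * (- ln Q) - (- ln u - l * (ln t - ln u)) \<ge> l * ln k - 1 / k - 2 * (c\<^sup>2 / k)"
        using ln_Q by simp
      moreover have "l * ln k \<ge> l * 22" using l \<kappa> by (intro mult_left_mono) (auto simp: ln_k)
      moreover have "c\<^sup>2 / k \<le> 101 / 10 / k" using c2 k_pos by (intro divide_right_mono) auto
      moreover have "3 / 17179869184 \<le> l * 22 - 1 / k - 2 * (101 / 10 / k)" by (simp add: l_def k)
      ultimately show ?thesis by linarith
    qed
    ultimately show ?thesis unfolding c_def[symmetric] l_def[symmetric] Q_def[symmetric] by blast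
  next
    case (2 x)
    define low where "low = ln k - 3 / 8 * \<kappa> - c\<^sup>2 / k"
    define up where "up = - ln (l\<^sup>2 + (1 - 2 * l) / k\<^sup>2)"
    have "low \<le> renyi_vec p s" if s: "prob_vec s" "(\<Sum>i\<in>UNIV. (s i)\<^sup>2) \<le> Q" for s :: "idx \<Rightarrow> real"
    proof -
      have "(x - 2) * ln ((1 + c) / k) + ln Q \<le> (x - 2) * (- ln k + 9 / 4 * \<kappa>) + (- ln k + c\<^sup>2 / k)"
        using 2 Bc ln_Q by (intro add_mono mult_left_mono) auto
      also have "\<dots> = - (x - 1) * ln k + (x - 2) * (9 / 4 * \<kappa>) + c\<^sup>2 / k" by (simp add: algebra_simps)
      also have "\<dots> \<le> - (x - 1) * ln k + ((x - 1) / 6) * (9 / 4 * \<kappa>) + (x - 1) * (c\<^sup>2 / k)"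
      proof -
        have "(x - 2) * (9 / 4 * \<kappa>) \<le> ((x - 1) / 6) * (9 / 4 * \<kappa>)" using 2 \<kappa> by (intro mult_right_mono) auto
        moreover have "1 * (c\<^sup>2 / k) \<le> (x - 1) * (c\<^sup>2 / k)" using 2 k_pos by (intro mult_right_mono) auto
        ultimately show ?thesis by linarith
      qed
      also have "\<dots> = - (x - 1) * low"
      proof -
        have "- (x - 1) * a + ((x - 1) / 6) * (9 / 4 * q) + (x - 1) * b = - (x - 1) * (a - 3 / 8 * q - b)"
          for a q b by (simp add: field_simps)
        then show ?thesis unfolding low_def .
      qed
      finally have "1 / (x - 1) * ((x - 2) * ln ((1 + c) / k) + ln Q) \<le> 1 / (x - 1) * (- (x - 1) * low)"
        using 2 by (intro mult_left_mono) auto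
      also have "\<dots> = - low" using 2 by (simp add: field_simps)
      finally have "low \<le> - (1 / (x - 1)) * ((x - 2) * ln ((1 + c) / k) + ln Q)" by simp
      also have "\<dots> \<le> renyi_vec p s"
        using s entry[of s] 2 unfolding 2(1) Q_def by (intro renyi_vec_ge_interpolate) auto
      finally show ?thesis .
    qed
    moreover have "renyi_vec p e \<le> up" if e: "prob_vec e" "l \<le> e j" for e :: "idx \<times> idx \<Rightarrow> real" and j
    proof -
      have pos: "0 < l\<^sup>2 + (1 - 2 * l) / k\<^sup>2" by (simp add: l_def k power2_eq_square)
      have "1 / real CARD(idx \<times> idx) \<le> l" unfolding card2 by (simp add: l_def k power2_eq_square)
      from collision_ge_of_large_entry[OF e this]
      have "l\<^sup>2 + (1 - 2 * l) / k\<^sup>2 \<le> (\<Sum>i\<in>UNIV. (e i)\<^sup>2)" unfolding card2 .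
      then have "- ln (\<Sum>i\<in>UNIV. (e i)\<^sup>2) \<le> up" unfolding up_def using pos by simp
      then show ?thesis using renyi_vec_le_collision[OF e(1), of x] 2 by simp
    qed
    moreover have "3 / 17179869184 \<le> 2 * low - up"
    proof -
      have "l\<^sup>2 + (1 - 2 * l) / k\<^sup>2 \<ge> 199 / 100 / k\<^sup>2" by (simp add: l_def k power2_eq_square)
      then have "ln (199 / 100 / k\<^sup>2) \<le> - up" using k_pos unfolding up_def minus_minus by (intro ln_mono) auto
      then have "ln (199 / 100) - 2 * ln k \<le> - up"
        using k_pos by (subst (asm) ln_divide_pos) (auto simp: ln_realpow)
      moreover have "7 * \<kappa> \<le> 8 * ln (199 / 100 :: real)"
      proof -
        have "ln ((2 :: real) ^ 7) \<le> ln ((199 / 100) ^ 8)" by (intro ln_mono) (simp_all add: power_divide)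
        moreover have "ln ((2 :: real) ^ 7) = 7 * \<kappa>" unfolding \<kappa>_def by (subst ln_realpow) simp_all
        moreover have "ln ((199 / 100 :: real) ^ 8) = 8 * ln (199 / 100)" by (subst ln_realpow) simp_all
        ultimately show ?thesis by linarith
      qed
      moreover have "c\<^sup>2 / k \<le> 101 / 10 / k" using c2 k_pos by (intro divide_right_mono) auto
      moreover have "3 / 17179869184 \<le> 1 / 8 * (11 / 16) - 2 * (101 / 10 / k)" by (simp add: k)
      moreover have "g \<le> 2 * (K - 3 / 8 * \<kappa> - C) - up"
        if "E - 2 * K \<le> - up" "7 * \<kappa> \<le> 8 * E" "C \<le> D" "g \<le> 1 / 8 * (11 / 16) - 2 * D" for g E K C D
        using that \<kappa> by (simp add: field_simps)
      ultimately show ?thesis unfolding low_def by blast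
    qed
    ultimately show ?thesis unfolding c_def[symmetric] l_def[symmetric] Q_def[symmetric] by blast
  next
    case (3 x)
    have "- ln ((1 + c) / k) \<le> renyi_vec p s" if s: "prob_vec s" "(\<Sum>i\<in>UNIV. (s i)\<^sup>2) \<le> Q" for s :: "idx \<Rightarrow> real"
      using s entry[of s] p by (intro renyi_vec_ge_min) (auto simp: Q_def)
    moreover have "renyi_vec p e \<le> 11 / 6 * (ln k + 1 / 500)" if e: "prob_vec e" "l \<le> e j" for e :: "idx \<times> idx \<Rightarrow> real" and j
    proof -
      have "renyi_vec p e \<le> x / (x - 1) * (- ln l)"
        using renyi_vec_le_of_large_entry[OF e l(1), of x] 3 by simp
      also have "\<dots> \<le> 11 / 6 * (- ln l)"
        using 3 l by (intro mult_right_mono) (auto simp: divide_le_eq)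
      also have "\<dots> \<le> 11 / 6 * (ln k + 1 / 500)" using ln_l by (intro mult_left_mono) auto
      finally show ?thesis .
    qed
    moreover have "3 / 17179869184 \<le> 2 * (- ln ((1 + c) / k)) - 11 / 6 * (ln k + 1 / 500)"
    proof -
      have "11 / 6 * (ln k + 1 / 500) + 1 / 100 \<le> 2 * (ln k - 9 / 4 * \<kappa>)"
        unfolding ln_k using \<kappa> by (simp add: field_simps)
      moreover have "2 * (ln k - 9 / 4 * \<kappa>) \<le> 2 * (- ln ((1 + c) / k))" using Bc by simp
      moreover have "3 / 17179869184 \<le> (1 / 100 :: real)" by simp
      ultimately show ?thesis by argo
    qed
    ultimately show ?thesis unfolding c_def[symmetric] l_def[symmetric] Q_def[symmetric] by blast
  next
    case 4
    have "- ln ((1 + c) / k) \<le> renyi_vec p s" if s: "prob_vec s" "(\<Sum>i\<in>UNIV. (s i)\<^sup>2) \<le> Q" for s :: "idx \<Rightarrow> real"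
      using s entry[of s] p by (intro renyi_vec_ge_min) (auto simp: Q_def)
    moreover have "renyi_vec p e \<le> - ln l" if e: "prob_vec e" "l \<le> e j" for e :: "idx \<times> idx \<Rightarrow> real" and j
      unfolding 4 using e(2) l(1) by (rule renyi_vec_infinity_le_of_large_entry[of l e j])
    moreover have "3 / 17179869184 \<le> 2 * (- ln ((1 + c) / k)) - (- ln l)"
    proof -
      have "ln k + 1 / 500 + 1 / 100 \<le> 2 * (ln k - 9 / 4 * \<kappa>)"
        unfolding ln_k using \<kappa> by (simp add: field_simps)
      moreover have "2 * (ln k - 9 / 4 * \<kappa>) \<le> 2 * (- ln ((1 + c) / k))" using Bc by simp
      moreover have "3 / 17179869184 \<le> (1 / 100 :: real)" by simp
      ultimately show ?thesis using ln_l by argo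
    qed
    ultimately show ?thesis unfolding c_def[symmetric] l_def[symmetric] Q_def[symmetric] by blast
  qed
qed

section \<open>The order of \<open>SL\<^sub>2\<close> modulo a power of two\<close>

lemma odd_word_right_inverse:
  fixes x :: "'a::len word"
  assumes "odd x"
  shows "\<exists>y. x * y = 1"
proof -
  have "odd (uint x)"
  proof
    assume "even (uint x)"
    then obtain m where "uint x = 2 * m" by blast
    then have "x = 2 * of_int m" by (metis of_int_mult of_int_numeral word_of_int_uint)
    then show False using assms by simp
  qed
  then have "gcd (uint x) (2 ^ LENGTH('a)) = 1" by (simp add: coprime_iff_gcd_eq_1[symmetric])
  then obtain u v where "u * uint x + v * 2 ^ LENGTH('a) = 1" by (metis bezout_int)
  then have "of_int (u * uint x + v * 2 ^ LENGTH('a)) = (1 :: 'a word)" by simp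
  moreover have "of_int (2 ^ LENGTH('a)) = (0 :: 'a word)" using word_of_int_eq_0_iff dvd_refl by blast
  ultimately have "of_int u * x = 1" by (simp only: of_int_add of_int_mult mult_zero_right add_0_right word_of_int_uint)
  then show ?thesis by (metis mult.commute)
qed

lemma card_odd_words: "2 * card {x :: 'a::len word. odd x} = 2 ^ LENGTH('a)"
  and card_even_words: "card {x :: 'a::len word. even x} = card {x :: 'a word. odd x}"
proof -
  have "bij_betw (\<lambda>x. x + 1) {x :: 'a word. even x} {x. odd x}"
    by (rule bij_betwI[where g = "\<lambda>x. x - 1"]) auto
  then show 1: "card {x :: 'a word. even x} = card {x :: 'a word. odd x}" by (rule bij_betw_same_card)
  have "card (UNIV :: 'a word set) = card ({x :: 'a word. even x} \<union> {x. odd x})" by (rule arg_cong[of _ _ card]) auto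
  also have "\<dots> = card {x :: 'a word. even x} + card {x :: 'a word. odd x}" by (intro card_Un_disjoint) auto
  finally show "2 * card {x :: 'a word. odd x} = 2 ^ LENGTH('a)" using 1 by (simp add: card_word)
qed

text \<open>If \<open>a\<close> is odd, then \<open>b, c\<close> are free and determine \<open>d\<close>; if \<open>a\<close> is even, then \<open>b\<close> must be odd,
  \<open>d\<close> is free, and \<open>c\<close> is determined.\<close>

lemma card_det_1_quadruples:
  "card {(a, b, c, d :: 'a::len word). a * d - b * c = 1} = 3 * 2 ^ (3 * LENGTH('a) - 2)"
proof -
  define O' where "O' = {x :: 'a word. odd x}"
  define E where "E = {x :: 'a word. even x}"
  define S where "S = {(a, b, c, d :: 'a word). a * d - b * c = 1}"
  obtain inv where inv: "\<And>x :: 'a word. odd x \<Longrightarrow> x * inv x = 1" using odd_word_right_inverse by metis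
  have cancel: "x * (inv x * y) = y" if "odd x" for x y :: "'a word"
    using inv[OF that] by (metis mult.assoc mult_1)
  have cancel': "inv x * (x * y) = y" if "odd x" for x y :: "'a word"
    using inv[OF that] by (metis mult.assoc mult.commute mult_1)
  define \<phi> where "\<phi> = (\<lambda>(a, b, c). (a, b, c, inv a * (1 + b * c)))"
  define \<psi> where "\<psi> = (\<lambda>(a, b, d). (a, b, inv b * (a * d - 1), d))"
  have S: "S = \<phi> ` (O' \<times> UNIV \<times> UNIV) \<union> \<psi> ` (E \<times> O' \<times> UNIV)"
  proof (intro equalityI subsetI)
    fix z assume "z \<in> S"
    then obtain a b c d where z: "z = (a, b, c, d)" and det: "a * d - b * c = 1" by (auto simp: S_def)
    show "z \<in> \<phi> ` (O' \<times> UNIV \<times> UNIV) \<union> \<psi> ` (E \<times> O' \<times> UNIV)"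
    proof (cases "odd a")
      case True
      have "a * d = 1 + b * c" using det by (simp add: diff_eq_eq)
      then have "d = inv a * (1 + b * c)" using cancel'[OF True, of d] by simp
      then have "z = \<phi> (a, b, c)" by (simp add: \<phi>_def z)
      then show ?thesis using True by (auto simp: O'_def)
    next
      case False
      have bc: "b * c = a * d - 1" using det by (simp add: algebra_simps)
      then have "odd (b * c)" using False by simp
      then have b: "odd b" by simp
      have "c = inv b * (a * d - 1)" using cancel'[OF b, of c] bc by simp
      then have "z = \<psi> (a, b, d)" by (simp add: \<psi>_def z)
      then show ?thesis using False b by (auto simp: O'_def E_def)
    qed
  next
    fix z assume "z \<in> \<phi> ` (O' \<times> UNIV \<times> UNIV) \<union> \<psi> ` (E \<times> O' \<times> UNIV)"
    then show "z \<in> S" by (auto simp: S_def \<phi>_def \<psi>_def O'_def E_def cancel)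
  qed
  have "card S = card (\<phi> ` (O' \<times> UNIV \<times> UNIV)) + card (\<psi> ` (E \<times> O' \<times> UNIV))"
    unfolding S by (intro card_Un_disjoint) (auto simp: \<phi>_def \<psi>_def O'_def E_def)
  also have "card (\<phi> ` (O' \<times> UNIV \<times> UNIV)) = card (O' \<times> (UNIV :: 'a word set) \<times> (UNIV :: 'a word set))"
    by (intro card_image) (auto simp: inj_on_def \<phi>_def)
  also have "card (\<psi> ` (E \<times> O' \<times> UNIV)) = card (E \<times> O' \<times> (UNIV :: 'a word set))"
    by (intro card_image) (auto simp: inj_on_def \<psi>_def)
  finally have card_S: "card S = card O' * (2 ^ LENGTH('a) * 2 ^ LENGTH('a)) + card E * (card O' * 2 ^ LENGTH('a))"
    by (simp only: card_cartesian_product card_word)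
  obtain n where n: "LENGTH('a) = Suc n" using len_gt_0[where 'a = 'a] gr0_implies_Suc by blast
  have O': "card O' = 2 ^ n" using card_odd_words[where 'a = 'a] by (simp add: O'_def n)
  then have E: "card E = 2 ^ n" using card_even_words[where 'a = 'a] by (simp add: O'_def E_def)
  have e: "3 * Suc n - 2 = Suc (n + n + n)" by simp
  show ?thesis unfolding S_def[symmetric] card_S O' E n e
    by (simp only: power_Suc power_add algebra_simps)
qed

lemma card_SL2_words:
  "card {A :: 'a::len word^2^2. det A = 1} = 3 * 2 ^ (3 * LENGTH('a) - 2)"
proof -
  define m where "m = (\<lambda>(a, b, c, d :: 'a word). vector [vector [a, b], vector [c, d]] :: 'a word^2^2)"
  have "bij_betw m {(a, b, c, d). a * d - b * c = 1} {A. det A = 1}"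
    by (rule bij_betwI[where g = "\<lambda>A. (A $ 1 $ 1, A $ 1 $ 2, A $ 2 $ 1, A $ 2 $ 2)"])
       (auto simp: m_def det_2 vector_2 intro!: matrix_2x2_eqI)
  then show ?thesis using bij_betw_same_card card_det_1_quadruples by metis
qed

lemma card_SL2: "CARD(SL2) = 3 * 2 ^ 5268390106224805281791998"
proof -
  have "CARD(SL2) = card {A :: Z_M^2^2. det A = 1}" by (rule type_definition.card[OF type_definition_SL2])
  moreover have "3 * LENGTH(1756130035408268427264000) - 2 = 5268390106224805281791998" by simp
  ultimately show ?thesis by (simp only: card_SL2_words)
qed

section \<open>The violation of additivity\<close>

lemma sum_squared_eigenvalues:
  fixes V :: "complex^'n^'n"
  assumes V: "unitary_mat V" and \<sigma>: "\<sigma> = V ** diag_mat (\<lambda>i. of_real (e i)) ** adj_mat V"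
  shows "(\<Sum>i\<in>UNIV. (e i)\<^sup>2) = (\<Sum>i\<in>UNIV. \<Sum>j\<in>UNIV. (cmod (\<sigma> $ i $ j))\<^sup>2)"
proof -
  have "(\<Sum>i\<in>UNIV. (e i)\<^sup>2) = Re (trace (\<sigma> ** \<sigma>))"
    unfolding \<sigma> unitary_conj_diag_mult[OF V] trace_unitary_conj_diag[OF V] by (simp add: power2_eq_square)
  also have "\<sigma> ** \<sigma> = \<sigma> ** adj_mat \<sigma>" unfolding \<sigma> adj_unitary_conj_diag ..
  also have "Re (trace (\<sigma> ** adj_mat \<sigma>)) = (\<Sum>i\<in>UNIV. \<Sum>j\<in>UNIV. (cmod (\<sigma> $ i $ j))\<^sup>2)"
    by (simp add: trace_eq_sum matrix_mult_nth complex_mult_cnj cmod_power2)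
  finally show ?thesis .
qed

lemma damped_channel_collision:
  assumes \<rho>: "density_matrix \<rho>"
  shows "(\<Sum>i\<in>UNIV. \<Sum>j\<in>UNIV. (cmod (damped_channel U_mat F_mat \<rho> $ i $ j))\<^sup>2) \<le>
    1 / real CARD(idx) + offdiag_bound\<^sup>2 / (real CARD(idx))\<^sup>2"
proof -
  define k where "k = real CARD(idx)"
  have k: "k > 0" by (simp add: k_def)
  let ?\<sigma> = "damped_channel U_mat F_mat \<rho>"
  have diag: "cmod (?\<sigma> $ i $ i) = 1 / k" for i
    using \<rho> by (simp add: damped_channel_diag[OF unitary_U_mat] density_matrix_def k_def norm_divide)
  have off: "(cmod (?\<sigma> $ i $ j))\<^sup>2 = (cmod (overlap (F_mat ** \<rho> ** F_mat) i j))\<^sup>2 / k\<^sup>2" if "i \<noteq> j" for i j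
    using that by (simp add: damped_channel_def overlap_def matrix_mul_assoc k_def norm_divide power_divide)
  have "(\<Sum>i\<in>UNIV. \<Sum>j\<in>UNIV. (cmod (?\<sigma> $ i $ j))\<^sup>2) =
      (\<Sum>i\<in>UNIV. (cmod (?\<sigma> $ i $ i))\<^sup>2 + (\<Sum>j\<in>UNIV - {i}. (cmod (?\<sigma> $ i $ j))\<^sup>2))"
    by (intro sum.cong refl sum.remove) auto
  also have "\<dots> = (\<Sum>i\<in>(UNIV :: idx set). (1 / k)\<^sup>2) +
      (\<Sum>i\<in>UNIV. \<Sum>j\<in>UNIV - {i}. (cmod (overlap (F_mat ** \<rho> ** F_mat) i j))\<^sup>2) / k\<^sup>2"
  proof -
    have "(\<Sum>j\<in>UNIV - {i}. (cmod (?\<sigma> $ i $ j))\<^sup>2) =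
        (\<Sum>j\<in>UNIV - {i}. (cmod (overlap (F_mat ** \<rho> ** F_mat) i j))\<^sup>2) / k\<^sup>2" for i
      unfolding sum_divide_distrib by (intro sum.cong refl off) auto
    then show ?thesis by (simp add: diag sum.distrib sum_divide_distrib)
  qed
  also have "\<dots> \<le> (\<Sum>i\<in>(UNIV :: idx set). (1 / k)\<^sup>2) + offdiag_bound\<^sup>2 / k\<^sup>2"
    using sum_offdiag_overlap_le[OF \<rho>] by (intro add_left_mono divide_right_mono) auto
  also have "(\<Sum>i\<in>(UNIV :: idx set). (1 / k)\<^sup>2) = 1 / k"
    using k by (simp add: power2_eq_square k_def[symmetric])
  finally show ?thesis by (simp add: k_def)
qed

lemma exists_damping_complement: "\<exists>S. adj_mat S = S \<and> S ** S = mat 1 - F_mat ** F_mat"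
proof -
  obtain V and f :: "SL2 \<Rightarrow> real" where V: "unitary_mat V" and f: "\<And>i. 0 < f i" "\<And>i. f i \<le> 1"
    and F: "F_mat = V ** diag_mat (\<lambda>i. of_real (f i)) ** adj_mat V"
    using F_mat_spectral by metis
  define S where "S = V ** diag_mat (\<lambda>i. of_real (sqrt (1 - f i * f i))) ** adj_mat V"
  have "sqrt (1 - f i * f i) * sqrt (1 - f i * f i) = 1 - f i * f i" for i
    using mult_mono[of "f i" 1 "f i" 1] f[of i] by simp
  then have "S ** S = V ** diag_mat (\<lambda>i. of_real (1 - f i * f i)) ** adj_mat V"
    unfolding S_def unitary_conj_diag_mult[OF V] by simp
  also have "\<dots> = V ** diag_mat (\<lambda>i. 1) ** adj_mat V - V ** diag_mat (\<lambda>i. of_real (f i * f i)) ** adj_mat V"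
    by (simp only: unitary_conj_diag_diff of_real_diff of_real_1)
  also have "V ** diag_mat (\<lambda>i. of_real (f i * f i)) ** adj_mat V = F_mat ** F_mat"
    unfolding F by (rule unitary_conj_diag_mult[OF V, symmetric])
  also have "V ** diag_mat (\<lambda>i. 1) ** adj_mat V = mat 1" by (rule unitary_conj_1[OF V])
  finally have "S ** S = mat 1 - F_mat ** F_mat" .
  moreover have "adj_mat S = S" unfolding S_def by (rule adj_unitary_conj_diag)
  ultimately show ?thesis by blast
qed

lemma max_entangled_output_overlap_ge:
  "999 / 1000 / real CARD(idx) \<le> Re (cdot max_entangled
     (tensor_map (damped_channel U_mat F_mat) (damped_channel U_mat F_mat) (outer max_entangled) *v max_entangled))"
proof -
  define d where "d = real CARD(SL2)"
  define t where "t = (\<Sum>g\<in>UNIV. \<Sum>x\<in>UNIV. (F_mat $ g $ x)\<^sup>2)"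
  have d: "d > 0" by (simp add: d_def)
  obtain S where S: "adj_mat S = S" "S ** S = mat 1 - F_mat ** F_mat" using exists_damping_complement by blast
  obtain V and f :: "SL2 \<Rightarrow> real" where V: "unitary_mat V" and f: "\<And>i. 0 < f i" "\<And>i. f i \<le> 1"
    and F: "F_mat = V ** diag_mat (\<lambda>i. of_real (f i)) ** adj_mat V"
    and sum: "(\<Sum>i\<in>UNIV. 1 - f i) \<le> real CARD(SL2) / 10000"
    using F_mat_spectral by metis
  have "d - 3 * (d / 10000) \<le> d - 3 * (\<Sum>i\<in>UNIV. 1 - f i)" using sum by (simp add: d_def)
  also have "\<dots> \<le> Re t"
    unfolding t_def d_def using f by (intro damping_square_sum_bound[OF V F]) (auto intro: less_imp_le)
  also have "\<dots> \<le> cmod t" by (rule complex_Re_le_cmod)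
  finally have "(9997 / 10000 * d)\<^sup>2 \<le> (cmod t)\<^sup>2" using d by (intro power_mono) auto
  then have "(9997 / 10000)\<^sup>2 * d\<^sup>2 \<le> (cmod t)\<^sup>2" by (simp only: power_mult_distrib)
  then have "(9997 / 10000)\<^sup>2 \<le> (cmod t)\<^sup>2 / d\<^sup>2" using d by (subst pos_le_divide_eq) simp_all
  moreover have "(999 / 1000 :: real) \<le> (9997 / 10000)\<^sup>2" by (simp add: power2_eq_square)
  ultimately have "999 / 1000 \<le> (cmod t)\<^sup>2 / d\<^sup>2" by linarith
  then have "999 / 1000 / real CARD(idx) \<le> (cmod t)\<^sup>2 / d\<^sup>2 / real CARD(idx)" by (rule divide_right_mono) simp
  also have "\<dots> = (cmod t)\<^sup>2 / (real CARD(idx) * d\<^sup>2)" by simp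
  also have "\<dots> \<le> Re (cdot max_entangled
     (tensor_map (damped_channel U_mat F_mat) (damped_channel U_mat F_mat) (outer max_entangled) *v max_entangled))"
    unfolding t_def d_def
    by (rule max_entangled_output_overlap[OF adj_F_mat S unitary_U_mat U_mat_real])
  finally show ?thesis .
qed

theorem corollary1p2:
  fixes \<Phi> :: "complex^SL2^SL2 \<Rightarrow> complex^idx^idx"
  assumes \<Phi>: "\<And>\<rho>. \<Phi> \<rho> = (\<chi> i j.
      1 / of_nat k_par * trace (U_mat i ** F_mat ** \<rho> ** F_mat ** adj_mat (U_mat j))
      + (if i = j then 1 else 0) / of_nat k_par * trace ((mat 1 - F_mat ** F_mat) ** \<rho>))"
  shows "CARD(SL2) = 3 * 2 ^ 5268390106224805281791998 \<and>
    (\<forall>j. unitary_mat (U_mat j)) \<and>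
    invertible (mat 1 + R_mat) \<and>
    quantum_channel \<Phi> \<and>
    (\<forall>p :: ereal. 1 \<le> p \<longrightarrow>
       min_output_entropy p (tensor_map \<Phi> \<Phi>) < min_output_entropy p \<Phi> + min_output_entropy p \<Phi> \<and>
       2 * min_output_entropy p \<Phi> - min_output_entropy p (tensor_map \<Phi> \<Phi>) \<ge> 3 / 17179869184)"
proof -
  have \<Phi>_damped: "\<Phi> = damped_channel U_mat F_mat"
    by (rule ext) (simp only: \<Phi> damped_channel_def card_idx)
  obtain S where S: "adj_mat S = S" "S ** S = mat 1 - F_mat ** F_mat" using exists_damping_complement by blast
  define K where "K = damped_kraus U_mat F_mat S"
  have \<Phi>_kraus: "\<Phi> = kraus_map K UNIV"
    unfolding \<Phi>_damped K_def by (rule damped_channel_eq_kraus_map[OF adj_F_mat S])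
  have tr: "trace (\<Phi> A) = trace A" for A
    unfolding \<Phi>_damped by (rule trace_damped_channel[OF unitary_U_mat])
  have channel: "quantum_channel \<Phi>"
    unfolding quantum_channel_def using tr clinear_map_kraus_map[of K UNIV] completely_positive_kraus_map[of K UNIV]
    by (simp add: \<Phi>_kraus)
  have out: "density_matrix (\<Phi> \<rho>)" if "density_matrix \<rho>" for \<rho>
    using that tr[of \<rho>] psd_mat_kraus_map[of \<rho> K UNIV] by (simp add: density_matrix_def \<Phi>_kraus)
  have out2: "density_matrix (tensor_map \<Phi> \<Phi> \<rho>)" if "density_matrix \<rho>" for \<rho>
    using density_matrix_tensor_map[of K UNIV \<rho>] tr that by (simp add: \<Phi>_kraus)
  have gap: "2 * min_output_entropy p \<Phi> - min_output_entropy p (tensor_map \<Phi> \<Phi>) \<ge> 3 / 17179869184" if p: "1 \<le> p" for p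
  proof -
    let ?k = "real CARD(idx)"
    obtain low up where low: "\<And>s :: idx \<Rightarrow> real. prob_vec s \<Longrightarrow>
          (\<Sum>i\<in>UNIV. (s i)\<^sup>2) \<le> 1 / ?k + offdiag_bound\<^sup>2 / ?k\<^sup>2 \<Longrightarrow> low \<le> renyi_vec p s"
      and up: "\<And>(e :: idx \<times> idx \<Rightarrow> real) j. prob_vec e \<Longrightarrow> 999 / 1000 / ?k \<le> e j \<Longrightarrow> renyi_vec p e \<le> up"
      and low_up: "3 / 17179869184 \<le> 2 * low - up"
      using entropy_gap[OF p] by blast
    have "low \<le> renyi_entropy p (\<Phi> \<rho>)" if \<rho>: "density_matrix \<rho>" for \<rho>
    proof -
      obtain V and s :: "idx \<Rightarrow> real" where V: "unitary_mat V" and s: "prob_vec s"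
        and \<sigma>: "\<Phi> \<rho> = V ** diag_mat (\<lambda>i. of_real (s i)) ** adj_mat V"
        and ent: "\<And>p. renyi_entropy p (\<Phi> \<rho>) = renyi_vec p s"
        using density_matrix_spectral[OF out[OF \<rho>]] by metis
      have "(\<Sum>i\<in>UNIV. (s i)\<^sup>2) \<le> 1 / ?k + offdiag_bound\<^sup>2 / ?k\<^sup>2"
        using damped_channel_collision[OF \<rho>] unfolding sum_squared_eigenvalues[OF V \<sigma>] \<Phi>_damped .
      then show ?thesis unfolding ent by (rule low[OF s])
    qed
    moreover have "density_matrix (outer (axis (undefined :: SL2) 1))"
      by (rule density_matrix_outer) (simp add: norm_vec_def L2_set_def axis_def if_distrib[of cmod] if_distrib[of "\<lambda>x. x\<^sup>2"] cong: if_cong)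
    ultimately have ge: "low \<le> min_output_entropy p \<Phi>"
      unfolding min_output_entropy_def by (intro cINF_greatest) auto
    have nonneg: "0 \<le> renyi_entropy p (tensor_map \<Phi> \<Phi> \<rho>)" if \<rho>: "density_matrix \<rho>" for \<rho>
    proof -
      obtain V and s :: "idx \<times> idx \<Rightarrow> real" where s: "prob_vec s"
        and ent: "\<And>p. renyi_entropy p (tensor_map \<Phi> \<Phi> \<rho>) = renyi_vec p s"
        using density_matrix_spectral[OF out2[OF \<rho>]] by metis
      show ?thesis using renyi_vec_ge_min[OF s p prob_vec_le_1[OF s]] by (simp add: ent)
    qed
    define \<omega> where "\<omega> = outer (max_entangled :: complex^(SL2 \<times> SL2))"
    have \<omega>: "density_matrix \<omega>" unfolding \<omega>_def by (rule density_matrix_outer[OF norm_max_entangled])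
    have "min_output_entropy p (tensor_map \<Phi> \<Phi>) \<le> renyi_entropy p (tensor_map \<Phi> \<Phi> \<omega>)"
      unfolding min_output_entropy_def using nonneg \<omega> by (intro cINF_lower bdd_belowI2[of _ 0]) auto
    also have "\<dots> \<le> up"
    proof -
      obtain V and e :: "idx \<times> idx \<Rightarrow> real" where V: "unitary_mat V" and e: "prob_vec e"
        and \<sigma>: "tensor_map \<Phi> \<Phi> \<omega> = V ** diag_mat (\<lambda>i. of_real (e i)) ** adj_mat V"
        and ent: "\<And>p. renyi_entropy p (tensor_map \<Phi> \<Phi> \<omega>) = renyi_vec p e"
        using density_matrix_spectral[OF out2[OF \<omega>]] by metis
      have "\<exists>j. 999 / 1000 / ?k \<le> e j"
        using max_entangled_output_overlap_ge
        by (intro exists_large_eigenvalue[OF V norm_max_entangled]) (simp only: \<sigma>[symmetric] \<omega>_def \<Phi>_damped)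
      then show ?thesis unfolding ent using up[OF e] by blast
    qed
    finally show ?thesis using ge low_up by linarith
  qed
  have "min_output_entropy p (tensor_map \<Phi> \<Phi>) < min_output_entropy p \<Phi> + min_output_entropy p \<Phi>" if "1 \<le> p" for p
    using gap[OF that] by simp
  moreover have "invertible (mat 1 + R_mat)"
    using F_mat_spectral unfolding invertible_def by metis
  ultimately show ?thesis using gap channel card_SL2 unitary_U_mat by blast
qed

end
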